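(* Let $T_0\in C^{0,1}(\mathbb{R})$ be bounded and positive with $T_0(0)=T_M$, $T_0(y)>T_M$ if $y<0$ and $T_0(y)<T_M$ if $y>0$. Let also $T_0|_{\mathbb{R}_\pm}\in C^2(\mathbb{R}_\pm)$ with bounded first and second derivative. Then for a time $t^*>0$ small enough there exists a unique bounded solution $(T_1,T_2,s)\in \mathcal{C}^{0,1}_{t,y}((0,t^* )\times\mathbb{R}_-)\times \mathcal{C}^{0,1}_{t,y}((0,t^* )\times\mathbb{R}_+)\times C^1((0,t^* ))$ solving, in the distributional sense, the problem $$\begin{cases} \partial_t T_1(t,y)-\dot{s}(t)\partial_y T_1(t,y)=\frac{K}{C}\, \partial_{y}^2 T_1(t,y)& y<0,\\ \partial_t T_2(t,y)-\dot{s}(t)\partial_y T_2(t,y)=\partial_{y}^2 T_2(t,y)-I_\alpha[T_2](t,y)& y>0,\\ T_1(t,0)=T_2(t,0)=T_M, &\\ T_1(0,y)=T_0(y)\ (y<0), \quad T_2(0,y)=T_0(y)\ (y>0),&\\ \dot{s}(t)=\frac{1}{L}\left( \partial_{y} T_2(t,0^+)-K\partial_{y} T_1(t,0^-)\right)&t>0,\\ s(0)=0.& \end{cases}$$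
   Context: $K,C,L,\alpha,T_M>0$ are fixed constants. $\mathbb{R}_-$ and $\mathbb{R}_+$ are the negative and positive half-lines; $T_1$ is a function of $(t,y)$ with $y\in\mathbb{R}_-$ and $T_2$ of $(t,y)$ with $y\in\mathbb{R}_+$. The non-local radiation operator is $$I_\alpha[T](t,y)=T^4(t,y)-\int_0^\infty \frac{\alpha E_1(\alpha(y-\eta))}{2}T^4(t,\eta)\,d\eta,\qquad E_1(x)=\int_{|x|}^\infty \frac{e^{-r}}{r}\,dr .$$ $C^{0,1}(\mathbb{R})$ is the space of bounded Lipschitz functions. $\mathcal{C}^{n,k}_{t,y}((0,\tau)\times U)$ is the space of continuous functions $f$ on $(0,\tau)\times U$ having continuous derivatives $\partial_t^j f$ ($0\le j\le n$) and $\partial_y^l f$ ($0\le l\le k$); the functions and these derivatives are continuous up to the boundary, but they are not required to be bounded. Solving in the distributional sense means that the two parabolic equations hold in the sense of distributions on $(0,t^* )\times\mathbb{R}_-$ and $(0,t^* )\times\mathbb{R}_+$ respectively, while the boundary, initial and Stefan conditions hold pointwise. *)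

theory Defs
  imports "HOL-Analysis.Analysis"
begin

definition dt :: "(real \<Rightarrow> real \<Rightarrow> real) \<Rightarrow> real \<Rightarrow> real \<Rightarrow> real" where
  "dt f t y = deriv (\<lambda>t'. f t' y) t"

definition dy :: "(real \<Rightarrow> real \<Rightarrow> real) \<Rightarrow> real \<Rightarrow> real \<Rightarrow> real" where
  "dy f t y = deriv (\<lambda>y'. f t y') y"

definition continuous_up_to_boundary ::
  "(real \<times> real) set \<Rightarrow> (real \<Rightarrow> real \<Rightarrow> real) \<Rightarrow> bool" where
  "continuous_up_to_boundary Q f \<longleftrightarrow>
     (\<exists>g. continuous_on (closure Q) g \<and> (\<forall>(t, y) \<in> Q. g (t, y) = f t y))"

(* Meant for open U.  An element f is identified with its continuous extension to the closure,
   so that the values of f at t = 0 and on the boundary of U are its traces there.  The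
   derivatives are taken in the open cylinder only and extend continuously to the closure;
   neither f nor the derivatives need be bounded. *)
definition C_ty :: "nat \<Rightarrow> nat \<Rightarrow> real \<Rightarrow> real set \<Rightarrow> (real \<Rightarrow> real \<Rightarrow> real) set" where
  "C_ty n k \<tau> U = {f.
     continuous_on (closure ({0<..<\<tau>} \<times> U)) (\<lambda>(t, y). f t y) \<and>
     (\<forall>j<n. \<forall>t\<in>{0<..<\<tau>}. \<forall>y\<in>U. (\<lambda>t'. (dt ^^ j) f t' y) field_differentiable (at t)) \<and>
     (\<forall>l<k. \<forall>t\<in>{0<..<\<tau>}. \<forall>y\<in>U. (\<lambda>y'. (dy ^^ l) f t y') field_differentiable (at y)) \<and>
     (\<forall>j\<le>n. continuous_up_to_boundary ({0<..<\<tau>} \<times> U) ((dt ^^ j) f)) \<and>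
     (\<forall>l\<le>k. continuous_up_to_boundary ({0<..<\<tau>} \<times> U) ((dy ^^ l) f))}"

definition bounded_lipschitz :: "(real \<Rightarrow> real) \<Rightarrow> bool" where
  "bounded_lipschitz f \<longleftrightarrow> bounded (range f) \<and> (\<exists>M. M-lipschitz_on UNIV f)"

(* Meant for open S. *)
definition C_on :: "nat \<Rightarrow> real set \<Rightarrow> (real \<Rightarrow> real) \<Rightarrow> bool" where
  "C_on k S f \<longleftrightarrow>
     (\<forall>j<k. \<forall>y\<in>S. (deriv ^^ j) f field_differentiable (at y)) \<and>
     continuous_on S ((deriv ^^ k) f)"

primrec C_plane :: "nat \<Rightarrow> (real \<Rightarrow> real \<Rightarrow> real) \<Rightarrow> bool" where
  "C_plane 0 \<phi> \<longleftrightarrow> continuous_on UNIV (\<lambda>(t, y). \<phi> t y)"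
| "C_plane (Suc k) \<phi> \<longleftrightarrow>
     (\<forall>p. (\<lambda>(t, y). \<phi> t y) differentiable (at p)) \<and> C_plane k (dt \<phi>) \<and> C_plane k (dy \<phi>)"

definition test_functions :: "(real \<times> real) set \<Rightarrow> (real \<Rightarrow> real \<Rightarrow> real) set" where
  "test_functions Q = {\<phi>. (\<forall>k. C_plane k \<phi>) \<and>
     compact (closure {(t, y). \<phi> t y \<noteq> 0}) \<and> closure {(t, y). \<phi> t y \<noteq> 0} \<subseteq> Q}"

(* Distributions on Q are represented as functionals, applied only to test functions on Q. *)
type_synonym distribution = "(real \<Rightarrow> real \<Rightarrow> real) \<Rightarrow> real"

definition distr_of :: "(real \<times> real) set \<Rightarrow> (real \<Rightarrow> real \<Rightarrow> real) \<Rightarrow> distribution" where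
  "distr_of Q f \<phi> = set_lebesgue_integral lborel Q (\<lambda>(t, y). f t y * \<phi> t y)"

definition distr_dt :: "distribution \<Rightarrow> distribution" where
  "distr_dt u \<phi> = - u (dt \<phi>)"

definition distr_dy :: "distribution \<Rightarrow> distribution" where
  "distr_dy u \<phi> = - u (dy \<phi>)"

(* For x = 0 the mathematical value is infinite, whereas the Bochner integral is 0 by convention;
   in I_op this concerns only the null set consisting of the point \<eta> = y. *)
definition E1 :: "real \<Rightarrow> real" where
  "E1 x = set_lebesgue_integral lborel {\<bar>x\<bar>..} (\<lambda>r. exp (- r) / r)"

definition I_op :: "real \<Rightarrow> (real \<Rightarrow> real \<Rightarrow> real) \<Rightarrow> real \<Rightarrow> real \<Rightarrow> real" where
  "I_op \<alpha> T t y = (T t y) ^ 4 -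
     set_lebesgue_integral lborel {0..} (\<lambda>\<eta>. \<alpha> * E1 (\<alpha> * (y - \<eta>)) / 2 * (T t \<eta>) ^ 4)"

(* The Lim terms are the one-sided traces of the space derivatives at the interface; the limits
   exist by membership in C_ty.  Likewise s(0) is the trace of s at t = 0, whence the
   continuity requirement at 0.  The products s'(t) * dy T are continuous functions, so they
   enter the equations as regular distributions. *)
definition bounded_stefan_solution ::
  "real \<Rightarrow> real \<Rightarrow> real \<Rightarrow> real \<Rightarrow> real \<Rightarrow> (real \<Rightarrow> real) \<Rightarrow> real \<Rightarrow>
   (real \<Rightarrow> real \<Rightarrow> real) \<Rightarrow> (real \<Rightarrow> real \<Rightarrow> real) \<Rightarrow> (real \<Rightarrow> real) \<Rightarrow> bool" where
  "bounded_stefan_solution K C L \<alpha> TM T0 \<tau> T1 T2 s \<longleftrightarrow>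
     (let Q1 = {0<..<\<tau>} \<times> {..<0}; Q2 = {0<..<\<tau>} \<times> {0<..} in
       T1 \<in> C_ty 0 1 \<tau> {..<0} \<and> T2 \<in> C_ty 0 1 \<tau> {0<..} \<and>
       s C1_differentiable_on {0<..<\<tau>} \<and> continuous_on {0..<\<tau>} s \<and>
       bounded ((\<lambda>(t, y). T1 t y) ` Q1) \<and> bounded ((\<lambda>(t, y). T2 t y) ` Q2) \<and>
       bounded (s ` {0<..<\<tau>}) \<and>
       (\<forall>\<phi> \<in> test_functions Q1.
          distr_dt (distr_of Q1 T1) \<phi> - distr_of Q1 (\<lambda>t y. deriv s t * dy T1 t y) \<phi>
            = K / C * distr_dy (distr_dy (distr_of Q1 T1)) \<phi>) \<and>
       (\<forall>\<phi> \<in> test_functions Q2.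
          distr_dt (distr_of Q2 T2) \<phi> - distr_of Q2 (\<lambda>t y. deriv s t * dy T2 t y) \<phi>
            = distr_dy (distr_dy (distr_of Q2 T2)) \<phi> - distr_of Q2 (I_op \<alpha> T2) \<phi>) \<and>
       (\<forall>t\<in>{0<..<\<tau>}. T1 t 0 = TM \<and> T2 t 0 = TM) \<and>
       (\<forall>y<0. T1 0 y = T0 y) \<and> (\<forall>y>0. T2 0 y = T0 y) \<and>
       (\<forall>t\<in>{0<..<\<tau>}. deriv s t =
          1 / L * (Lim (at_right 0) (\<lambda>y. dy T2 t y) - K * Lim (at_left 0) (\<lambda>y. dy T1 t y))) \<and>
       s 0 = 0)"

end

theory Submission
  imports Defs "HOL-Probability.Distributions"
begin

text \<open>
After the reflection \<open>y \<mapsto> -y\<close> of the first phase, both phases are heat equations on the positive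
half-line, with Dirichlet value \<open>TM\<close> at \<open>y = 0\<close>, a drift given by the interface speed, and, in the second
phase, the radiation term. The speed is a combination of the two boundary gradients, so the nonlinearity
involves the gradient only through its trace at \<open>y = 0\<close>.

Existence. Write each temperature as its initial profile plus a correction. The correction vanishes at time 0
and at \<open>y = 0\<close>, and its source is bounded as long as its gradient is. Extending the source as an odd
function of \<open>y\<close> removes the boundary: the correction is the Gaussian potential of the extended source. The
potential and its gradient are continuous up to \<open>y = 0\<close> and \<open>t = 0\<close> and bounded by constant multiples of \<open>t\<close> and
of \<open>sqrt t\<close> times the bound of the source. The source depends in a Lipschitz way on the corrections and their
gradients, so for a short time the Banach fixed point theorem applies to bounded continuous states (lemma
\<open>stefan_data.local_existence\<close>). That the potential solves the equation weakly is Fubini's theorem together with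
the identity \<open>backward_duhamel\<close> for test functions.

Uniqueness. The gradient of an arbitrary solution may be unbounded far from the interface, so
the norms of the existence proof are not available, and the maximum principle takes their place. Let \<open>w\<close> be the
difference between an arbitrary solution and the constructed one, and let the two agree up to time \<open>a\<close>. Then
\<open>w\<close> solves a heat equation with drift whose source is bounded by \<open>H = S * P + c * W\<close>, where \<open>S\<close> and \<open>W\<close> bound the
differences of the speeds and of the second-phase temperatures after time \<open>a\<close>, and \<open>P\<close> bounds the gradient of the
constructed solution. Comparison with an exponential barrier gives \<open>\<bar>w\<bar> \<le> H * (t - a)\<close>, and comparison with
a parabola on \<open>0 < y < l\<close> bounds the boundary gradient of \<open>w\<close> by a multiple of \<open>l * H\<close> up to time \<open>a + l\<^sup>2\<close>.
Hence \<open>S\<close> and \<open>W\<close> are at most small multiples of \<open>H\<close>, so \<open>H = 0\<close>, and time steps of a uniform length cover the whole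
interval (lemma \<open>two_half_line_solutions.unique\<close>). The comparison principle for weak solutions is obtained by
mollification, from the classical argument at an interior maximum.
\<close>

section \<open>Dominated limits and derivatives of integrals\<close>

text \<open>
The exceptional null set may depend on the point \<open>x\<close>: the integrands of the radiation operator and of the heat
potential jump across sets that move with the parameter.
\<close>

lemma continuous_on_integral_dominated:
  fixes f :: "'b::metric_space \<Rightarrow> 'a \<Rightarrow> real"
  assumes meas: "\<And>x. x \<in> S \<Longrightarrow> f x \<in> borel_measurable M"
    and lim: "\<And>x. x \<in> S \<Longrightarrow> AE \<omega> in M. continuous (at x within S) (\<lambda>x. f x \<omega>)"
    and bound: "\<And>x. x \<in> S \<Longrightarrow> AE \<omega> in M. \<bar>f x \<omega>\<bar> \<le> m \<omega>"
    and m: "integrable M m"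
  shows "continuous_on S (\<lambda>x. integral\<^sup>L M (f x))"
proof (rule continuous_on_sequentiallyI)
  fix X x assume X: "\<forall>n. X n \<in> S" "x \<in> S" "X \<longlonglongrightarrow> x"
  show "(\<lambda>n. integral\<^sup>L M (f (X n))) \<longlonglongrightarrow> integral\<^sup>L M (f x)"
  proof (rule integral_dominated_convergence[where w=m])
    show "AE \<omega> in M. (\<lambda>n. f (X n) \<omega>) \<longlonglongrightarrow> f x \<omega>"
      using lim[OF X(2)] by eventually_elim (use X in \<open>auto simp: continuous_within_sequentially comp_def\<close>)
    show "AE \<omega> in M. norm (f (X i) \<omega>) \<le> m \<omega>" for i
      using bound[of "X i"] X by simp
  qed (use meas m X in auto)
qed

text \<open>
By the mean value theorem the bound on the derivative also dominates the difference quotients.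
\<close>

lemma has_real_derivative_integral_dominated:
  fixes f f' :: "real \<Rightarrow> 'a \<Rightarrow> real"
  assumes ab: "a < x0" "x0 < b"
    and deriv: "\<And>x \<omega>. a < x \<Longrightarrow> x < b \<Longrightarrow> \<omega> \<in> space M \<Longrightarrow>
        ((\<lambda>x. f x \<omega>) has_real_derivative f' x \<omega>) (at x)"
    and int: "\<And>x. a < x \<Longrightarrow> x < b \<Longrightarrow> integrable M (f x)"
    and meas: "f' x0 \<in> borel_measurable M"
    and bound: "\<And>x \<omega>. a < x \<Longrightarrow> x < b \<Longrightarrow> \<omega> \<in> space M \<Longrightarrow> \<bar>f' x \<omega>\<bar> \<le> m \<omega>"
    and m: "integrable M m"
  shows "((\<lambda>x. integral\<^sup>L M (f x)) has_real_derivative integral\<^sup>L M (f' x0)) (at x0)"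
proof -
  have "(\<lambda>n. (integral\<^sup>L M (f (X n)) - integral\<^sup>L M (f x0)) / (X n - x0)) \<longlonglongrightarrow> integral\<^sup>L M (f' x0)"
    if X: "X \<longlonglongrightarrow> x0" and ne: "\<And>n. X n \<noteq> x0" and S: "\<And>n. a < X n \<and> X n < b" for X
  proof -
    have "(\<lambda>n. integral\<^sup>L M (\<lambda>\<omega>. (f (X n) \<omega> - f x0 \<omega>) / (X n - x0))) \<longlonglongrightarrow> integral\<^sup>L M (f' x0)"
    proof (rule integral_dominated_convergence[where w=m])
      show "AE \<omega> in M. (\<lambda>n. (f (X n) \<omega> - f x0 \<omega>) / (X n - x0)) \<longlonglongrightarrow> f' x0 \<omega>"
      proof (rule AE_I2)
        fix \<omega> assume "\<omega> \<in> space M"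
        from deriv[OF ab this] have "((\<lambda>y. (f y \<omega> - f x0 \<omega>) / (y - x0)) \<longlongrightarrow> f' x0 \<omega>) (at x0)"
          by (simp add: has_field_derivative_iff)
        then show "(\<lambda>n. (f (X n) \<omega> - f x0 \<omega>) / (X n - x0)) \<longlonglongrightarrow> f' x0 \<omega>"
          using X ne unfolding tendsto_at_iff_sequentially by (auto simp: comp_def)
      qed
      show "AE \<omega> in M. norm ((f (X i) \<omega> - f x0 \<omega>) / (X i - x0)) \<le> m \<omega>" for i
      proof (rule AE_I2)
        fix \<omega> assume w: "\<omega> \<in> space M"
        have "norm (f (X i) \<omega> - f x0 \<omega>) \<le> m \<omega> * norm (X i - x0)"
        proof (rule field_differentiable_bound[where S="{a<..<b}" and f'="\<lambda>x. f' x \<omega>"])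
          show "((\<lambda>x. f x \<omega>) has_field_derivative f' z \<omega>) (at z within {a<..<b})" if "z \<in> {a<..<b}" for z
            using deriv[of z \<omega>] that w by (auto intro: DERIV_subset)
        qed (use bound w ab S in auto)
        then show "norm ((f (X i) \<omega> - f x0 \<omega>) / (X i - x0)) \<le> m \<omega>"
          using ne[of i] by (simp add: divide_le_eq)
      qed
    qed (use meas m int ab S in auto)
    then show ?thesis using int ab S by simp
  qed note seq = this
  have "((\<lambda>y. (integral\<^sup>L M (f y) - integral\<^sup>L M (f x0)) / (y - x0)) \<longlongrightarrow> integral\<^sup>L M (f' x0)) (at x0)"
    unfolding tendsto_at_iff_sequentially comp_def
  proof (intro allI impI)
    fix X assume X: "\<forall>i. X i \<in> UNIV - {x0}" "X \<longlonglongrightarrow> x0"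
    have "eventually (\<lambda>n. X n \<in> {a<..<b}) sequentially"
      using X(2) ab by (intro topological_tendstoD) auto
    then obtain N where N: "\<And>n. n \<ge> N \<Longrightarrow> X n \<in> {a<..<b}" by (auto simp: eventually_sequentially)
    have "(\<lambda>n. (integral\<^sup>L M (f (X (n+N))) - integral\<^sup>L M (f x0)) / (X (n+N) - x0)) \<longlonglongrightarrow> integral\<^sup>L M (f' x0)"
      by (rule seq) (use X N LIMSEQ_ignore_initial_segment[OF X(2)] in auto)
    then show "(\<lambda>n. (integral\<^sup>L M (f (X n)) - integral\<^sup>L M (f x0)) / (X n - x0)) \<longlonglongrightarrow> integral\<^sup>L M (f' x0)"
      by (rule LIMSEQ_offset)
  qed
  then show ?thesis by (simp add: has_field_derivative_iff)
qed

section \<open>A smooth bump function\<close>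

text \<open>
With this recursion, closure under products and affine substitutions is an induction on the order that needs no
formula for higher derivatives.
\<close>

primrec differentiable_times :: "nat \<Rightarrow> (real \<Rightarrow> real) \<Rightarrow> bool" where
  "differentiable_times 0 f = True"
| "differentiable_times (Suc n) f =
    (\<exists>f'. (\<forall>x. (f has_real_derivative f' x) (at x)) \<and> differentiable_times n f')"

definition smooth :: "(real \<Rightarrow> real) \<Rightarrow> bool" where
  "smooth f \<longleftrightarrow> (\<forall>n. differentiable_times n f)"

lemma differentiable_times_Suc_D: "differentiable_times (Suc n) f \<Longrightarrow> differentiable_times n f"
  by (induction n arbitrary: f) auto

lemma differentiable_times_add:
  "differentiable_times n f \<Longrightarrow> differentiable_times n g \<Longrightarrow> differentiable_times n (\<lambda>x. f x + g x)"
proof (induction n arbitrary: f g)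
  case (Suc n)
  then obtain f' g' where "\<And>x. (f has_real_derivative f' x) (at x)" "differentiable_times n f'"
     "\<And>x. (g has_real_derivative g' x) (at x)" "differentiable_times n g'" by auto
  with Suc.IH show ?case by (auto intro!: exI[of _ "\<lambda>x. f' x + g' x"] derivative_eq_intros)
qed simp

lemma differentiable_times_mult:
  "differentiable_times n f \<Longrightarrow> differentiable_times n g \<Longrightarrow> differentiable_times n (\<lambda>x. f x * g x)"
proof (induction n arbitrary: f g)
  case (Suc n)
  then obtain f' g' where *: "\<And>x. (f has_real_derivative f' x) (at x)" "differentiable_times n f'"
     "\<And>x. (g has_real_derivative g' x) (at x)" "differentiable_times n g'" by auto
  have "differentiable_times n (\<lambda>x. f' x * g x + f x * g' x)"
    using Suc.prems[THEN differentiable_times_Suc_D] * by (intro differentiable_times_add Suc.IH)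
  with * show ?case
    by (auto intro!: exI[of _ "\<lambda>x. f' x * g x + f x * g' x"] derivative_eq_intros)
qed simp

lemma differentiable_times_const: "differentiable_times n (\<lambda>x. c)"
  by (induction n arbitrary: c) (auto intro!: exI[of _ "\<lambda>x. 0"])

lemma differentiable_times_affine:
  "differentiable_times n f \<Longrightarrow> differentiable_times n (\<lambda>x. f (a * x + b))"
proof (induction n arbitrary: f)
  case (Suc n)
  then obtain f' where *: "\<And>x. (f has_real_derivative f' x) (at x)" "differentiable_times n f'" by auto
  have "differentiable_times n (\<lambda>x. f' (a * x + b) * a)"
    using * Suc.IH by (intro differentiable_times_mult differentiable_times_const)
  moreover have "((\<lambda>x. f (a * x + b)) has_real_derivative f' (a * x + b) * a) (at x)" for x
    by (rule DERIV_chain2[OF *(1)]) (auto intro!: derivative_eq_intros)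
  ultimately show ?case by (auto intro!: exI[of _ "\<lambda>x. f' (a * x + b) * a"])
qed simp

lemma smooth_mult: "smooth f \<Longrightarrow> smooth g \<Longrightarrow> smooth (\<lambda>x. f x * g x)"
  and smooth_const: "smooth (\<lambda>x. c)"
  and smooth_affine: "smooth f \<Longrightarrow> smooth (\<lambda>x. f (a * x + b))"
  by (simp_all add: smooth_def differentiable_times_mult differentiable_times_const differentiable_times_affine)

lemma smooth_DERIV: "smooth f \<Longrightarrow> (f has_real_derivative deriv f x) (at x)"
proof -
  assume "smooth f"
  then have "differentiable_times (Suc 0) f" unfolding smooth_def by blast
  then show ?thesis by (auto simp: DERIV_deriv_iff_real_differentiable real_differentiable_def)
qed

lemma smooth_deriv: "smooth f \<Longrightarrow> smooth (deriv f)"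
  unfolding smooth_def
proof
  fix n assume "\<forall>n. differentiable_times n f"
  then have "differentiable_times (Suc n) f" by blast
  then obtain f' where *: "\<And>x. (f has_real_derivative f' x) (at x)" "differentiable_times n f'" by auto
  then have "deriv f = f'" by (auto intro: DERIV_imp_deriv)
  with * show "differentiable_times n (deriv f)" by simp
qed

lemma smooth_continuous: "smooth f \<Longrightarrow> continuous_on S f"
  using smooth_DERIV by (meson DERIV_isCont continuous_at_imp_continuous_on)

lemma poly_div_exp_tendsto_0: "((\<lambda>x. poly p x / exp x) \<longlongrightarrow> (0::real)) at_top"
proof -
  have "((\<lambda>x. \<Sum>i\<le>degree p. coeff p i * (x ^ i / exp x)) \<longlongrightarrow> (\<Sum>i\<le>degree p. coeff p i * 0)) at_top"
    by (intro tendsto_intros tendsto_power_div_exp_0)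
  then show ?thesis by (simp add: poly_altdef sum_divide_distrib)
qed

text \<open>
The functions \<open>p (1/x) * exp (-1/x)\<close>, continued by 0 to \<open>x \<le> 0\<close>, form a family that is closed under
differentiation; \<open>p = 1\<close> gives the standard flat function.
\<close>

definition flat_exp :: "real poly \<Rightarrow> real \<Rightarrow> real" where
  "flat_exp p x = (if x > 0 then poly p (1 / x) * exp (- (1 / x)) else 0)"

lemma DERIV_flat_exp:
  "(flat_exp p has_real_derivative flat_exp ([:0,0,1:] * (p - pderiv p)) x) (at x)"
proof -
  consider "x > 0" | "x < 0" | "x = 0" by linarith
  then show ?thesis
  proof cases
    case 1
    have "((\<lambda>x. poly p (1 / x) * exp (- (1 / x))) has_real_derivative
        flat_exp ([:0,0,1:] * (p - pderiv p)) x) (at x)"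
      unfolding flat_exp_def using 1
      by (auto intro!: derivative_eq_intros DERIV_chain2[OF poly_DERIV] simp: field_simps)
    then show ?thesis
      by (rule has_field_derivative_transform_within_open[where S="{0<..}"]) (use 1 in \<open>auto simp: flat_exp_def\<close>)
  next
    case 2
    have "((\<lambda>x. 0) has_real_derivative flat_exp ([:0,0,1:] * (p - pderiv p)) x) (at x)"
      using 2 by (auto simp: flat_exp_def)
    then show ?thesis
      by (rule has_field_derivative_transform_within_open[where S="{..<0}"]) (use 2 in \<open>auto simp: flat_exp_def\<close>)
  next
    (* With y = 1/x the difference quotient becomes a polynomial divided by an exponential. *)
    case 3
    have "((\<lambda>y. poly (pCons 0 p) (inverse y) / exp (inverse y)) \<longlongrightarrow> 0) (at_right 0)"
      by (rule filterlim_compose[OF poly_div_exp_tendsto_0 filterlim_inverse_at_top_right])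
    then have "((\<lambda>y. flat_exp p y / y) \<longlongrightarrow> 0) (at_right 0)"
      by (rule Lim_transform_eventually)
        (auto simp: eventually_at_filter flat_exp_def field_simps exp_minus)
    moreover have "((\<lambda>y. flat_exp p y / y) \<longlongrightarrow> 0) (at_left 0)"
      by (rule Lim_transform_eventually[OF tendsto_const])
        (auto simp: eventually_at_filter flat_exp_def)
    ultimately have "((\<lambda>y. flat_exp p y / y) \<longlongrightarrow> 0) (at 0)" by (simp add: filterlim_split_at)
    with 3 show ?thesis by (simp add: has_field_derivative_iff flat_exp_def)
  qed
qed

lemma smooth_flat_exp: "smooth (flat_exp p)"
proof -
  have "differentiable_times n (flat_exp p)" for n
    by (induction n arbitrary: p) (use DERIV_flat_exp in auto)
  then show ?thesis by (simp add: smooth_def)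
qed

text \<open>
The product of the flat functions of \<open>\<epsilon> + x\<close> and of \<open>\<epsilon> - x\<close>, normalised.
\<close>

lemma smooth_mollifier_exists:
  assumes "\<epsilon> > (0::real)"
  obtains \<rho> where "smooth \<rho>" "\<And>x. \<rho> x \<ge> 0" "\<And>x. \<bar>x\<bar> \<ge> \<epsilon> \<Longrightarrow> \<rho> x = 0"
    "integrable lborel \<rho>" "integral\<^sup>L lborel \<rho> = 1"
proof -
  define b where "b x = flat_exp 1 (1 * x + \<epsilon>) * flat_exp 1 ((-1) * x + \<epsilon>)" for x
  have sm: "smooth b" unfolding b_def by (intro smooth_mult smooth_affine smooth_flat_exp)
  have nn: "b x \<ge> 0" for x by (auto simp: b_def flat_exp_def)
  have z: "b x = 0" if "\<bar>x\<bar> \<ge> \<epsilon>" for x using that assms by (auto simp: b_def flat_exp_def)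
  have pos: "b x > 0" if "\<bar>x\<bar> < \<epsilon>" for x using that assms by (auto simp: b_def flat_exp_def)
  have c: "continuous_on UNIV b" using sm smooth_continuous by blast
  have "integrable lborel (\<lambda>x. indicator {-\<epsilon>..\<epsilon>} x *\<^sub>R b x)"
    using borel_integrable_atLeastAtMost'[of "-\<epsilon>" \<epsilon> b] c continuous_on_subset
    unfolding set_integrable_def by blast
  moreover have eq: "indicator {-\<epsilon>..\<epsilon>} x *\<^sub>R b x = b x" for x using z[of x] by (cases "\<bar>x\<bar> < \<epsilon>") (auto simp: indicator_def)
  ultimately have i: "integrable lborel b" by (subst (asm) eq) 
  have "integral\<^sup>L lborel b \<noteq> 0"
  proof
    assume "integral\<^sup>L lborel b = 0"
    then have "AE x in lborel. b x = 0" using integral_nonneg_eq_0_iff_AE[OF i] nn by auto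
    then have "AE x in lborel. x \<notin> {-\<epsilon><..<\<epsilon>}" 
    proof eventually_elim
      case (elim x)
      then show ?case using pos[of x] by (auto simp: abs_less_iff)
    qed
    then have "emeasure lborel {-\<epsilon><..<\<epsilon>} = 0"
      using AE_iff_null_sets[of "{-\<epsilon><..<\<epsilon>}" lborel] by (simp add: null_sets_def)
    then show False using assms by simp
  qed
  then have ip: "integral\<^sup>L lborel b > 0" using nn by (simp add: less_le)
  show ?thesis
  proof (rule that[of "\<lambda>x. (1 / integral\<^sup>L lborel b) * b x"])
    show "smooth (\<lambda>x. (1 / integral\<^sup>L lborel b) * b x)" by (rule smooth_mult[OF smooth_const sm])
  qed (use i ip nn z in auto)
qed

section \<open>Test functions\<close>

lemma test_C_plane: "\<phi> \<in> test_functions Q \<Longrightarrow> C_plane k \<phi>"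
  by (auto simp: test_functions_def)

lemma test_differentiable: "\<phi> \<in> test_functions Q \<Longrightarrow> (\<lambda>(t, y). \<phi> t y) differentiable (at p)"
  using test_C_plane[of \<phi> Q "Suc 0"] by (cases p) simp

lemma test_continuous: "\<phi> \<in> test_functions Q \<Longrightarrow> continuous_on S (\<lambda>(t, y). \<phi> t y)"
  using test_C_plane[of \<phi> Q 0] continuous_on_subset by fastforce

lemma test_DERIV_dt: "\<phi> \<in> test_functions Q \<Longrightarrow> ((\<lambda>t. \<phi> t y) has_real_derivative dt \<phi> t y) (at t)"
proof -
  assume "\<phi> \<in> test_functions Q"
  from test_differentiable[OF this, of "(t,y)"] have "(\<lambda>t. case (t, y) of (t, y) \<Rightarrow> \<phi> t y) differentiable (at t)"
    by (rule differentiable_compose[where g="\<lambda>t. (t,y)" and f="\<lambda>(t, y). \<phi> t y"])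
      (simp_all add: differentiable_Pair)
  then show ?thesis by (simp add: dt_def DERIV_deriv_iff_real_differentiable)
qed

lemma test_DERIV_dy: "\<phi> \<in> test_functions Q \<Longrightarrow> ((\<lambda>y. \<phi> t y) has_real_derivative dy \<phi> t y) (at y)"
proof -
  assume "\<phi> \<in> test_functions Q"
  from test_differentiable[OF this, of "(t,y)"] have "(\<lambda>y. case (t, y) of (t, y) \<Rightarrow> \<phi> t y) differentiable (at y)"
    by (rule differentiable_compose[where g="\<lambda>y. (t,y)" and f="\<lambda>(t, y). \<phi> t y"])
      (simp_all add: differentiable_Pair)
  then show ?thesis by (simp add: dy_def DERIV_deriv_iff_real_differentiable)
qed

definition supp :: "(real \<Rightarrow> real \<Rightarrow> real) \<Rightarrow> (real \<times> real) set" where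
  "supp \<phi> = closure {(t, y). \<phi> t y \<noteq> 0}"

lemma compact_supp: "\<phi> \<in> test_functions Q \<Longrightarrow> compact (supp \<phi>)"
  and supp_subset: "\<phi> \<in> test_functions Q \<Longrightarrow> supp \<phi> \<subseteq> Q"
  by (simp_all add: test_functions_def supp_def)

lemma closed_supp: "closed (supp \<phi>)"
  by (simp add: supp_def)

lemma not_in_supp: "(t, y) \<notin> supp \<phi> \<Longrightarrow> \<phi> t y = 0"
  using subsetD[OF closure_subset, of "(t, y)" "{(t, y). \<phi> t y \<noteq> 0}"] 
  unfolding supp_def by blast

lemma supp_derivatives:
  assumes "(t, y) \<notin> supp \<phi>" shows "dt \<phi> t y = 0" "dy \<phi> t y = 0"
proof -
  have o: "open (- supp \<phi>)" using closed_supp by auto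
  have "open ((\<lambda>t. (t, y)) -` (- supp \<phi>))" by (intro open_vimage o continuous_intros)
  moreover have "t \<in> (\<lambda>t. (t, y)) -` (- supp \<phi>)" using assms by (simp only: vimage_eq Compl_iff not_False_eq_True)
  moreover have "0 = \<phi> t y" if "t \<in> (\<lambda>t. (t, y)) -` (- supp \<phi>)" for t
    using not_in_supp[of t y \<phi>] that by auto
  ultimately have "((\<lambda>t. \<phi> t y) has_real_derivative 0) (at t)"
    by (rule has_field_derivative_transform_within_open[OF DERIV_const])
  then show "dt \<phi> t y = 0" unfolding dt_def by (rule DERIV_imp_deriv)
  have "open ((\<lambda>y. (t, y)) -` (- supp \<phi>))" by (intro open_vimage o continuous_intros)
  moreover have "y \<in> (\<lambda>y. (t, y)) -` (- supp \<phi>)" using assms by (simp only: vimage_eq Compl_iff not_False_eq_True)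
  moreover have "0 = \<phi> t y" if "y \<in> (\<lambda>y. (t, y)) -` (- supp \<phi>)" for y
    using not_in_supp[of t y \<phi>] that by auto
  ultimately have "((\<lambda>y. \<phi> t y) has_real_derivative 0) (at y)"
    by (rule has_field_derivative_transform_within_open[OF DERIV_const])
  then show "dy \<phi> t y = 0" unfolding dy_def by (rule DERIV_imp_deriv)
qed

lemma test_functionI:
  assumes C: "\<And>k. C_plane k \<phi>" and S: "compact S" "S \<subseteq> Q" and z: "\<And>t y. \<phi> t y \<noteq> 0 \<Longrightarrow> (t, y) \<in> S"
  shows "\<phi> \<in> test_functions Q"
proof -
  have "{(t, y). \<phi> t y \<noteq> 0} \<subseteq> S" using z by auto
  then have 1: "supp \<phi> \<subseteq> S" unfolding supp_def using S(1) compact_imp_closed closure_minimal by blast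
  then have "compact (supp \<phi>)"
    unfolding supp_def compact_closure by (rule bounded_subset[rotated, OF order_trans[OF closure_subset]])
     (rule compact_imp_bounded[OF S(1)])
  with 1 S C show ?thesis unfolding test_functions_def supp_def by blast
qed

lemma assumes "\<phi> \<in> test_functions Q" shows test_dt: "dt \<phi> \<in> test_functions Q"
  and test_dy: "dy \<phi> \<in> test_functions Q"
proof -
  have c: "compact (supp \<phi>)" "supp \<phi> \<subseteq> Q" using assms compact_supp supp_subset by auto
  have D: "dt \<phi> t y \<noteq> 0 \<Longrightarrow> (t, y) \<in> supp \<phi>" "dy \<phi> t y \<noteq> 0 \<Longrightarrow> (t, y) \<in> supp \<phi>" for t y
    using supp_derivatives by blast+
  have C: "C_plane k (dt \<phi>)" "C_plane k (dy \<phi>)" for k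
    using test_C_plane[OF assms, of "Suc k"] by simp_all
  show "dt \<phi> \<in> test_functions Q" by (rule test_functionI[OF C(1) c]) (rule D(1))
  show "dy \<phi> \<in> test_functions Q" by (rule test_functionI[OF C(2) c]) (rule D(2))
qed

lemma test_product:
  assumes a: "smooth a" "\<And>x. x \<notin> {a1..a2} \<Longrightarrow> a x = 0"
    and b: "smooth b" "\<And>x. x \<notin> {b1..b2} \<Longrightarrow> b x = 0"
    and Q: "{a1..a2} \<times> {b1..b2} \<subseteq> Q"
  shows "(\<lambda>t y. a t * b y) \<in> test_functions Q"
    and "dt (\<lambda>t y. a t * b y) = (\<lambda>t y. deriv a t * b y)"
    and "dy (\<lambda>t y. a t * b y) = (\<lambda>t y. a t * deriv b y)"
proof -
  have D: "dt (\<lambda>t y. a t * b y) = (\<lambda>t y. deriv a t * b y)" 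
    "dy (\<lambda>t y. a t * b y) = (\<lambda>t y. a t * deriv b y)" if "smooth a" "smooth b" for a b
    using that[THEN smooth_DERIV] unfolding dt_def dy_def
    by (intro ext; intro DERIV_imp_deriv DERIV_cmult DERIV_cmult_right; blast)+
  then show "dt (\<lambda>t y. a t * b y) = (\<lambda>t y. deriv a t * b y)" 
    "dy (\<lambda>t y. a t * b y) = (\<lambda>t y. a t * deriv b y)"
    using D[OF a(1) b(1)] by blast+
  have "C_plane k (\<lambda>t y. a t * b y)" if "smooth a" "smooth b" for k a b
    using that
  proof (induction k arbitrary: a b)
    case 0
    then show ?case unfolding C_plane.simps case_prod_beta
      by (intro continuous_intros continuous_on_compose2[OF smooth_continuous[of a UNIV]]
         continuous_on_compose2[OF smooth_continuous[of b UNIV]]) auto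
  next
    case (Suc k)
    have "(\<lambda>p. a (fst p) * b (snd p)) differentiable (at p)" for p
    proof -
      have "a differentiable at (fst p)" "b differentiable at (snd p)"
        using Suc.prems[THEN smooth_DERIV] by (auto simp: real_differentiable_def)
      then have "(\<lambda>p. a (fst p)) differentiable at p" "(\<lambda>p. b (snd p)) differentiable at p"
        using differentiable_compose[of a fst p UNIV] differentiable_compose[of b snd p UNIV]
          bounded_linear_imp_differentiable[OF bounded_linear_fst] bounded_linear_imp_differentiable[OF bounded_linear_snd]
        by auto
      then show ?thesis by (rule differentiable_mult)
    qed
    then show ?case unfolding C_plane.simps case_prod_beta D[OF Suc.prems]
      using Suc smooth_deriv by blast
  qed
  with a b have C: "C_plane k (\<lambda>t y. a t * b y)" for k by blast
  show "(\<lambda>t y. a t * b y) \<in> test_functions Q"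
  proof (rule test_functionI[OF C _ Q])
    show "compact ({a1..a2} \<times> {b1..b2})" by (intro compact_Times compact_Icc)
  qed (use a(2) b(2) in force)
qed

lemma integrable_continuous_compact_support:
  fixes f :: "'a::euclidean_space \<Rightarrow> real"
  assumes "continuous_on UNIV f" "compact S" "\<And>x. x \<notin> S \<Longrightarrow> f x = 0"
  shows "integrable lborel f"
proof -
  have "integrable lborel (\<lambda>x. indicator S x *\<^sub>R f x)"
    using borel_integrable_compact[OF assms(2), of f] continuous_on_subset[OF assms(1)]
    by (auto simp: set_integrable_def)
  moreover have eq: "indicator S x *\<^sub>R f x = f x" for x using assms(3) by (auto simp: indicator_def)
  ultimately show ?thesis by (subst (asm) eq)
qed

text \<open>
Multiplication by a test function turns continuity on \<open>Q\<close> into continuity on the plane. All pairings below are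
therefore integrals of continuous functions with compact support.
\<close>

lemma test_mult_continuous:
  assumes \<phi>: "\<phi> \<in> test_functions Q" and Q: "open Q" and f: "continuous_on Q (\<lambda>(t, y). f t y)"
  shows "continuous_on UNIV (\<lambda>p. if p \<in> Q then (case p of (t, y) \<Rightarrow> f t y * \<phi> t y) else 0)"
proof -
  have s: "supp \<phi> \<subseteq> Q" by (rule supp_subset[OF \<phi>])
  have 1: "continuous_on Q (\<lambda>p. if p \<in> Q then (case p of (t, y) \<Rightarrow> f t y * \<phi> t y) else 0)"
    using continuous_on_mult[OF f test_continuous[OF \<phi>, of Q]]
    by (rule continuous_on_eq) auto
  have 2: "continuous_on (- supp \<phi>) (\<lambda>p. if p \<in> Q then (case p of (t, y) \<Rightarrow> f t y * \<phi> t y) else 0)"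
    by (rule continuous_on_eq[OF continuous_on_const[of _ 0]]) (use not_in_supp[of _ _ \<phi>] in \<open>auto split: prod.splits\<close>)
  have "continuous_on (Q \<union> - supp \<phi>) (\<lambda>p. if p \<in> Q then (case p of (t, y) \<Rightarrow> f t y * \<phi> t y) else 0)"
    by (rule continuous_on_open_Un[OF Q _ 1 2]) (use closed_supp in auto)
  moreover have "Q \<union> - supp \<phi> = UNIV" using s by auto
  ultimately show ?thesis by simp
qed

lemma test_mult_integrable:
  assumes \<phi>: "\<phi> \<in> test_functions Q" and Q: "open Q" and f: "continuous_on Q (\<lambda>(t, y). f t y)"
  shows "integrable lborel (\<lambda>p. if p \<in> Q then (case p of (t, y) \<Rightarrow> f t y * \<phi> t y) else 0)"
proof (rule integrable_continuous_compact_support[OF test_mult_continuous[OF assms]])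
  show "compact (supp \<phi>)" by (rule compact_supp[OF \<phi>])
qed (use not_in_supp[of _ _ \<phi>] in \<open>auto split: prod.splits\<close>)

lemma distr_of_altdef:
  "distr_of Q f \<phi> = integral\<^sup>L lborel (\<lambda>p. if p \<in> Q then (case p of (t, y) \<Rightarrow> f t y * \<phi> t y) else 0)"
  unfolding distr_of_def set_lebesgue_integral_def by (rule Bochner_Integration.integral_cong) auto

lemma distr_of_cmult: "distr_of Q (\<lambda>t y. c * f t y) \<phi> = c * distr_of Q f \<phi>"
  unfolding distr_of_altdef integral_mult_right_zero[symmetric]
  by (rule Bochner_Integration.integral_cong) auto

lemma distr_of_diff:
  assumes "\<phi> \<in> test_functions Q" "open Q" "continuous_on Q (\<lambda>(t, y). f t y)" "continuous_on Q (\<lambda>(t, y). g t y)"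
  shows "distr_of Q (\<lambda>t y. f t y - g t y) \<phi> = distr_of Q f \<phi> - distr_of Q g \<phi>"
  unfolding distr_of_altdef
    Bochner_Integration.integral_diff[OF test_mult_integrable[OF assms(1,2,3)] test_mult_integrable[OF assms(1,2,4)], symmetric]
  by (rule Bochner_Integration.integral_cong) (auto simp: algebra_simps)

lemma integral_deriv_compact_support:
  fixes F f :: "real \<Rightarrow> real"
  assumes "\<And>x. (F has_real_derivative f x) (at x)" "continuous_on UNIV f" "\<And>x. \<bar>x\<bar> \<ge> R \<Longrightarrow> F x = 0" "R > 0"
    "\<And>x. \<bar>x\<bar> > R \<Longrightarrow> f x = 0"
  shows "integral\<^sup>L lborel f = 0"
proof -
  have "(\<integral>x. indicator {-R..R} x *\<^sub>R f x \<partial>lborel) = F R - F (-R)"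
  proof (rule integral_FTC_Icc)
    show "continuous_on {- R..R} f" using assms(2) by (rule continuous_on_subset) simp
    show "(F has_vector_derivative f x) (at x within {- R..R})" for x
      using assms(1)[of x] by (auto intro: has_vector_derivative_at_within
          simp: has_real_derivative_iff_has_vector_derivative)
  qed (use assms(4) in simp)
  moreover have eq: "indicator {-R..R} x *\<^sub>R f x = f x" for x
    using assms(5)[of x] by (cases "\<bar>x\<bar> > R") (auto simp: indicator_def)
  ultimately show ?thesis unfolding eq using assms(3)[of R] assms(3)[of "-R"] \<open>R>0\<close> by simp
qed

section \<open>Integration by parts against test functions\<close>

lemma continuous_on_slices:
  assumes "continuous_on (A \<times> B) (\<lambda>(t, y). f t y)"
  shows "t \<in> A \<Longrightarrow> continuous_on B (f t)" and "y \<in> B \<Longrightarrow> continuous_on A (\<lambda>t. f t y)"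
proof -
  show "continuous_on B (f t)" if "t \<in> A"
    by (rule continuous_on_compose2[OF assms, where f="\<lambda>y. (t, y)", simplified]) (use that in \<open>auto intro!: continuous_intros\<close>)
  show "continuous_on A (\<lambda>t. f t y)" if "y \<in> B"
    by (rule continuous_on_compose2[OF assms, where f="\<lambda>t. (t, y)", simplified]) (use that in \<open>auto intro!: continuous_intros\<close>)
qed

lemma tendsto_at_boundary:
  fixes f :: "real \<Rightarrow> real \<Rightarrow> real"
  assumes "t \<in> A"
  shows "continuous_on (A \<times> {0..}) (\<lambda>(t, y). f t y) \<Longrightarrow> (f t \<longlongrightarrow> f t 0) (at_right 0)"
    and "continuous_on (A \<times> {..0}) (\<lambda>(t, y). f t y) \<Longrightarrow> (f t \<longlongrightarrow> f t 0) (at_left 0)"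
proof -
  assume "continuous_on (A \<times> {0..}) (\<lambda>(t, y). f t y)"
  from continuous_on_slices(1)[OF this assms] have "(f t \<longlongrightarrow> f t 0) (at 0 within {0..})" by (auto simp: continuous_on_def)
  then show "(f t \<longlongrightarrow> f t 0) (at_right 0)" by (rule tendsto_within_subset) auto
next
  assume "continuous_on (A \<times> {..0}) (\<lambda>(t, y). f t y)"
  from continuous_on_slices(1)[OF this assms] have "(f t \<longlongrightarrow> f t 0) (at 0 within {..0})" by (auto simp: continuous_on_def)
  then show "(f t \<longlongrightarrow> f t 0) (at_left 0)" by (rule tendsto_within_subset) auto
qed

lemma plane_integral_dt_eq_0:
  fixes h ht :: "real \<Rightarrow> real \<Rightarrow> real"
  assumes D: "\<And>t y. ((\<lambda>t. h t y) has_real_derivative ht t y) (at t)"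
    and c: "continuous_on UNIV (\<lambda>(t, y). ht t y)"
    and S: "compact S" and z: "\<And>t y. (t, y) \<notin> S \<Longrightarrow> h t y = 0" "\<And>t y. (t, y) \<notin> S \<Longrightarrow> ht t y = 0"
  shows "(\<integral>p. (case p of (t, y) \<Rightarrow> ht t y) \<partial>lborel) = 0"
proof -
  obtain R where R: "R > 0" "\<And>p. p \<in> S \<Longrightarrow> norm p \<le> R"
    using compact_imp_bounded[OF S] by (auto simp: bounded_pos)
  have far: "(t, y) \<notin> S" if "\<bar>t\<bar> \<ge> R + 1" for t y
    using R(2)[of "(t, y)"] norm_fst_le[of t y] that by fastforce
  have "integrable lborel (\<lambda>(t, y). ht t y)"
    by (rule integrable_continuous_compact_support[OF c S]) (use z(2) in auto)
  then have "integrable (lborel \<Otimes>\<^sub>M lborel) (\<lambda>(t, y). ht t y)" by (simp add: lborel_prod)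
  from lborel_pair.integral_snd[OF this]
  have "(\<integral>p. (case p of (t, y) \<Rightarrow> ht t y) \<partial>lborel) = (\<integral>y. (\<integral>t. ht t y \<partial>lborel) \<partial>lborel)"
    by (simp add: lborel_prod)
  also have "(\<lambda>y. \<integral>t. ht t y \<partial>lborel) = (\<lambda>y. 0)"
  proof
    fix y show "(\<integral>t. ht t y \<partial>lborel) = 0"
  proof (rule integral_deriv_compact_support[where R="R+1", OF D])
    show "continuous_on UNIV (\<lambda>t. ht t y)"
      by (rule continuous_on_compose2[OF c, of UNIV "\<lambda>t. (t, y)", simplified]) (intro continuous_intros)
    qed (use far z R(1) in auto)
  qed
  finally show ?thesis by simp
qed

text \<open>
This follows from the previous lemma by exchanging the two coordinates.
\<close>

lemma plane_integral_dy_eq_0: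
  fixes h hy :: "real \<Rightarrow> real \<Rightarrow> real"
  assumes D: "\<And>t y. ((\<lambda>y. h t y) has_real_derivative hy t y) (at y)"
    and c: "continuous_on UNIV (\<lambda>(t, y). hy t y)"
    and S: "compact S" and z: "\<And>t y. (t, y) \<notin> S \<Longrightarrow> h t y = 0" "\<And>t y. (t, y) \<notin> S \<Longrightarrow> hy t y = 0"
  shows "(\<integral>p. (case p of (t, y) \<Rightarrow> hy t y) \<partial>lborel) = 0"
proof -
  have c': "continuous_on UNIV (\<lambda>(y, t). hy t y)"
    using continuous_on_compose2[OF c, of UNIV "\<lambda>(y, t). (t, y)"]
    by (simp add: case_prod_beta continuous_intros)
  have "(\<integral>p. (case p of (y, t) \<Rightarrow> hy t y) \<partial>lborel) = 0"
  proof (rule plane_integral_dt_eq_0[where h="\<lambda>y t. h t y" and S="prod.swap ` S", OF D c'])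
    show "compact (prod.swap ` S)"
      by (rule compact_continuous_image[OF _ S]) (auto simp: prod.swap_def intro!: continuous_intros)
  qed (use z in \<open>force+\<close>)
  moreover have "(\<lambda>(t, y). hy t y) \<in> borel_measurable (lborel \<Otimes>\<^sub>M lborel)"
    using c by (simp add: lborel_prod borel_measurable_continuous_onI)
  from lborel_pair.integral_product_swap[OF this]
  have "(\<integral>p. (case p of (y, t) \<Rightarrow> hy t y) \<partial>lborel) = (\<integral>p. (case p of (t, y) \<Rightarrow> hy t y) \<partial>lborel)"
    by (simp add: lborel_prod)
  ultimately show ?thesis by simp
qed

text \<open>
The curve \<open>c\<close> will be a line parallel to one of the axes, so that one lemma serves both partial derivatives.
\<close>

lemma DERIV_mult_test_zero_extension:
  fixes a b a' b' :: "real \<Rightarrow> real" and c :: "real \<Rightarrow> real \<times> real"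
  assumes Q: "open Q" and S: "closed S" "S \<subseteq> Q" and c: "continuous_on UNIV c"
    and a: "c x \<in> Q \<Longrightarrow> (a has_real_derivative a' x) (at x)"
    and b: "(b has_real_derivative b' x) (at x)"
    and z: "\<And>x. c x \<notin> S \<Longrightarrow> b x = 0" "\<And>x. c x \<notin> S \<Longrightarrow> b' x = 0"
  shows "((\<lambda>x. if c x \<in> Q then a x * b x else 0) has_real_derivative
     (if c x \<in> Q then a' x * b x + a x * b' x else 0)) (at x)"
proof (cases "c x \<in> Q")
  case True
  have "((\<lambda>x. a x * b x) has_real_derivative (if c x \<in> Q then a' x * b x + a x * b' x else 0)) (at x)"
    using DERIV_mult[OF a[OF True] b] True by (simp add: algebra_simps)
  then show ?thesis
    by (rule has_field_derivative_transform_within_open[where S="c -` Q"])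
      (use True open_vimage[OF Q c] in auto)
next
  case False
  have "((\<lambda>x. 0) has_real_derivative (if c x \<in> Q then a' x * b x + a x * b' x else 0)) (at x)"
    using False by simp
  then show ?thesis
    by (rule has_field_derivative_transform_within_open[where S="c -` (- S)"])
      (use False S z open_vimage[OF _ c, of "- S"] in auto)
qed

lemma distr_of_dt_by_parts:
  assumes \<phi>: "\<phi> \<in> test_functions Q" and Q: "open Q"
    and f: "continuous_on Q (\<lambda>(t, y). f t y)" "continuous_on Q (\<lambda>(t, y). ft t y)"
    and D: "\<And>t y. (t, y) \<in> Q \<Longrightarrow> ((\<lambda>t. f t y) has_real_derivative ft t y) (at t)"
  shows "distr_of Q f (dt \<phi>) = - distr_of Q ft \<phi>"
proof -
  let ?A = "\<lambda>p. if p \<in> Q then (case p of (t, y) \<Rightarrow> ft t y * \<phi> t y) else 0"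
  let ?B = "\<lambda>p. if p \<in> Q then (case p of (t, y) \<Rightarrow> f t y * dt \<phi> t y) else 0"
  have "(\<integral>p. (case p of (t, y) \<Rightarrow> if (t, y) \<in> Q then ft t y * \<phi> t y + f t y * dt \<phi> t y else 0) \<partial>lborel) = 0"
  proof (rule plane_integral_dt_eq_0[where S="supp \<phi>"])
    show "((\<lambda>t. if (t, y) \<in> Q then f t y * \<phi> t y else 0) has_real_derivative
        (if (t, y) \<in> Q then ft t y * \<phi> t y + f t y * dt \<phi> t y else 0)) (at t)" for t y
      using not_in_supp[of _ y \<phi>] supp_derivatives[of _ y \<phi>]
      by (intro DERIV_mult_test_zero_extension[OF Q closed_supp supp_subset[OF \<phi>]] D test_DERIV_dt[OF \<phi>]
        continuous_intros) auto
    have "continuous_on UNIV (\<lambda>p. ?A p + ?B p)"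
      by (intro continuous_on_add test_mult_continuous[OF _ Q] \<phi> test_dt[OF \<phi>] f)
    then show "continuous_on UNIV (\<lambda>(t, y). if (t, y) \<in> Q then ft t y * \<phi> t y + f t y * dt \<phi> t y else 0)"
      by (rule continuous_on_eq) auto
  qed (use compact_supp[OF \<phi>] not_in_supp[of _ _ \<phi>] supp_derivatives[of _ _ \<phi>] in auto)
  also have "(\<lambda>p. case p of (t, y) \<Rightarrow> if (t, y) \<in> Q then ft t y * \<phi> t y + f t y * dt \<phi> t y else 0) = (\<lambda>p. ?A p + ?B p)"
    by auto
  also have "integral\<^sup>L lborel (\<lambda>p. ?A p + ?B p) = distr_of Q ft \<phi> + distr_of Q f (dt \<phi>)"
    unfolding distr_of_altdef
    by (intro Bochner_Integration.integral_add test_mult_integrable[OF _ Q] \<phi> test_dt[OF \<phi>] f)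
  finally show ?thesis by simp
qed

lemma distr_of_dy_by_parts:
  assumes \<phi>: "\<phi> \<in> test_functions Q" and Q: "open Q"
    and f: "continuous_on Q (\<lambda>(t, y). f t y)" "continuous_on Q (\<lambda>(t, y). fy t y)"
    and D: "\<And>t y. (t, y) \<in> Q \<Longrightarrow> (f t has_real_derivative fy t y) (at y)"
  shows "distr_of Q f (dy \<phi>) = - distr_of Q fy \<phi>"
proof -
  let ?A = "\<lambda>p. if p \<in> Q then (case p of (t, y) \<Rightarrow> fy t y * \<phi> t y) else 0"
  let ?B = "\<lambda>p. if p \<in> Q then (case p of (t, y) \<Rightarrow> f t y * dy \<phi> t y) else 0"
  have "(\<integral>p. (case p of (t, y) \<Rightarrow> if (t, y) \<in> Q then fy t y * \<phi> t y + f t y * dy \<phi> t y else 0) \<partial>lborel) = 0"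
  proof (rule plane_integral_dy_eq_0[where S="supp \<phi>"])
    show "((\<lambda>y. if (t, y) \<in> Q then f t y * \<phi> t y else 0) has_real_derivative
        (if (t, y) \<in> Q then fy t y * \<phi> t y + f t y * dy \<phi> t y else 0)) (at y)" for t y
      using not_in_supp[of t _ \<phi>] supp_derivatives[of t _ \<phi>]
      by (intro DERIV_mult_test_zero_extension[OF Q closed_supp supp_subset[OF \<phi>]] D test_DERIV_dy[OF \<phi>]
        continuous_intros) auto
    have "continuous_on UNIV (\<lambda>p. ?A p + ?B p)"
      by (intro continuous_on_add test_mult_continuous[OF _ Q] \<phi> test_dy[OF \<phi>] f)
    then show "continuous_on UNIV (\<lambda>(t, y). if (t, y) \<in> Q then fy t y * \<phi> t y + f t y * dy \<phi> t y else 0)"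
      by (rule continuous_on_eq) auto
  qed (use compact_supp[OF \<phi>] not_in_supp[of _ _ \<phi>] supp_derivatives[of _ _ \<phi>] in auto)
  also have "(\<lambda>p. case p of (t, y) \<Rightarrow> if (t, y) \<in> Q then fy t y * \<phi> t y + f t y * dy \<phi> t y else 0) = (\<lambda>p. ?A p + ?B p)"
    by auto
  also have "integral\<^sup>L lborel (\<lambda>p. ?A p + ?B p) = distr_of Q fy \<phi> + distr_of Q f (dy \<phi>)"
    unfolding distr_of_altdef
    by (intro Bochner_Integration.integral_add test_mult_integrable[OF _ Q] \<phi> test_dy[OF \<phi>] f)
  finally show ?thesis by simp
qed

lemma distr_of_scale: "distr_of Q f (\<lambda>s \<xi>. c * \<phi> s \<xi>) = c * distr_of Q f \<phi>"
  unfolding distr_of_altdef integral_mult_right_zero[symmetric]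
  by (rule Bochner_Integration.integral_cong) auto

section \<open>Weak solutions of the heat equation\<close>

text \<open>
The distributional form of \<open>w\<^sub>t - \<kappa> w\<^sub>y\<^sub>y = G\<close>. A drift term is part of \<open>G\<close>: it contains only the
continuous first derivative of \<open>w\<close>.
\<close>

definition weak_heat :: "(real \<times> real) set \<Rightarrow> real \<Rightarrow> (real \<Rightarrow> real \<Rightarrow> real) \<Rightarrow> (real \<Rightarrow> real \<Rightarrow> real) \<Rightarrow> bool" where
  "weak_heat Q \<kappa> w G \<longleftrightarrow> (\<forall>\<phi>\<in>test_functions Q.
     - distr_of Q w (dt \<phi>) - \<kappa> * distr_of Q w (dy (dy \<phi>)) = distr_of Q G \<phi>)"

lemma weak_heat_diff:
  assumes Q: "open Q" and 1: "weak_heat Q \<kappa> w G" "weak_heat Q \<kappa> w' G'"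
    and c: "continuous_on Q (\<lambda>(t, y). w t y)" "continuous_on Q (\<lambda>(t, y). w' t y)"
      "continuous_on Q (\<lambda>(t, y). G t y)" "continuous_on Q (\<lambda>(t, y). G' t y)"
  shows "weak_heat Q \<kappa> (\<lambda>t y. w t y - w' t y) (\<lambda>t y. G t y - G' t y)"
  unfolding weak_heat_def
proof
  fix \<phi> assume \<phi>: "\<phi> \<in> test_functions Q"
  note d = distr_of_diff[OF \<phi> Q c(3,4)] distr_of_diff[OF test_dt[OF \<phi>] Q c(1,2)]
    distr_of_diff[OF test_dy[OF test_dy[OF \<phi>]] Q c(1,2)]
  show "- distr_of Q (\<lambda>t y. w t y - w' t y) (dt \<phi>) - \<kappa> * distr_of Q (\<lambda>t y. w t y - w' t y) (dy (dy \<phi>))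
     = distr_of Q (\<lambda>t y. G t y - G' t y) \<phi>"
    using 1[unfolded weak_heat_def, rule_format, OF \<phi>] unfolding d right_diff_distrib distrib_left by linarith
qed

lemma weak_heat_uminus:
  assumes "weak_heat Q \<kappa> w G"
  shows "weak_heat Q \<kappa> (\<lambda>t y. - w t y) (\<lambda>t y. - G t y)"
  using assms distr_of_cmult[of Q "-1"] unfolding weak_heat_def by force

lemma weak_heat_add:
  assumes Q: "open Q" and 1: "weak_heat Q \<kappa> w G" "weak_heat Q \<kappa> w' G'"
    and c: "continuous_on Q (\<lambda>(t, y). w t y)" "continuous_on Q (\<lambda>(t, y). w' t y)"
      "continuous_on Q (\<lambda>(t, y). G t y)" "continuous_on Q (\<lambda>(t, y). G' t y)"
  shows "weak_heat Q \<kappa> (\<lambda>t y. w t y + w' t y) (\<lambda>t y. G t y + G' t y)"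
  using weak_heat_diff[OF Q 1(1) weak_heat_uminus[OF 1(2)] c(1) _ c(3)] continuous_on_minus[OF c(2)]
    continuous_on_minus[OF c(4)] by (simp add: case_prod_beta)

text \<open>
Adding this equation to that of a correction with vanishing initial values prescribes the initial profile \<open>g\<close>.
\<close>

lemma weak_heat_stationary:
  assumes Q: "open Q" and c: "continuous_on Q (\<lambda>(t, y). g y)" "continuous_on Q (\<lambda>(t, y). g' y)"
      "continuous_on Q (\<lambda>(t, y). g'' y)"
    and D: "\<And>t y. (t, y) \<in> Q \<Longrightarrow> (g has_real_derivative g' y) (at y)"
      "\<And>t y. (t, y) \<in> Q \<Longrightarrow> (g' has_real_derivative g'' y) (at y)"
  shows "weak_heat Q \<kappa> (\<lambda>t. g) (\<lambda>t y. - (\<kappa> * g'' y))"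
  unfolding weak_heat_def
proof
  fix \<phi> assume \<phi>: "\<phi> \<in> test_functions Q"
  have "distr_of Q (\<lambda>t. g) (dt \<phi>) = - distr_of Q (\<lambda>t y. 0) \<phi>"
    by (rule distr_of_dt_by_parts[OF \<phi> Q c(1)]) (auto simp: case_prod_beta)
  then have "distr_of Q (\<lambda>t. g) (dt \<phi>) = 0" by (simp add: distr_of_def set_lebesgue_integral_def case_prod_beta)
  moreover have "distr_of Q (\<lambda>t. g) (dy (dy \<phi>)) = distr_of Q (\<lambda>t. g'') \<phi>"
    using distr_of_dy_by_parts[OF test_dy[OF \<phi>] Q c(1,2)] distr_of_dy_by_parts[OF \<phi> Q c(2,3)] D by auto
  ultimately show "- distr_of Q (\<lambda>t. g) (dt \<phi>) - \<kappa> * distr_of Q (\<lambda>t. g) (dy (dy \<phi>))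
     = distr_of Q (\<lambda>t y. - (\<kappa> * g'' y)) \<phi>"
    using distr_of_cmult[of Q "-\<kappa>" "\<lambda>t. g''" \<phi>] by simp
qed

text \<open>
The factor \<open>c\<close> in the auxiliary facts absorbs the sign that each derivative in \<open>y\<close> produces and makes the
induction on the order of differentiability go through.
\<close>

lemma test_reflect:
  assumes \<phi>: "\<phi> \<in> test_functions Q"
  shows "(\<lambda>t y. \<phi> t (- y)) \<in> test_functions ((\<lambda>(t, y). (t, - y)) ` Q)" (is ?A)
    and "dt (\<lambda>t y. \<phi> t (- y)) = (\<lambda>t y. dt \<phi> t (- y))"
    and "dy (dy (\<lambda>t y. \<phi> t (- y))) = (\<lambda>t y. dy (dy \<phi>) t (- y))"
proof -
  have Dt: "dt (\<lambda>t y. c * \<phi> t (- y)) = (\<lambda>t y. c * dt \<phi> t (- y))"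
    and Dy: "dy (\<lambda>t y. c * \<phi> t (- y)) = (\<lambda>t y. (- c) * dy \<phi> t (- y))"
    if \<phi>: "\<And>p. (\<lambda>(t, y). \<phi> t y) differentiable (at p)" for c and \<phi> :: "real \<Rightarrow> real \<Rightarrow> real"
  proof -
    have 1: "((\<lambda>t. \<phi> t y) has_real_derivative dt \<phi> t y) (at t)" for t y
      using differentiable_compose[where g="\<lambda>t. (t,y)" and f="\<lambda>(t, y). \<phi> t y" and x=t and s=UNIV, OF \<phi>]
      by (simp add: dt_def DERIV_deriv_iff_real_differentiable differentiable_Pair)
    have 2: "((\<lambda>y. \<phi> t y) has_real_derivative dy \<phi> t y) (at y)" for t y
      using differentiable_compose[where g="\<lambda>y. (t,y)" and f="\<lambda>(t, y). \<phi> t y" and x=y and s=UNIV, OF \<phi>]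
      by (simp add: dy_def DERIV_deriv_iff_real_differentiable differentiable_Pair)
    show "dt (\<lambda>t y. c * \<phi> t (- y)) = (\<lambda>t y. c * dt \<phi> t (- y))"
      by (intro ext, subst dt_def, rule DERIV_imp_deriv, rule DERIV_cmult, rule 1)
    have "((\<lambda>y. c * \<phi> t (- y)) has_real_derivative (- c) * dy \<phi> t (- y)) (at y)" for t y
    proof -
      have "((\<lambda>y. \<phi> t (- y)) has_real_derivative dy \<phi> t (- y) * - 1) (at y)"
        by (rule DERIV_chain2[of "\<phi> t", OF 2]) (auto intro!: derivative_eq_intros)
      from DERIV_cmult[OF this, of c] show ?thesis by simp
    qed
    then show "dy (\<lambda>t y. c * \<phi> t (- y)) = (\<lambda>t y. (- c) * dy \<phi> t (- y))"
      by (intro ext, subst dy_def, intro DERIV_imp_deriv)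
  qed
  have C: "C_plane k (\<lambda>t y. c * \<phi> t (- y))" if "C_plane k \<phi>" for k c and \<phi> :: "real \<Rightarrow> real \<Rightarrow> real"
    using that
  proof (induction k arbitrary: c \<phi>)
    case 0
    then have "continuous_on UNIV (\<lambda>p. c * (case (fst p, - snd p) of (t, y) \<Rightarrow> \<phi> t y))"
      by (intro continuous_intros continuous_on_compose2[where f="\<lambda>p. (fst p, - snd p)" and g="\<lambda>(t, y). \<phi> t y"]) auto
    then show ?case by (simp add: case_prod_beta)
  next
    case (Suc k)
    have d: "(\<lambda>(t, y). \<phi> t y) differentiable (at p)" for p
      using Suc.prems unfolding C_plane.simps by blast
    have "(\<lambda>p. (fst p, - snd p)) differentiable (at p)" for p :: "real \<times> real"
      unfolding differentiable_def by (auto intro!: exI derivative_eq_intros)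
    from differentiable_compose[OF d this]
    have "(\<lambda>p. c * (case (fst p, - snd p) of (t, y) \<Rightarrow> \<phi> t y)) differentiable (at p)" for p
      by (intro differentiable_mult differentiable_const)
    then have "(\<lambda>(t, y). c * \<phi> t (- y)) differentiable (at p)" for p
      unfolding case_prod_beta fst_conv snd_conv .
    with Suc show ?case unfolding C_plane.simps Dt[OF d] Dy[OF d] by blast
  qed
  have eq: "(\<lambda>t y. 1 * \<phi> t (- y)) = (\<lambda>t y. \<phi> t (- y))" by simp
  show ?A
  proof (rule test_functionI)
    show "C_plane k (\<lambda>t y. \<phi> t (- y))" for k
      using C[of k \<phi> 1] test_C_plane[OF \<phi>] by simp
    show "compact ((\<lambda>(t, y). (t, - y)) ` supp \<phi>)"
      by (rule compact_continuous_image[OF _ compact_supp[OF \<phi>]])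
        (auto simp: case_prod_beta intro!: continuous_intros)
    show "(\<lambda>(t, y). (t, - y)) ` supp \<phi> \<subseteq> (\<lambda>(t, y). (t, - y)) ` Q"
      by (rule image_mono[OF supp_subset[OF \<phi>]])
    show "(t, y) \<in> (\<lambda>(t, y). (t, - y)) ` supp \<phi>" if "\<phi> t (- y) \<noteq> 0" for t y
      using not_in_supp[of t "- y" \<phi>] that by force
  qed
  show "dt (\<lambda>t y. \<phi> t (- y)) = (\<lambda>t y. dt \<phi> t (- y))"
    using Dt[OF test_differentiable[OF \<phi>], of 1] by simp
  have "dy (\<lambda>t y. \<phi> t (- y)) = (\<lambda>t y. (- 1) * dy \<phi> t (- y))"
    using Dy[OF test_differentiable[OF \<phi>], of 1] by simp
  then show "dy (dy (\<lambda>t y. \<phi> t (- y))) = (\<lambda>t y. dy (dy \<phi>) t (- y))"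
    using Dy[OF test_differentiable[OF test_dy[OF \<phi>]], of "-1"] by simp
qed

lemma integral_reflect:
  fixes f :: "real \<times> real \<Rightarrow> real"
  assumes f: "f \<in> borel_measurable borel"
  shows "(\<integral>p. f (fst p, - snd p) \<partial>lborel) = integral\<^sup>L lborel f"
proof -
  have "lborel \<Otimes>\<^sub>M lborel = distr lborel borel (\<lambda>x. x) \<Otimes>\<^sub>M distr lborel borel (uminus :: real \<Rightarrow> real)"
    by (simp add: lborel_distr_uminus distr_id2)
  also have "\<dots> = distr (lborel \<Otimes>\<^sub>M lborel) (borel \<Otimes>\<^sub>M borel) (\<lambda>(x, y). (x :: real, - y))"
    by (rule pair_measure_distr) (auto simp: lborel_distr_uminus sigma_finite_lborel)
  also have "(\<lambda>(x, y). (x :: real, - y :: real)) = (\<lambda>p. (fst p, - snd p))" by auto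
  finally have eq: "(lborel :: (real \<times> real) measure) = distr lborel borel (\<lambda>p. (fst p, - snd p))"
    by (simp add: lborel_prod borel_prod)
  show ?thesis
    by (subst (2) eq, subst integral_distr) (use f in \<open>auto simp: borel_prod[symmetric]\<close>)
qed

lemma distr_of_reflect:
  assumes \<phi>: "\<phi> \<in> test_functions Q" and Q: "open Q" and f: "continuous_on Q (\<lambda>(t, y). f t y)"
  shows "distr_of ((\<lambda>(t, y). (t, - y)) ` Q) (\<lambda>t y. f t (- y)) (\<lambda>t y. \<phi> t (- y)) = distr_of Q f \<phi>"
proof -
  have "(t, y) \<in> (\<lambda>(t, y). (t, - y)) ` Q \<longleftrightarrow> (t, - y) \<in> Q" for t y by force
  moreover have "(\<lambda>p. if p \<in> Q then (case p of (t, y) \<Rightarrow> f t y * \<phi> t y) else 0) \<in> borel_measurable borel"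
    by (rule borel_measurable_continuous_onI[OF test_mult_continuous[OF assms]])
  from integral_reflect[OF this]
  have "(\<integral>p. (if (fst p, - snd p) \<in> Q then f (fst p) (- snd p) * \<phi> (fst p) (- snd p) else 0) \<partial>lborel) = distr_of Q f \<phi>"
    unfolding distr_of_altdef by (simp only: case_prod_conv)
  moreover have "(\<lambda>p. if p \<in> (\<lambda>(t, y). (t, - y)) ` Q then (case p of (t, y) \<Rightarrow> f t (- y) * \<phi> t (- y)) else 0)
     = (\<lambda>p. if (fst p, - snd p) \<in> Q then f (fst p) (- snd p) * \<phi> (fst p) (- snd p) else 0)"
    by (rule ext, split prod.split) (use calculation(1) in auto)
  ultimately show ?thesis unfolding distr_of_altdef by simp
qed

text \<open>
The equation contains only an even derivative in \<open>y\<close>, so its form is unchanged. This is what allows both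
phases to be treated on the same half-line.
\<close>

lemma weak_heat_reflect:
  assumes Q: "open Q" and w: "weak_heat Q \<kappa> w G"
    and c: "continuous_on Q (\<lambda>(t, y). w t y)" "continuous_on Q (\<lambda>(t, y). G t y)"
  shows "weak_heat ((\<lambda>(t, y). (t, - y)) ` Q) \<kappa> (\<lambda>t y. w t (- y)) (\<lambda>t y. G t (- y))"
  unfolding weak_heat_def
proof
  fix \<psi> assume \<psi>: "\<psi> \<in> test_functions ((\<lambda>(t, y). (t, - y)) ` Q)"
  define \<phi> where "\<phi> = (\<lambda>t y. \<psi> t (- y))"
  have Qeq: "(\<lambda>(t, y). (t, - y)) ` (\<lambda>(t, y). (t, - y)) ` Q = Q" by (force simp: image_image)
  have \<phi>: "\<phi> \<in> test_functions Q" using test_reflect(1)[OF \<psi>] unfolding Qeq \<phi>_def .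
  have eq: "\<psi> = (\<lambda>t y. \<phi> t (- y))" by (simp add: \<phi>_def)
  show "- distr_of ((\<lambda>(t, y). (t, - y)) ` Q) (\<lambda>t y. w t (- y)) (dt \<psi>)
      - \<kappa> * distr_of ((\<lambda>(t, y). (t, - y)) ` Q) (\<lambda>t y. w t (- y)) (dy (dy \<psi>))
      = distr_of ((\<lambda>(t, y). (t, - y)) ` Q) (\<lambda>t y. G t (- y)) \<psi>"
    unfolding eq test_reflect(2,3)[OF \<phi>]
    using w \<phi> distr_of_reflect[OF \<phi> Q c(2)] distr_of_reflect[OF test_dt[OF \<phi>] Q c(1)]
      distr_of_reflect[OF test_dy[OF test_dy[OF \<phi>]] Q c(1)]
    unfolding weak_heat_def by auto
qed

section \<open>Mollification\<close>

lemma smooth_reflect: "smooth f \<Longrightarrow> smooth (\<lambda>s. f (t - s))"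
  using smooth_affine[of f "-1" t] by simp

lemma smooth_shift_DERIV: "smooth g \<Longrightarrow> ((\<lambda>x. g (x - s)) has_real_derivative deriv g (x - s)) (at x)"
  using DERIV_shift[of g "deriv g (x - s)" x "- s"] smooth_DERIV[of g "x - s"] by simp

lemma deriv_reflect: "smooth f \<Longrightarrow> deriv (\<lambda>s. f (t - s)) s = - deriv f (t - s)"
proof -
  assume f: "smooth f"
  have "((\<lambda>s. f (t - s)) has_real_derivative deriv f (t - s) * (- 1)) (at s)"
    by (rule DERIV_chain2[of f, OF smooth_DERIV[OF f]]) (auto intro!: derivative_eq_intros)
  then show ?thesis by (simp add: DERIV_imp_deriv)
qed

lemma deriv_eq_0_outside:
  assumes "\<And>x. \<bar>x\<bar> > \<epsilon> \<Longrightarrow> a x = (0::real)" "\<bar>x\<bar> > \<epsilon>"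
  shows "deriv a x = 0"
proof (rule DERIV_imp_deriv)
  show "(a has_real_derivative 0) (at x)"
  proof (rule has_field_derivative_transform_within_open[OF DERIV_const, where S="{x. \<bar>x\<bar> > \<epsilon>}"])
    show "open {x. \<bar>x\<bar> > \<epsilon>}" by (intro open_Collect_less continuous_intros)
  qed (use assms in auto)
qed

lemma smooth_compact_support_bounded:
  assumes "smooth a" "\<And>x. \<bar>x\<bar> > \<epsilon> \<Longrightarrow> a x = 0"
  obtains B where "B \<ge> 0" "\<And>x. \<bar>a x\<bar> \<le> B"
proof -
  have "compact (a ` {-\<epsilon>..\<epsilon>})"
    by (intro compact_continuous_image smooth_continuous assms compact_Icc)
  then obtain B where B: "\<And>x. x \<in> {-\<epsilon>..\<epsilon>} \<Longrightarrow> \<bar>a x\<bar> \<le> B"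
    using compact_imp_bounded[of "a ` {-\<epsilon>..\<epsilon>}"] unfolding bounded_iff by (metis imageI real_norm_def)
  have "\<bar>a x\<bar> \<le> max B 0" for x
    
  proof (cases "\<bar>x\<bar> > \<epsilon>")
    case False
    then have "x \<in> {-\<epsilon>..\<epsilon>}" by auto
    from B[OF this] show ?thesis by linarith
  qed (use assms(2) in auto)
  then show ?thesis using that[of "max B 0"] by auto
qed

text \<open>
The parameter \<open>x\<close> is the position of a convolution kernel, in time or in space.
\<close>

lemma distr_of_DERIV:
  fixes k k' :: "real \<Rightarrow> real \<Rightarrow> real \<Rightarrow> real"
  assumes Q: "open Q" and f: "continuous_on Q (\<lambda>(t, y). f t y)" and d: "d > 0"
    and D: "\<And>x s \<xi>. ((\<lambda>x. k x s \<xi>) has_real_derivative k' x s \<xi>) (at x)"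
    and test: "\<And>x. \<bar>x - x0\<bar> < d \<Longrightarrow> k x \<in> test_functions Q" "k' x0 \<in> test_functions Q"
    and bound: "\<And>x s \<xi>. \<bar>x - x0\<bar> < d \<Longrightarrow>
      \<bar>if (s, \<xi>) \<in> Q then f s \<xi> * k' x s \<xi> else 0\<bar> \<le> C * indicator (cbox a b) (s, \<xi>)"
  shows "((\<lambda>x. distr_of Q f (k x)) has_real_derivative distr_of Q f (k' x0)) (at x0)"
  unfolding distr_of_altdef
proof (rule has_real_derivative_integral_dominated[where a="x0 - d" and b="x0 + d" and m="\<lambda>p. C * indicator (cbox a b) p"
      and f'="\<lambda>x p. if p \<in> Q then (case p of (s, \<xi>) \<Rightarrow> f s \<xi> * k' x s \<xi>) else 0"])
  show "((\<lambda>x. if p \<in> Q then (case p of (s, \<xi>) \<Rightarrow> f s \<xi> * k x s \<xi>) else 0) has_real_derivative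
       (if p \<in> Q then (case p of (s, \<xi>) \<Rightarrow> f s \<xi> * k' x s \<xi>) else 0)) (at x)" for x p
    by (cases p) (auto intro!: DERIV_cmult D)
  show "integrable lborel (\<lambda>p. if p \<in> Q then case p of (s, \<xi>) \<Rightarrow> f s \<xi> * k x s \<xi> else 0)"
    if "x0 - d < x" "x < x0 + d" for x
    by (rule test_mult_integrable[OF test(1) Q f]) (use that in auto)
  show "(\<lambda>p. if p \<in> Q then case p of (s, \<xi>) \<Rightarrow> f s \<xi> * k' x0 s \<xi> else 0) \<in> borel_measurable lborel"
    by (rule borel_measurable_integrable[OF test_mult_integrable[OF test(2) Q f]])
  show "\<bar>if p \<in> Q then case p of (s, \<xi>) \<Rightarrow> f s \<xi> * k' x s \<xi> else 0\<bar> \<le> C * indicator (cbox a b) p"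
    if "x0 - d < x" "x < x0 + d" for x p
    using bound[of x "fst p" "snd p"] that by (cases p) auto
  show "integrable lborel (\<lambda>p. C * indicator (cbox a b) p)"
    by (rule integrable_mult_right, rule integrable_real_indicator) (simp, rule emeasure_lborel_cbox_finite)
qed (use d in simp_all)

text \<open>
The convolution kernel is \<open>a (t - s) * b (y - \<xi>)\<close>. Differentiating a convolution replaces one of the factors by its
derivative, which again gives such a pair.
\<close>

locale bump_pair =
  fixes Q :: "(real \<times> real) set" and a b :: "real \<Rightarrow> real" and \<epsilon> :: real
  assumes Q: "open Q" and smooth: "smooth a" "smooth b"
    and a0: "\<And>x. \<bar>x\<bar> > \<epsilon> \<Longrightarrow> a x = 0" and b0: "\<And>x. \<bar>x\<bar> > \<epsilon> \<Longrightarrow> b x = 0"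
begin

lemma deriv_pairs: "bump_pair Q (deriv a) b \<epsilon>" "bump_pair Q a (deriv b) \<epsilon>"
  by unfold_locales (use Q smooth smooth_deriv a0 b0 deriv_eq_0_outside[of \<epsilon>] in auto)

lemma
  assumes "{t - \<epsilon>..t + \<epsilon>} \<times> {y - \<epsilon>..y + \<epsilon>} \<subseteq> Q"
  shows test: "(\<lambda>s \<xi>. a (t - s) * b (y - \<xi>)) \<in> test_functions Q"
    and dt_kernel: "dt (\<lambda>s \<xi>. a (t - s) * b (y - \<xi>)) = (\<lambda>s \<xi>. (- 1) * (deriv a (t - s) * b (y - \<xi>)))"
    and dy_kernel: "dy (\<lambda>s \<xi>. a (t - s) * b (y - \<xi>)) = (\<lambda>s \<xi>. (- 1) * (a (t - s) * deriv b (y - \<xi>)))"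
proof -
  have z: "a (t - x) = 0" if "x \<notin> {t - \<epsilon>..t + \<epsilon>}" for x using a0[of "t - x"] that by auto
  have z': "b (y - x) = 0" if "x \<notin> {y - \<epsilon>..y + \<epsilon>}" for x using b0[of "y - x"] that by auto
  note tp = test_product[OF smooth_reflect[OF smooth(1), of t] z smooth_reflect[OF smooth(2), of y] z' assms]
  show "(\<lambda>s \<xi>. a (t - s) * b (y - \<xi>)) \<in> test_functions Q" using tp(1) .
  show "dt (\<lambda>s \<xi>. a (t - s) * b (y - \<xi>)) = (\<lambda>s \<xi>. (- 1) * (deriv a (t - s) * b (y - \<xi>)))"
    by (rule trans[OF tp(2)]) (simp_all add: deriv_reflect[OF smooth(1)])
  show "dy (\<lambda>s \<xi>. a (t - s) * b (y - \<xi>)) = (\<lambda>s \<xi>. (- 1) * (a (t - s) * deriv b (y - \<xi>)))"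
    by (rule trans[OF tp(3)]) (simp_all add: deriv_reflect[OF smooth(2)])
qed

text \<open>
All kernels with centre at distance at least \<open>\<epsilon>\<close> from the boundary of a rectangle are supported in that
rectangle, which yields one majorant for all of them.
\<close>

lemma majorant:
  assumes f: "continuous_on Q (\<lambda>(t, y). f t y)" and K: "{t1..t2} \<times> {y1..y2} \<subseteq> Q"
  obtains C where "C \<ge> 0" "\<And>s \<xi> t y. t1 + \<epsilon> \<le> t \<Longrightarrow> t \<le> t2 - \<epsilon> \<Longrightarrow> y1 + \<epsilon> \<le> y \<Longrightarrow> y \<le> y2 - \<epsilon> \<Longrightarrow>
    \<bar>if (s, \<xi>) \<in> Q then f s \<xi> * (a (t - s) * b (y - \<xi>)) else 0\<bar> \<le> C * indicator (cbox (t1, y1) (t2, y2)) (s, \<xi>)"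
proof -
  obtain A where A: "A \<ge> 0" "\<And>x. \<bar>a x\<bar> \<le> A" using smooth_compact_support_bounded[OF smooth(1) a0] by blast
  obtain B where B: "B \<ge> 0" "\<And>x. \<bar>b x\<bar> \<le> B" using smooth_compact_support_bounded[OF smooth(2) b0] by blast
  have "compact ((\<lambda>(t, y). f t y) ` ({t1..t2} \<times> {y1..y2}))"
    by (intro compact_continuous_image continuous_on_subset[OF f K] compact_Times compact_Icc)
  then obtain F' where "\<And>s \<xi>. s \<in> {t1..t2} \<Longrightarrow> \<xi> \<in> {y1..y2} \<Longrightarrow> \<bar>f s \<xi>\<bar> \<le> F'"
    using compact_imp_bounded[of "(\<lambda>(t, y). f t y) ` ({t1..t2} \<times> {y1..y2})"] unfolding bounded_iff by force
  then obtain F where F: "F \<ge> 0" "\<And>s \<xi>. s \<in> {t1..t2} \<Longrightarrow> \<xi> \<in> {y1..y2} \<Longrightarrow> \<bar>f s \<xi>\<bar> \<le> F"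
    using that[of "max F' 0"] by force
  show ?thesis
  proof (rule that[of "F * (A * B)"])
    fix s \<xi> t y assume ty: "t1 + \<epsilon> \<le> t" "t \<le> t2 - \<epsilon>" "y1 + \<epsilon> \<le> y" "y \<le> y2 - \<epsilon>"
    show "\<bar>if (s, \<xi>) \<in> Q then f s \<xi> * (a (t - s) * b (y - \<xi>)) else 0\<bar> \<le> F * (A * B) * indicator (cbox (t1, y1) (t2, y2)) (s, \<xi>)"
    proof (cases "(s, \<xi>) \<in> cbox (t1, y1) (t2, y2)")
      case True
      then have "s \<in> {t1..t2}" "\<xi> \<in> {y1..y2}" by auto
      with F(2)[OF this] A(2)[of "t - s"] B(2)[of "y - \<xi>"] True K F(1) A(1) B(1) show ?thesis
        by (auto simp: abs_mult intro!: mult_mono)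
    next
      case False
      then have "\<bar>t - s\<bar> > \<epsilon> \<or> \<bar>y - \<xi>\<bar> > \<epsilon>" using ty by auto
      with False show ?thesis using a0[of "t - s"] b0[of "y - \<xi>"] by auto
    qed
  qed (use F A B in auto)
qed

lemma continuous_on_convolution:
  assumes f: "continuous_on Q (\<lambda>(t, y). f t y)" and K: "{t1 - \<epsilon>..t2 + \<epsilon>} \<times> {y1 - \<epsilon>..y2 + \<epsilon>} \<subseteq> Q"
  shows "continuous_on ({t1..t2} \<times> {y1..y2}) (\<lambda>(t, y). distr_of Q f (\<lambda>s \<xi>. a (t - s) * b (y - \<xi>)))"
proof -
  obtain C where C: "C \<ge> 0" "\<And>s \<xi> t y. t1 \<le> t \<Longrightarrow> t \<le> t2 \<Longrightarrow> y1 \<le> y \<Longrightarrow> y \<le> y2 \<Longrightarrow>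
    \<bar>if (s, \<xi>) \<in> Q then f s \<xi> * (a (t - s) * b (y - \<xi>)) else 0\<bar> \<le> C * indicator (cbox (t1 - \<epsilon>, y1 - \<epsilon>) (t2 + \<epsilon>, y2 + \<epsilon>)) (s, \<xi>)"
    using majorant[OF f K] by auto
  let ?g = "\<lambda>q p. if p \<in> Q then (case p of (s, \<xi>) \<Rightarrow> f s \<xi> * (a (fst q - s) * b (snd q - \<xi>))) else 0"
  have "continuous_on ({t1..t2} \<times> {y1..y2}) (\<lambda>q. integral\<^sup>L lborel (?g q))"
  proof (rule continuous_on_integral_dominated[where m="\<lambda>p. C * indicator (cbox (t1 - \<epsilon>, y1 - \<epsilon>) (t2 + \<epsilon>, y2 + \<epsilon>)) p"])
    show "?g q \<in> borel_measurable lborel" if "q \<in> {t1..t2} \<times> {y1..y2}" for q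
      using that K by (intro borel_measurable_integrable test_mult_integrable[OF test Q f]) force
    show "AE p in lborel. continuous (at q within {t1..t2} \<times> {y1..y2}) (\<lambda>q. ?g q p)"
      if "q \<in> {t1..t2} \<times> {y1..y2}" for q
    proof (rule AE_I2)
      fix p
      have "continuous_on UNIV (\<lambda>q. ?g q p)"
        by (cases p; cases "p \<in> Q") (auto intro!: continuous_intros
            continuous_on_compose2[OF smooth_continuous[OF smooth(1), of UNIV]]
            continuous_on_compose2[OF smooth_continuous[OF smooth(2), of UNIV]])
      then show "continuous (at q within {t1..t2} \<times> {y1..y2}) (\<lambda>q. ?g q p)"
        using continuous_on_eq_continuous_at continuous_at_imp_continuous_at_within open_UNIV by blast
    qed
    show "AE p in lborel. \<bar>?g q p\<bar> \<le> C * indicator (cbox (t1 - \<epsilon>, y1 - \<epsilon>) (t2 + \<epsilon>, y2 + \<epsilon>)) p"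
      if "q \<in> {t1..t2} \<times> {y1..y2}" for q
    proof (rule AE_I2)
      fix p show "\<bar>?g q p\<bar> \<le> C * indicator (cbox (t1 - \<epsilon>, y1 - \<epsilon>) (t2 + \<epsilon>, y2 + \<epsilon>)) p"
        using C(2)[of "fst q" "snd q" "fst p" "snd p"] that by (cases p; cases q) auto
    qed
    show "integrable lborel (\<lambda>p. C * indicator (cbox (t1 - \<epsilon>, y1 - \<epsilon>) (t2 + \<epsilon>, y2 + \<epsilon>)) p)"
      by (intro integrable_mult_right) (auto intro!: integrable_real_indicator emeasure_lborel_cbox_finite)
  qed
  then show ?thesis unfolding distr_of_altdef case_prod_beta .
qed

lemma
  assumes f: "continuous_on Q (\<lambda>(t, y). f t y)" and K: "{t - r..t + r} \<times> {y - r..y + r} \<subseteq> Q" and r: "r > \<epsilon>"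
  shows convolution_DERIV_t: "((\<lambda>t. distr_of Q f (\<lambda>s \<xi>. a (t - s) * b (y - \<xi>))) has_real_derivative
      distr_of Q f (\<lambda>s \<xi>. deriv a (t - s) * b (y - \<xi>))) (at t)"
    and convolution_DERIV_y: "((\<lambda>y. distr_of Q f (\<lambda>s \<xi>. a (t - s) * b (y - \<xi>))) has_real_derivative
      distr_of Q f (\<lambda>s \<xi>. a (t - s) * deriv b (y - \<xi>))) (at y)"
proof -
  interpret A: bump_pair Q "deriv a" b \<epsilon> by (rule deriv_pairs)
  interpret B: bump_pair Q a "deriv b" \<epsilon> by (rule deriv_pairs)
  let ?ind = "indicator (cbox (t - r, y - r) (t + r, y + r)) :: real \<times> real \<Rightarrow> real"
  have sub: "{t' - \<epsilon>..t' + \<epsilon>} \<times> {y' - \<epsilon>..y' + \<epsilon>} \<subseteq> Q" if "\<bar>t' - t\<bar> < r - \<epsilon>" "\<bar>y' - y\<bar> < r - \<epsilon>" for t' y'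
  proof -
    have "{t' - \<epsilon>..t' + \<epsilon>} \<times> {y' - \<epsilon>..y' + \<epsilon>} \<subseteq> {t - r..t + r} \<times> {y - r..y + r}" using that by auto
    with K show ?thesis by blast
  qed
  show "((\<lambda>t. distr_of Q f (\<lambda>s \<xi>. a (t - s) * b (y - \<xi>))) has_real_derivative
      distr_of Q f (\<lambda>s \<xi>. deriv a (t - s) * b (y - \<xi>))) (at t)"
  proof -
    obtain C where "C \<ge> 0" and C: "\<And>s \<xi> t' y'. t - r + \<epsilon> \<le> t' \<Longrightarrow> t' \<le> t + r - \<epsilon> \<Longrightarrow> y - r + \<epsilon> \<le> y' \<Longrightarrow> y' \<le> y + r - \<epsilon> \<Longrightarrow>
      \<bar>if (s, \<xi>) \<in> Q then f s \<xi> * (deriv a (t' - s) * b (y' - \<xi>)) else 0\<bar> \<le> C * ?ind (s, \<xi>)"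
      using A.majorant[OF f K] by blast
    show ?thesis
    proof (rule distr_of_DERIV[OF Q f, where d="r - \<epsilon>" and C=C and a="(t - r, y - r)" and b="(t + r, y + r)" and k="\<lambda>t s \<xi>. a (t - s) * b (y - \<xi>)" and k'="\<lambda>t s \<xi>. deriv a (t - s) * b (y - \<xi>)"])
      show "((\<lambda>t. a (t - s) * b (y - \<xi>)) has_real_derivative deriv a (t' - s) * b (y - \<xi>)) (at t')" for t' s \<xi>
        by (rule DERIV_cmult_right[OF smooth_shift_DERIV[OF smooth(1)]])
      show "(\<lambda>s \<xi>. a (t' - s) * b (y - \<xi>)) \<in> test_functions Q" if "\<bar>t' - t\<bar> < r - \<epsilon>" for t'
        by (rule test[OF sub]) (use that r in auto)
      show "(\<lambda>s \<xi>. deriv a (t - s) * b (y - \<xi>)) \<in> test_functions Q"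
        by (rule A.test[OF sub]) (use r in auto)
      show "\<bar>if (s, \<xi>) \<in> Q then f s \<xi> * (deriv a (t' - s) * b (y - \<xi>)) else 0\<bar> \<le> C * ?ind (s, \<xi>)"
        if "\<bar>t' - t\<bar> < r - \<epsilon>" for t' s \<xi>
        by (rule C) (use that r in auto)
    qed (use r in simp)
  qed
  show "((\<lambda>y. distr_of Q f (\<lambda>s \<xi>. a (t - s) * b (y - \<xi>))) has_real_derivative
      distr_of Q f (\<lambda>s \<xi>. a (t - s) * deriv b (y - \<xi>))) (at y)"
  proof -
    obtain C where "C \<ge> 0" and C: "\<And>s \<xi> t' y'. t - r + \<epsilon> \<le> t' \<Longrightarrow> t' \<le> t + r - \<epsilon> \<Longrightarrow> y - r + \<epsilon> \<le> y' \<Longrightarrow> y' \<le> y + r - \<epsilon> \<Longrightarrow>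
      \<bar>if (s, \<xi>) \<in> Q then f s \<xi> * (a (t' - s) * deriv b (y' - \<xi>)) else 0\<bar> \<le> C * ?ind (s, \<xi>)"
      using B.majorant[OF f K] by blast
    show ?thesis
    proof (rule distr_of_DERIV[OF Q f, where d="r - \<epsilon>" and C=C and a="(t - r, y - r)" and b="(t + r, y + r)" and k="\<lambda>y s \<xi>. a (t - s) * b (y - \<xi>)" and k'="\<lambda>y s \<xi>. a (t - s) * deriv b (y - \<xi>)"])
      show "((\<lambda>y. a (t - s) * b (y - \<xi>)) has_real_derivative a (t - s) * deriv b (y' - \<xi>)) (at y')" for y' s \<xi>
        by (rule DERIV_cmult[OF smooth_shift_DERIV[OF smooth(2)]])
      show "(\<lambda>s \<xi>. a (t - s) * b (y' - \<xi>)) \<in> test_functions Q" if "\<bar>y' - y\<bar> < r - \<epsilon>" for y'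
        by (rule test[OF sub]) (use that r in auto)
      show "(\<lambda>s \<xi>. a (t - s) * deriv b (y - \<xi>)) \<in> test_functions Q"
        by (rule B.test[OF sub]) (use r in auto)
      show "\<bar>if (s, \<xi>) \<in> Q then f s \<xi> * (a (t - s) * deriv b (y' - \<xi>)) else 0\<bar> \<le> C * ?ind (s, \<xi>)"
        if "\<bar>y' - y\<bar> < r - \<epsilon>" for y' s \<xi>
        by (rule C) (use that r in auto)
    qed (use r in simp)
  qed
qed

end

text \<open>
The kernel is a probability density on the box of radius \<open>\<epsilon>\<close>, so the mollified value is an average of values of \<open>f\<close>
in that box.
\<close>

lemma mollification_close:
  assumes B: "bump_pair Q \<rho> \<rho> \<epsilon>" and nn: "\<And>x. \<rho> x \<ge> 0" and int: "integrable lborel \<rho>" "integral\<^sup>L lborel \<rho> = 1"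
    and f: "continuous_on Q (\<lambda>(t, y). f t y)" and K: "{t - \<epsilon>..t + \<epsilon>} \<times> {y - \<epsilon>..y + \<epsilon>} \<subseteq> Q"
    and close: "\<And>s \<xi>. \<bar>t - s\<bar> \<le> \<epsilon> \<Longrightarrow> \<bar>y - \<xi>\<bar> \<le> \<epsilon> \<Longrightarrow> \<bar>f s \<xi> - c\<bar> \<le> \<eta>"
  shows "\<bar>distr_of Q f (\<lambda>s \<xi>. \<rho> (t - s) * \<rho> (y - \<xi>)) - c\<bar> \<le> \<eta>"
proof -
  interpret bump_pair Q \<rho> \<rho> \<epsilon> by fact
  let ?\<phi> = "\<lambda>s \<xi>. \<rho> (t - s) * \<rho> (y - \<xi>)"
  have T: "?\<phi> \<in> test_functions Q" by (rule test[OF K])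
  have nn: "?\<phi> s \<xi> \<ge> 0" for s \<xi> using nn by simp
  have "distr_of Q (\<lambda>s \<xi>. 1) ?\<phi> = (\<integral>p. (case p of (s, \<xi>) \<Rightarrow> ?\<phi> s \<xi>) \<partial>lborel)"
    unfolding distr_of_altdef
  proof (rule Bochner_Integration.integral_cong)
    fix p :: "real \<times> real"
    have "p \<in> Q" if "\<bar>t - fst p\<bar> \<le> \<epsilon>" "\<bar>y - snd p\<bar> \<le> \<epsilon>" using that by (intro subsetD[OF K]) (cases p, auto)
    then show "(if p \<in> Q then case p of (s, \<xi>) \<Rightarrow> 1 * ?\<phi> s \<xi> else 0) = (case p of (s, \<xi>) \<Rightarrow> ?\<phi> s \<xi>)"
      using a0[of "t - fst p"] b0[of "y - snd p"] by (cases p) force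
  qed simp
  also have "\<dots> = (\<integral>s. (\<integral>\<xi>. ?\<phi> s \<xi> \<partial>lborel) \<partial>lborel)"
  proof -
    have "continuous_on UNIV (\<lambda>(s, \<xi>). ?\<phi> s \<xi>)" by (rule test_continuous[OF T])
    then have "integrable lborel (\<lambda>(s, \<xi>). ?\<phi> s \<xi>)"
      by (rule integrable_continuous_compact_support[OF _ compact_supp[OF T]])
        (use not_in_supp[of _ _ ?\<phi>] in auto)
    then have "integrable (lborel \<Otimes>\<^sub>M lborel) (\<lambda>(s, \<xi>). ?\<phi> s \<xi>)" by (simp add: lborel_prod)
    from lborel_pair.integral_fst[OF this] show ?thesis by (simp add: lborel_prod)
  qed
  also have "\<dots> = 1"
  proof -
    have "(\<integral>s. \<rho> (x - s) \<partial>lborel) = 1" for x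
      using lborel_integral_real_affine[of "-1" \<rho> x] int(2) by simp
    then show ?thesis by simp
  qed
  finally have one: "distr_of Q (\<lambda>s \<xi>. 1) ?\<phi> = 1" .
  have cc: "continuous_on Q (\<lambda>(s, \<xi>). d)" for d :: real by (simp add: case_prod_beta)
  have "distr_of Q (\<lambda>s \<xi>. f s \<xi> - c) ?\<phi> = distr_of Q f ?\<phi> - c"
    using distr_of_diff[OF T Q f cc[of c]] distr_of_cmult[of Q c "\<lambda>s \<xi>. 1"] one by simp
  then have "\<bar>distr_of Q f ?\<phi> - c\<bar> = \<bar>distr_of Q (\<lambda>s \<xi>. f s \<xi> - c) ?\<phi>\<bar>" by simp
  also have "\<dots> \<le> distr_of Q (\<lambda>s \<xi>. \<eta>) ?\<phi>"
  proof -
    have c1: "continuous_on Q (\<lambda>(s, \<xi>). f s \<xi> - c)"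
      using f by (auto simp: case_prod_beta intro!: continuous_intros)
    have "norm (distr_of Q (\<lambda>s \<xi>. f s \<xi> - c) ?\<phi>) \<le> distr_of Q (\<lambda>s \<xi>. \<eta>) ?\<phi>"
      unfolding distr_of_altdef
    proof (rule Bochner_Integration.integral_norm_bound_integral[OF test_mult_integrable[OF T Q c1] test_mult_integrable[OF T Q cc]])
      fix p :: "real \<times> real"
      have "?\<phi> (fst p) (snd p) \<noteq> 0 \<Longrightarrow> \<bar>f (fst p) (snd p) - c\<bar> \<le> \<eta>"
        using a0[of "t - fst p"] b0[of "y - snd p"] close[of "fst p" "snd p"] by force
      then have "\<bar>f (fst p) (snd p) - c\<bar> * ?\<phi> (fst p) (snd p) \<le> \<eta> * ?\<phi> (fst p) (snd p)"
        using nn[of "fst p" "snd p"] by (cases "?\<phi> (fst p) (snd p) = 0") (auto intro: mult_right_mono simp del: mult_eq_0_iff)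
      then show "norm (if p \<in> Q then case p of (s, \<xi>) \<Rightarrow> (f s \<xi> - c) * ?\<phi> s \<xi> else 0)
          \<le> (if p \<in> Q then case p of (s, \<xi>) \<Rightarrow> \<eta> * ?\<phi> s \<xi> else 0)"
        using abs_of_nonneg[OF nn[of "fst p" "snd p"]] by (cases p) (simp add: abs_mult[of _ "?\<phi> _ _"] del: abs_mult_self_eq)
    qed
    then show ?thesis by simp
  qed
  also have "\<dots> = \<eta>" using distr_of_cmult[of Q \<eta> "\<lambda>s \<xi>. 1"] one by simp
  finally show ?thesis .
qed

section \<open>The weak comparison principle\<close>

lemma second_derivative_nonpos_at_max:
  fixes z :: "real \<Rightarrow> real"
  assumes d: "d > 0" and max: "\<And>y. \<bar>y - y0\<bar> < d \<Longrightarrow> z y \<le> z y0"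
    and D: "\<And>y. \<bar>y - y0\<bar> < d \<Longrightarrow> (z has_real_derivative z' y) (at y)" and D2: "(z' has_real_derivative z'') (at y0)"
  shows "z' y0 = 0" "z'' \<le> 0"
proof -
  show z: "z' y0 = 0"
    by (rule DERIV_local_max[OF D d]) (use max d in \<open>auto simp: abs_minus_commute\<close>)
  show "z'' \<le> 0"
  proof (rule ccontr)
    assume "\<not> z'' \<le> 0"
    then obtain e where e: "e > 0" "\<And>h. 0 < h \<Longrightarrow> h < e \<Longrightarrow> z' y0 < z' (y0 + h)"
      using DERIV_pos_inc_right[OF D2] by auto
    define h where "h = min d e / 2"
    have h: "0 < h" "h < d" "h < e" using d e by (auto simp: h_def)
    have "z y0 < z (y0 + h)"
    proof (rule DERIV_pos_imp_increasing_open[where f=z and a=y0 and b="y0 + h"])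
      show "\<exists>l. (z has_real_derivative l) (at x) \<and> l > 0" if "y0 < x" "x < y0 + h" for x
        using D[of x] e(2)[of "x - y0"] z that h by auto
      show "continuous_on {y0..y0 + h} z"
        by (intro continuous_at_imp_continuous_on ballI DERIV_isCont[OF D]) (use h in auto)
    qed (use h in auto)
    with max[of "y0 + h"] h show False by auto
  qed
qed

lemma left_derivative_nonneg_at_max:
  fixes z :: "real \<Rightarrow> real"
  assumes D: "(z has_real_derivative z') (at t0)" and "a < t0" "\<And>t. a \<le> t \<Longrightarrow> t \<le> t0 \<Longrightarrow> z t \<le> z t0"
  shows "z' \<ge> 0"
proof (rule ccontr)
  assume "\<not> z' \<ge> 0"
  then obtain d where d: "d > 0" "\<And>h. 0 < h \<Longrightarrow> h < d \<Longrightarrow> z t0 < z (t0 - h)"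
    using DERIV_neg_dec_left[OF D] by auto
  define h where "h = min d (t0 - a) / 2"
  have "0 < h" "h < d" "a \<le> t0 - h" using d assms(2) by (auto simp: h_def min_def field_simps)
  with d(2)[of h] assms(3)[of "t0 - h"] show False by auto
qed

text \<open>
A classical comparison function, with its derivatives.
\<close>

locale barrier =
  fixes B Bt By Byy :: "real \<Rightarrow> real \<Rightarrow> real"
  assumes cont_B: "continuous_on UNIV (\<lambda>(t, y). B t y)"
    and DERIV_Bt: "\<And>t y. ((\<lambda>t. B t y) has_real_derivative Bt t y) (at t)"
    and DERIV_By: "\<And>t y. (B t has_real_derivative By t y) (at y)"
    and DERIV_Byy: "\<And>t y. (By t has_real_derivative Byy t y) (at y)"

text \<open>
Here \<open>G\<close> includes the drift \<open>b t * wy t y\<close>; the source proper is \<open>G t y - b t * wy t y\<close>.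
\<close>

locale weak_drift_equation =
  fixes Q :: "(real \<times> real) set" and \<kappa> :: real and w wy G :: "real \<Rightarrow> real \<Rightarrow> real" and b :: "real \<Rightarrow> real"
  assumes Q: "open Q" and \<kappa>: "\<kappa> \<ge> 0" and weak: "weak_heat Q \<kappa> w G"
    and cont_w: "continuous_on Q (\<lambda>(t, y). w t y)"
    and cont_wy: "continuous_on Q (\<lambda>(t, y). wy t y)"
    and cont_G: "continuous_on Q (\<lambda>(t, y). G t y)"
    and DERIV_w: "\<And>t y. (t, y) \<in> Q \<Longrightarrow> (w t has_real_derivative wy t y) (at y)"
begin

lemma uniformly_close:
  assumes f: "continuous_on Q (\<lambda>(t, y). f t y)" and K: "{t1..t2} \<times> {y1..y2} \<subseteq> Q" and "\<eta> > (0::real)"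
  obtains \<epsilon> where "\<epsilon> > 0" "\<And>t y s \<xi>. \<lbrakk>t1 \<le> t; t \<le> t2; y1 \<le> y; y \<le> y2; t1 \<le> s; s \<le> t2; y1 \<le> \<xi>; \<xi> \<le> y2;
     \<bar>t - s\<bar> \<le> \<epsilon>; \<bar>y - \<xi>\<bar> \<le> \<epsilon>\<rbrakk> \<Longrightarrow> \<bar>f s \<xi> - f t y\<bar> \<le> \<eta>"
proof -
  have "uniformly_continuous_on ({t1..t2} \<times> {y1..y2}) (\<lambda>(t, y). f t y)"
    by (intro compact_uniformly_continuous continuous_on_subset[OF f K] compact_Times compact_Icc)
  then obtain d where d: "d > 0" "\<And>p q. p \<in> {t1..t2} \<times> {y1..y2} \<Longrightarrow> q \<in> {t1..t2} \<times> {y1..y2} \<Longrightarrow>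
     dist q p < d \<Longrightarrow> dist (case q of (t, y) \<Rightarrow> f t y) (case p of (t, y) \<Rightarrow> f t y) < \<eta>"
    unfolding uniformly_continuous_on_def using assms(3) by metis
  show ?thesis
  proof (rule that[of "d / 3"])
    fix t y s \<xi> assume *: "t1 \<le> t" "t \<le> t2" "y1 \<le> y" "y \<le> y2" "t1 \<le> s" "s \<le> t2" "y1 \<le> \<xi>" "\<xi> \<le> y2"
     "\<bar>t - s\<bar> \<le> d / 3" "\<bar>y - \<xi>\<bar> \<le> d / 3"
    have "dist (s, \<xi>) (t, y) \<le> dist s t + dist \<xi> y"
      unfolding dist_Pair_Pair by (rule sqrt_sum_squares_le_sum) auto
    also have "\<dots> < d" using * d(1) by (simp add: dist_real_def abs_minus_commute)
    finally show "\<bar>f s \<xi> - f t y\<bar> \<le> \<eta>"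
      using d(2)[of "(t, y)" "(s, \<xi>)"] * by (simp add: dist_real_def)
  qed (use d in auto)
qed

text \<open>
If \<open>w\<close> exceeded \<open>B\<close> somewhere, then so would a sufficiently fine mollification \<open>W\<close>, while \<open>W < B\<close> would still hold
on the parabolic boundary. At a maximum of \<open>W - B\<close> the first derivatives in \<open>y\<close> agree, the second derivatives
are ordered one way and the time derivatives the other. But \<open>W\<close> satisfies the equation up to an error that vanishes with
the radius of the mollifier, since mollification commutes with the derivatives and moves the continuous functions
\<open>w\<close>, \<open>wy\<close> and \<open>G\<close> only a little, and \<open>B\<close> exceeds the right-hand side by \<open>\<delta>\<close>.
\<close>

lemma comparison_interior:
  assumes B: "barrier B Bt By Byy"
    and R: "{t1..t2} \<times> {y1..y2} \<subseteq> Q" and b: "continuous_on {t1..t2} b"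
    and \<delta>: "\<delta> > 0" "\<And>t y. t \<in> {t1..t2} \<Longrightarrow> y \<in> {y1..y2} \<Longrightarrow>
       G t y - b t * wy t y + \<delta> \<le> Bt t y - \<kappa> * Byy t y - b t * By t y"
    and \<gamma>: "\<gamma> > 0" "\<And>t y. t \<in> {t1..t2} \<Longrightarrow> y \<in> {y1..y2} \<Longrightarrow> t = t1 \<or> y = y1 \<or> y = y2 \<Longrightarrow> w t y + \<gamma> \<le> B t y"
    and ty: "t \<in> {t1..t2}" "y \<in> {y1..y2}"
  shows "w t y \<le> B t y"
proof (rule ccontr)
  assume neg: "\<not> w t y \<le> B t y"
  interpret barrier B Bt By Byy by fact
  have "compact ({t1..t2} \<times> {y1..y2})" by (intro compact_Times compact_Icc)
  from compact_subset_open_imp_cball_epsilon_subset[OF this Q R]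
  obtain e where e: "e > 0" "(\<Union>p\<in>{t1..t2} \<times> {y1..y2}. cball p e) \<subseteq> Q" by blast
  define r where "r = e / 2"
  have r: "r > 0" using e by (simp add: r_def)
  have K: "{t1 - r..t2 + r} \<times> {y1 - r..y2 + r} \<subseteq> Q"
  proof
    fix p assume p: "p \<in> {t1 - r..t2 + r} \<times> {y1 - r..y2 + r}"
    obtain s \<xi> where [simp]: "p = (s, \<xi>)" by (cases p)
    (* the point of the rectangle nearest to p *)
    define q where "q = (max t1 (min t2 s), max y1 (min y2 \<xi>))"
    have "dist q p \<le> dist (fst q) s + dist (snd q) \<xi>"
      unfolding dist_prod_def by (simp, rule sqrt_sum_squares_le_sum) auto
    also have "dist (fst q) s \<le> e / 2" using p ty e(1) by (auto simp: q_def r_def dist_real_def max_def min_def)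
    also have "dist (snd q) \<xi> \<le> e / 2" using p ty e(1) by (auto simp: q_def r_def dist_real_def max_def min_def)
    also have "e / 2 + e / 2 = e" by simp
    finally have "p \<in> cball q e" by simp
    moreover have "q \<in> {t1..t2} \<times> {y1..y2}" using ty by (auto simp: q_def)
    ultimately show "p \<in> Q" using e(2) by blast
  qed
  obtain \<Sigma> where \<Sigma>: "\<Sigma> \<ge> 0" "\<And>t. t \<in> {t1..t2} \<Longrightarrow> \<bar>b t\<bar> \<le> \<Sigma>"
  proof -
    have "bounded (b ` {t1..t2})" by (intro compact_imp_bounded compact_continuous_image b compact_Icc)
    then show ?thesis using that unfolding bounded_pos by (metis imageI less_imp_le real_norm_def)
  qed
  (* The tolerance of the mollification: below the margin on the parabolic boundary, below the alleged excess and,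
     after multiplication by 1 + \<Sigma> to account for the drift, below the slack \<delta> of the barrier. *)
  define \<eta> where "\<eta> = min (min (\<gamma> / 2) ((w t y - B t y) / 2)) (\<delta> / (2 * (1 + \<Sigma>)))"
  have \<eta>: "\<eta> > 0" "\<eta> < \<gamma>" "\<eta> < w t y - B t y" "(1 + \<Sigma>) * \<eta> < \<delta>"
  proof -
    show "\<eta> > 0" using \<delta>(1) \<gamma>(1) \<Sigma>(1) neg by (auto simp: \<eta>_def)
    have 1: "\<eta> \<le> \<gamma> / 2" and 2: "\<eta> \<le> (w t y - B t y) / 2" unfolding \<eta>_def by linarith+
    show "\<eta> < \<gamma>" using 1 \<gamma>(1) by linarith
    have "x / 2 < x" if "x > 0" for x :: real using that by simp
    from le_less_trans[OF 2 this] neg show "\<eta> < w t y - B t y" by simp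
    have "(1 + \<Sigma>) * \<eta> \<le> (1 + \<Sigma>) * (\<delta> / (2 * (1 + \<Sigma>)))" using \<Sigma>(1) by (intro mult_left_mono) (auto simp: \<eta>_def)
    also have "\<dots> = \<delta> / 2" using \<Sigma>(1) by (simp add: field_simps add_nonneg_eq_0_iff)
    also have "\<dots> < \<delta>" using \<delta>(1) by simp
    finally show "(1 + \<Sigma>) * \<eta> < \<delta>" .
  qed
  define near where "near = (\<lambda>\<epsilon> f. \<forall>t y s \<xi>. t1 - r \<le> t \<longrightarrow> t \<le> t2 + r \<longrightarrow> y1 - r \<le> y \<longrightarrow> y \<le> y2 + r \<longrightarrow>
     t1 - r \<le> s \<longrightarrow> s \<le> t2 + r \<longrightarrow> y1 - r \<le> \<xi> \<longrightarrow> \<xi> \<le> y2 + r \<longrightarrow> \<bar>t - s\<bar> \<le> \<epsilon> \<longrightarrow> \<bar>y - \<xi>\<bar> \<le> \<epsilon> \<longrightarrow>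
     \<bar>f s \<xi> - f t y\<bar> \<le> \<eta>)"
  obtain \<epsilon>1 where \<epsilon>1: "\<epsilon>1 > 0" "near \<epsilon>1 w"
    unfolding near_def using uniformly_close[OF cont_w K \<eta>(1)] by blast
  obtain \<epsilon>2 where \<epsilon>2: "\<epsilon>2 > 0" "near \<epsilon>2 wy"
    unfolding near_def using uniformly_close[OF cont_wy K \<eta>(1)] by blast
  obtain \<epsilon>3 where \<epsilon>3: "\<epsilon>3 > 0" "near \<epsilon>3 G"
    unfolding near_def using uniformly_close[OF cont_G K \<eta>(1)] by blast
  define \<epsilon> where "\<epsilon> = min (min (r / 2) \<epsilon>1) (min \<epsilon>2 \<epsilon>3)"
  have \<epsilon>: "\<epsilon> > 0" "\<epsilon> < r" "\<epsilon> \<le> \<epsilon>1" "\<epsilon> \<le> \<epsilon>2" "\<epsilon> \<le> \<epsilon>3" using r \<epsilon>1 \<epsilon>2 \<epsilon>3 by (auto simp: \<epsilon>_def)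
  obtain \<rho> where \<rho>: "smooth \<rho>" "\<And>x. \<rho> x \<ge> 0" "\<And>x. \<bar>x\<bar> \<ge> \<epsilon> \<Longrightarrow> \<rho> x = 0"
    "integrable lborel \<rho>" "integral\<^sup>L lborel \<rho> = 1" using smooth_mollifier_exists[OF \<epsilon>(1)] by metis
  interpret bump_pair Q \<rho> \<rho> \<epsilon> by unfold_locales (use Q \<rho> in auto)
  interpret D: bump_pair Q \<rho> "deriv \<rho>" \<epsilon> by (rule deriv_pairs)
  define W where "W = (\<lambda>t y. distr_of Q w (\<lambda>s \<xi>. \<rho> (t - s) * \<rho> (y - \<xi>)))"
  define Wt where "Wt = (\<lambda>t y. distr_of Q w (\<lambda>s \<xi>. deriv \<rho> (t - s) * \<rho> (y - \<xi>)))"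
  define Wy where "Wy = (\<lambda>t y. distr_of Q w (\<lambda>s \<xi>. \<rho> (t - s) * deriv \<rho> (y - \<xi>)))"
  define Wyy where "Wyy = (\<lambda>t y. distr_of Q w (\<lambda>s \<xi>. \<rho> (t - s) * deriv (deriv \<rho>) (y - \<xi>)))"
  have sub: "{t - \<epsilon>..t + \<epsilon>} \<times> {y - \<epsilon>..y + \<epsilon>} \<subseteq> Q" "{t - r..t + r} \<times> {y - r..y + r} \<subseteq> Q"
    if "t \<in> {t1..t2}" "y \<in> {y1..y2}" for t y
  proof -
    have "{t - r..t + r} \<times> {y - r..y + r} \<subseteq> {t1 - r..t2 + r} \<times> {y1 - r..y2 + r}" using that by auto
    with K show "{t - r..t + r} \<times> {y - r..y + r} \<subseteq> Q" by blast
    moreover have "{t - \<epsilon>..t + \<epsilon>} \<times> {y - \<epsilon>..y + \<epsilon>} \<subseteq> {t - r..t + r} \<times> {y - r..y + r}" using \<epsilon>(2) by auto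
    ultimately show "{t - \<epsilon>..t + \<epsilon>} \<times> {y - \<epsilon>..y + \<epsilon>} \<subseteq> Q" by blast
  qed
  note close = mollification_close[OF bump_pair_axioms \<rho>(2,4,5)]
  have Wclose: "\<bar>W t y - w t y\<bar> \<le> \<eta>" if "t \<in> {t1..t2}" "y \<in> {y1..y2}" for t y
    unfolding W_def by (rule close[OF cont_w sub(1)[OF that] \<epsilon>1(2)[unfolded near_def, rule_format]]) (use that \<epsilon> in auto)
  have Wyclose: "\<bar>Wy t y - wy t y\<bar> \<le> \<eta>" if "t \<in> {t1..t2}" "y \<in> {y1..y2}" for t y
  proof -
    note T = test[OF sub(1)[OF that]] and dk = dy_kernel[OF sub(1)[OF that]]
    have "Wy t y = distr_of Q wy (\<lambda>s \<xi>. \<rho> (t - s) * \<rho> (y - \<xi>))"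
      using distr_of_dy_by_parts[OF T Q cont_w cont_wy DERIV_w] unfolding dk distr_of_scale Wy_def by simp
    moreover have "\<bar>distr_of Q wy (\<lambda>s \<xi>. \<rho> (t - s) * \<rho> (y - \<xi>)) - wy t y\<bar> \<le> \<eta>"
      by (rule close[OF cont_wy sub(1)[OF that] \<epsilon>2(2)[unfolded near_def, rule_format]]) (use that \<epsilon> in auto)
    ultimately show ?thesis by simp
  qed
  have eqn: "\<bar>Wt t y - \<kappa> * Wyy t y - G t y\<bar> \<le> \<eta>" if "t \<in> {t1..t2}" "y \<in> {y1..y2}" for t y
  proof -
    note T = test[OF sub(1)[OF that]] and dk = dy_kernel[OF sub(1)[OF that]] dt_kernel[OF sub(1)[OF that]]
      D.dy_kernel[OF sub(1)[OF that]]
    have "dy (dy (\<lambda>s \<xi>. \<rho> (t - s) * \<rho> (y - \<xi>))) = (\<lambda>s \<xi>. \<rho> (t - s) * deriv (deriv \<rho>) (y - \<xi>))"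
    proof -
      have "dy (\<lambda>s \<xi>. (- 1) * (\<rho> (t - s) * deriv \<rho> (y - \<xi>))) = (\<lambda>s \<xi>. (- 1) * dy (\<lambda>s \<xi>. \<rho> (t - s) * deriv \<rho> (y - \<xi>)) s \<xi>)"
        unfolding dy_def using test_DERIV_dy[OF D.test[OF sub(1)[OF that]]]
        by (intro ext DERIV_imp_deriv DERIV_cmult) (simp add: dy_def)
      then show ?thesis unfolding dk by (simp add: fun_eq_iff)
    qed
    moreover have "distr_of Q w (dt (\<lambda>s \<xi>. \<rho> (t - s) * \<rho> (y - \<xi>))) = - Wt t y"
      unfolding dk(2) distr_of_scale Wt_def by simp
    ultimately have "Wt t y - \<kappa> * Wyy t y = distr_of Q G (\<lambda>s \<xi>. \<rho> (t - s) * \<rho> (y - \<xi>))"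
      using weak[unfolded weak_heat_def, rule_format, OF T] by (simp add: Wyy_def)
    moreover have "\<bar>distr_of Q G (\<lambda>s \<xi>. \<rho> (t - s) * \<rho> (y - \<xi>)) - G t y\<bar> \<le> \<eta>"
      by (rule close[OF cont_G sub(1)[OF that] \<epsilon>3(2)[unfolded near_def, rule_format]]) (use that \<epsilon> in auto)
    ultimately show ?thesis by simp
  qed
  have DW: "((\<lambda>t. W t y) has_real_derivative Wt t y) (at t)" "(W t has_real_derivative Wy t y) (at y)"
     "(Wy t has_real_derivative Wyy t y) (at y)" if "t \<in> {t1..t2}" "y \<in> {y1..y2}" for t y
    unfolding W_def Wt_def Wy_def Wyy_def
    by (rule convolution_DERIV_t[OF cont_w sub(2)[OF that] \<epsilon>(2)] convolution_DERIV_y[OF cont_w sub(2)[OF that] \<epsilon>(2)]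
        D.convolution_DERIV_y[OF cont_w sub(2)[OF that] \<epsilon>(2)])+
  define Z where "Z = (\<lambda>t y. W t y - B t y)"
  have "continuous_on ({t1..t2} \<times> {y1..y2}) (\<lambda>p. (case p of (t, y) \<Rightarrow> W t y) - (case p of (t, y) \<Rightarrow> B t y))"
  proof (intro continuous_on_diff)
    show "continuous_on ({t1..t2} \<times> {y1..y2}) (\<lambda>(t, y). W t y)"
      unfolding W_def
    proof (rule continuous_on_convolution[OF cont_w])
      have "{t1 - \<epsilon>..t2 + \<epsilon>} \<times> {y1 - \<epsilon>..y2 + \<epsilon>} \<subseteq> {t1 - r..t2 + r} \<times> {y1 - r..y2 + r}" using \<epsilon>(2) by auto
      with K show "{t1 - \<epsilon>..t2 + \<epsilon>} \<times> {y1 - \<epsilon>..y2 + \<epsilon>} \<subseteq> Q" by blast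
    qed
  qed (use cont_B continuous_on_subset in blast)
  moreover have "compact ({t1..t2} \<times> {y1..y2})" "{t1..t2} \<times> {y1..y2} \<noteq> {}"
    using ty by (auto intro: compact_Times)
  ultimately obtain p where p: "p \<in> {t1..t2} \<times> {y1..y2}"
    "\<forall>q\<in>{t1..t2} \<times> {y1..y2}. (case q of (t, y) \<Rightarrow> W t y) - (case q of (t, y) \<Rightarrow> B t y) \<le> (case p of (t, y) \<Rightarrow> W t y) - (case p of (t, y) \<Rightarrow> B t y)"
    using continuous_attains_sup by blast
  obtain t0 y0 where p0: "p = (t0, y0)" by (cases p)
  have in0: "t0 \<in> {t1..t2}" "y0 \<in> {y1..y2}" and max: "\<And>s \<xi>. s \<in> {t1..t2} \<Longrightarrow> \<xi> \<in> {y1..y2} \<Longrightarrow> Z s \<xi> \<le> Z t0 y0"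
    using p unfolding p0 Z_def by auto
  have pos: "Z t0 y0 > 0"
    using max[OF ty] Wclose[OF ty] \<eta>(3) unfolding Z_def by linarith
  have "\<not> (t0 = t1 \<or> y0 = y1 \<or> y0 = y2)"
  proof
    assume "t0 = t1 \<or> y0 = y1 \<or> y0 = y2"
    from \<gamma>(2)[OF in0 this] Wclose[OF in0] \<eta>(2) pos show False unfolding Z_def by linarith
  qed
  then have inner: "t1 < t0" "y1 < y0" "y0 < y2" using in0 by auto
  have DZ: "((\<lambda>t. Z t y) has_real_derivative Wt t y - Bt t y) (at t)" "(Z t has_real_derivative Wy t y - By t y) (at y)"
     "((\<lambda>y. Wy t y - By t y) has_real_derivative Wyy t y - Byy t y) (at y)" if "t \<in> {t1..t2}" "y \<in> {y1..y2}" for t y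
    unfolding Z_def by (intro DERIV_diff DW[OF that] DERIV_Bt DERIV_By DERIV_Byy)+
  have 1: "Wt t0 y0 - Bt t0 y0 \<ge> 0"
    by (rule left_derivative_nonneg_at_max[OF DZ(1)[OF in0] inner(1)]) (use max in0 in auto)
  define d where "d = min (y0 - y1) (y2 - y0)"
  have d: "d > 0" "\<And>y. \<bar>y - y0\<bar> < d \<Longrightarrow> y \<in> {y1..y2}" using inner by (auto simp: d_def)
  note second = second_derivative_nonpos_at_max[where z="Z t0" and z'="\<lambda>y. Wy t0 y - By t0 y", OF d(1) max[OF in0(1) d(2)] DZ(2)[OF in0(1) d(2)] DZ(3)[OF in0]]
  have 2: "Wy t0 y0 - By t0 y0 = 0" and 3: "Wyy t0 y0 - Byy t0 y0 \<le> 0" using second by auto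
  have "\<kappa> * Wyy t0 y0 \<le> \<kappa> * Byy t0 y0" using 3 \<kappa> by (intro mult_left_mono) auto
  moreover have "\<bar>b t0 * (Wy t0 y0 - wy t0 y0)\<bar> \<le> \<Sigma> * \<eta>"
    unfolding abs_mult using \<Sigma> Wyclose[OF in0] in0 by (intro mult_mono) auto
  moreover have "b t0 * Wy t0 y0 = b t0 * By t0 y0" using 2 by simp
  ultimately show False
    using 1 eqn[OF in0] \<delta>(2)[OF in0] \<eta>(4) unfolding right_diff_distrib distrib_right by linarith
qed

text \<open>
The equation holds only inside the rectangle, and \<open>w\<close> is merely continuous up to its boundary. Shrinking the
rectangle a little and raising the barrier by half of the alleged excess reduces this to the interior version.
\<close>

lemma comparison:
  assumes B: "barrier B Bt By Byy"
    and R: "{t1<..<t2} \<times> {y1<..<y2} \<subseteq> Q" and b: "continuous_on {t1<..<t2} b"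
    and wcl: "continuous_on ({t1..<t2} \<times> {y1..y2}) (\<lambda>(t, y). w t y)"
    and \<delta>: "\<delta> > 0" "\<And>t y. t \<in> {t1<..<t2} \<Longrightarrow> y \<in> {y1<..<y2} \<Longrightarrow>
       G t y - b t * wy t y + \<delta> \<le> Bt t y - \<kappa> * Byy t y - b t * By t y"
    and bd: "\<And>t y. t \<in> {t1..<t2} \<Longrightarrow> y \<in> {y1..y2} \<Longrightarrow> t = t1 \<or> y = y1 \<or> y = y2 \<Longrightarrow> w t y \<le> B t y"
    and ty: "t \<in> {t1<..<t2}" "y \<in> {y1<..<y2}"
  shows "w t y \<le> B t y"
proof (rule ccontr)
  assume neg: "\<not> w t y \<le> B t y"
  interpret barrier B Bt By Byy by fact
  define \<gamma> where "\<gamma> = w t y - B t y"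
  have \<gamma>: "\<gamma> > 0" using neg by (simp add: \<gamma>_def)
  let ?K = "{t1..t} \<times> {y1..y2}"
  have K: "?K \<subseteq> {t1..<t2} \<times> {y1..y2}" using ty by auto
  have "continuous_on ?K (\<lambda>p. (case p of (t, y) \<Rightarrow> w t y) - (case p of (t, y) \<Rightarrow> B t y))"
    by (intro continuous_on_diff continuous_on_subset[OF wcl K] continuous_on_subset[OF cont_B]) auto
  then have "uniformly_continuous_on ?K (\<lambda>p. (case p of (t, y) \<Rightarrow> w t y) - (case p of (t, y) \<Rightarrow> B t y))"
    by (intro compact_uniformly_continuous compact_Times compact_Icc)
  then obtain r where r: "r > 0" "\<And>p q. p \<in> ?K \<Longrightarrow> q \<in> ?K \<Longrightarrow> dist q p < r \<Longrightarrow>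
     dist ((case q of (t, y) \<Rightarrow> w t y) - (case q of (t, y) \<Rightarrow> B t y)) ((case p of (t, y) \<Rightarrow> w t y) - (case p of (t, y) \<Rightarrow> B t y)) < \<gamma> / 4"
    unfolding uniformly_continuous_on_def using \<gamma> by (metis zero_less_divide_iff zero_less_numeral)
  have close: "w s \<xi> - B s \<xi> \<le> (w s' \<xi>' - B s' \<xi>') + \<gamma> / 4"
    if "(s, \<xi>) \<in> ?K" "(s', \<xi>') \<in> ?K" "dist (s, \<xi>) (s', \<xi>') < r" for s \<xi> s' \<xi>'
    using r(2)[OF that(2,1,3)] unfolding dist_real_def prod.case by linarith
  define q where "q = min (min (r / 2) ((t - t1) / 2)) (min ((y - y1) / 2) ((y2 - y) / 2))"
  have q: "q > 0" "q < r" "t1 + q < t" "y1 + q < y" "y < y2 - q"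
  proof -
    show "q > 0" using r ty by (auto simp: q_def)
    have "q \<le> r / 2" "q \<le> (t - t1) / 2" "q \<le> (y - y1) / 2" "q \<le> (y2 - y) / 2" unfolding q_def by linarith+
    then show "q < r" "t1 + q < t" "y1 + q < y" "y < y2 - q" using r(1) ty by auto
  qed
  have "w t y \<le> B t y + \<gamma> / 2"
  proof (rule comparison_interior[where B="\<lambda>t y. B t y + \<gamma> / 2" and \<gamma>="\<gamma> / 4" and ?t1.0="t1 + q" and ?t2.0=t and ?y1.0="y1 + q" and ?y2.0="y2 - q"])
    show "barrier (\<lambda>t y. B t y + \<gamma> / 2) Bt By Byy"
    proof
      show "continuous_on UNIV (\<lambda>(t, y). B t y + \<gamma> / 2)"
        using cont_B by (auto simp: case_prod_beta intro!: continuous_intros)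
      show "((\<lambda>t. B t y + \<gamma> / 2) has_real_derivative Bt t y) (at t)" for t y
        using DERIV_add[OF DERIV_Bt DERIV_const] by simp
      show "((\<lambda>y. B t y + \<gamma> / 2) has_real_derivative By t y) (at y)" for t y
        using DERIV_add[OF DERIV_By DERIV_const] by simp
    qed (rule DERIV_Byy)
    show "{t1 + q..t} \<times> {y1 + q..y2 - q} \<subseteq> Q" using R ty q by (intro order_trans[OF _ R]) auto
    show "continuous_on {t1 + q..t} b" using ty q by (intro continuous_on_subset[OF b]) auto
    show "G s \<xi> - b s * wy s \<xi> + \<delta> \<le> Bt s \<xi> - \<kappa> * Byy s \<xi> - b s * By s \<xi>"
      if "s \<in> {t1 + q..t}" "\<xi> \<in> {y1 + q..y2 - q}" for s \<xi>
      using that q ty by (intro \<delta>) auto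
    show "w s \<xi> + \<gamma> / 4 \<le> B s \<xi> + \<gamma> / 2"
      if *: "s \<in> {t1 + q..t}" "\<xi> \<in> {y1 + q..y2 - q}" "s = t1 + q \<or> \<xi> = y1 + q \<or> \<xi> = y2 - q" for s \<xi>
    proof -
      have in_K: "(s, \<xi>) \<in> ?K" using that q by auto
      obtain s' \<xi>' where s': "(s', \<xi>') \<in> ?K" "dist (s, \<xi>) (s', \<xi>') < r" "w s' \<xi>' \<le> B s' \<xi>'"
      proof -
        consider "s = t1 + q" | "\<xi> = y1 + q" | "\<xi> = y2 - q" using *(3) by blast
        then show ?thesis
        proof cases
          case 1 then show ?thesis using bd[of t1 \<xi>] *(1,2) q ty by (intro that[of t1 \<xi>]) (auto simp: dist_Pair_Pair dist_real_def)
        next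
          case 2 then show ?thesis using bd[of s y1] *(1,2) q ty by (intro that[of s y1]) (auto simp: dist_Pair_Pair dist_real_def)
        next
          case 3 then show ?thesis using bd[of s y2] *(1,2) q ty by (intro that[of s y2]) (auto simp: dist_Pair_Pair dist_real_def)
        qed
      qed
      from close[OF in_K s'(1,2)] s'(3) show ?thesis by linarith
    qed
  qed (use \<delta>(1) \<gamma> q ty in auto)
  then show False using \<gamma> by (simp add: \<gamma>_def field_simps)
qed

lemma uminus: "weak_drift_equation Q \<kappa> (\<lambda>t y. - w t y) (\<lambda>t y. - wy t y) (\<lambda>t y. - G t y)"
  using Q \<kappa> weak_heat_uminus[OF weak] continuous_on_minus[OF cont_w] continuous_on_minus[OF cont_wy]
    continuous_on_minus[OF cont_G] DERIV_minus[OF DERIV_w]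
  by unfold_locales (auto simp: case_prod_beta)

end

text \<open>
Zero initial and boundary values, a source bounded by \<open>H\<close>, a bounded drift coefficient and a bounded \<open>w\<close>. The gradient
\<open>wy\<close> may be unbounded as \<open>y\<close> grows.
\<close>

locale half_line_drift_equation = weak_drift_equation +
  fixes t1 t2 \<Sigma> H M :: real
  assumes sub: "{t1<..<t2} \<times> {0<..} \<subseteq> Q" and cont_b: "continuous_on {t1<..<t2} b"
    and wcl: "continuous_on ({t1..<t2} \<times> {0..}) (\<lambda>(t, y). w t y)"
    and w_bounded: "\<And>t y. t \<in> {t1..<t2} \<Longrightarrow> y \<ge> 0 \<Longrightarrow> \<bar>w t y\<bar> \<le> M"
    and w_initial: "\<And>y. y \<ge> 0 \<Longrightarrow> w t1 y = 0" and w_boundary: "\<And>t. t \<in> {t1..<t2} \<Longrightarrow> w t 0 = 0"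
    and b_bounded: "\<And>t. t \<in> {t1<..<t2} \<Longrightarrow> \<bar>b t\<bar> \<le> \<Sigma>"
    and source: "\<And>t y. t \<in> {t1<..<t2} \<Longrightarrow> y > 0 \<Longrightarrow> \<bar>G t y - b t * wy t y\<bar> \<le> H"
begin

lemma uminus_half_line:
  "half_line_drift_equation Q \<kappa> (\<lambda>t y. - w t y) (\<lambda>t y. - wy t y) (\<lambda>t y. - G t y) b t1 t2 \<Sigma> H M"
proof -
  interpret N: weak_drift_equation Q \<kappa> "\<lambda>t y. - w t y" "\<lambda>t y. - wy t y" "\<lambda>t y. - G t y" b by (rule uminus)
  show ?thesis
  proof
    show "continuous_on ({t1..<t2} \<times> {0..}) (\<lambda>(t, y). - w t y)"
      using continuous_on_minus[OF wcl] by (simp add: case_prod_beta)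
    show "\<bar>- G t y - b t * - wy t y\<bar> \<le> H" if "t \<in> {t1<..<t2}" "y > 0" for t y
      using source[OF that] by (simp add: abs_minus_commute)
  qed (use sub cont_b w_bounded w_initial w_boundary b_bounded in auto)
qed

lemma \<Sigma>_nonneg: "t1 < t2 \<Longrightarrow> \<Sigma> \<ge> 0"
  using b_bounded[of "(t1 + t2) / 2"] by (auto intro: order_trans[OF abs_ge_zero])

lemma H_nonneg: "t1 < t2 \<Longrightarrow> H \<ge> 0"
  using source[of "(t1 + t2) / 2" 1] by (auto intro: order_trans[OF abs_ge_zero])

lemma M_nonneg: "t1 < t2 \<Longrightarrow> M \<ge> 0"
  using w_bounded[of t1 0] by (auto intro: order_trans[OF abs_ge_zero])

text \<open>
The barrier is \<open>H * (t - t1) + \<epsilon> * exp (y + l * (t - t1))\<close>. The exponential outgrows the bounded function \<open>w\<close> at a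
distant lateral boundary, and with \<open>l\<close> larger than \<open>\<kappa> + \<Sigma>\<close> it is a strict supersolution. Then \<open>\<epsilon>\<close> tends to 0.
\<close>

lemma upper_bound:
  assumes t: "t \<in> {t1<..<t2}" and y: "y > 0"
  shows "w t y \<le> H * (t - t1)"
proof (rule field_le_epsilon)
  fix e :: real assume e: "e > 0"
  define l where "l = \<kappa> + \<Sigma> + 1"
  (* With this \<epsilon> the exponential part of the barrier equals e at the given point. *)
  define \<epsilon> where "\<epsilon> = e / exp (y + l * (t - t1))"
  have \<epsilon>: "\<epsilon> > 0" using e by (simp add: \<epsilon>_def)
  note nn = \<Sigma>_nonneg H_nonneg M_nonneg
  have lt: "t1 < t2" using t by auto
  define B where "B = (\<lambda>t y. H * (t - t1) + \<epsilon> * exp (y + l * (t - t1)))"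
  (* Since exp R > R, the barrier exceeds the bound M of w at the lateral boundary R. *)
  define R where "R = y + 1 + M / \<epsilon>"
  have R: "R > y" "R \<ge> 0" "M \<le> \<epsilon> * exp R"
  proof -
    show "R > y" "R \<ge> 0" using nn lt \<epsilon> y by (auto simp: R_def add_pos_nonneg)
    have "M \<le> \<epsilon> * (1 + R)" using \<epsilon> y by (simp add: R_def field_simps)
    also have "\<dots> \<le> \<epsilon> * exp R" using \<epsilon> exp_ge_add_one_self[of R] by (intro mult_left_mono) auto
    finally show "M \<le> \<epsilon> * exp R" .
  qed
  have exp_mono: "exp x \<le> exp (x + l * (s - t1))" if "s \<ge> t1" for x s
    using that nn(1) lt \<kappa> by (auto simp: l_def)
  have "w t y \<le> B t y"
  proof (rule comparison[where B=B and \<delta>=\<epsilon> and ?t1.0=t1 and ?t2.0=t2 and ?y1.0=0 and ?y2.0=R])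
    show "barrier B (\<lambda>t y. H + \<epsilon> * (exp (y + l * (t - t1)) * l))
        (\<lambda>t y. \<epsilon> * exp (y + l * (t - t1))) (\<lambda>t y. \<epsilon> * exp (y + l * (t - t1)))"
      unfolding B_def by unfold_locales (auto intro!: derivative_eq_intros continuous_intros simp: case_prod_beta)
    show "{t1<..<t2} \<times> {0<..<R} \<subseteq> Q" using sub by auto
    show "continuous_on {t1<..<t2} b" by (rule cont_b)
    show "continuous_on ({t1..<t2} \<times> {0..R}) (\<lambda>(t, y). w t y)" by (rule continuous_on_subset[OF wcl]) auto
    show "G s \<xi> - b s * wy s \<xi> + \<epsilon> \<le> H + \<epsilon> * (exp (\<xi> + l * (s - t1)) * l) - \<kappa> * (\<epsilon> * exp (\<xi> + l * (s - t1))) - b s * (\<epsilon> * exp (\<xi> + l * (s - t1)))"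
      if "s \<in> {t1<..<t2}" "\<xi> \<in> {0<..<R}" for s \<xi>
    proof -
      let ?E = "exp (\<xi> + l * (s - t1))"
      have E: "?E \<ge> 1" using exp_mono[of s \<xi>] that by (intro order_trans[OF _ exp_mono]) auto
      have "\<epsilon> \<le> \<epsilon> * ?E" using E \<epsilon> by simp
      also have "\<dots> \<le> (l - \<kappa> - b s) * (\<epsilon> * ?E)"
        using b_bounded[OF that(1)] mult_right_mono[of 1 "l - \<kappa> - b s" "\<epsilon> * ?E"] \<epsilon> by (auto simp: l_def)
      finally have "\<epsilon> \<le> \<epsilon> * (?E * l) - \<kappa> * (\<epsilon> * ?E) - b s * (\<epsilon> * ?E)" by (simp add: algebra_simps)
      moreover have "G s \<xi> - b s * wy s \<xi> \<le> H" using source[of s \<xi>] that by auto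
      ultimately show ?thesis by linarith
    qed
    show "w s \<xi> \<le> B s \<xi>" if *: "s \<in> {t1..<t2}" "\<xi> \<in> {0..R}" "s = t1 \<or> \<xi> = 0 \<or> \<xi> = R" for s \<xi>
    proof -
      have Bnn: "B s x \<ge> 0" "B s x \<ge> \<epsilon> * exp x" for x
      proof -
        have "\<epsilon> * exp x \<le> \<epsilon> * exp (x + l * (s - t1))" using exp_mono[of s x] * \<epsilon> by (intro mult_left_mono) auto
        moreover have "H * (s - t1) \<ge> 0" using nn lt * by auto
        ultimately show "B s x \<ge> \<epsilon> * exp x" by (simp add: B_def)
        moreover have "\<epsilon> * exp x \<ge> 0" using \<epsilon> by simp
        ultimately show "B s x \<ge> 0" by linarith
      qed
      consider "s = t1" | "\<xi> = 0" | "\<xi> = R" using * by blast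
      then show ?thesis
      proof cases
        case 3
        then have "w s \<xi> \<le> M" using w_bounded[of s \<xi>] * by auto
        with 3 R(3) Bnn(2)[of R] show ?thesis by auto
      qed (use Bnn w_initial w_boundary * in auto)
    qed
  qed (use \<epsilon> t y R in auto)
  also have "B t y = H * (t - t1) + e" by (simp add: B_def \<epsilon>_def)
  finally show "w t y \<le> H * (t - t1) + e" .
qed

lemma bound:
  assumes t: "t \<in> {t1<..<t2}" and y: "y > 0"
  shows "\<bar>w t y\<bar> \<le> H * (t - t1)"
proof -
  interpret N: half_line_drift_equation Q \<kappa> "\<lambda>t y. - w t y" "\<lambda>t y. - wy t y" "\<lambda>t y. - G t y" b t1 t2 \<Sigma> H M
    by (rule uminus_half_line)
  show ?thesis using upper_bound[OF t y] N.upper_bound[OF t y] by auto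
qed

text \<open>
The barrier is the parabola \<open>(H + e) * (A * y - y\<^sup>2 / \<kappa>)\<close> with \<open>A = (1 + 1 / \<kappa>) * l\<close>. Its second derivative contributes
\<open>2 * (H + e)\<close>, of which the drift uses up at most one half when \<open>l\<close> is small, and at \<open>y = l\<close> it equals \<open>(H + e) * l\<^sup>2\<close>, which
dominates \<open>w\<close> by the previous bound because \<open>t - t1 \<le> l\<^sup>2\<close>.
\<close>

lemma upper_bound_near_boundary:
  assumes \<kappa>0: "\<kappa> > 0" and l: "l > 0" "t2 \<le> t1 + l^2" "\<Sigma> * l * (1 + 3 / \<kappa>) \<le> 1"
    and t: "t \<in> {t1<..<t2}" and y: "0 < y" "y < l"
  shows "w t y \<le> H * ((1 + 1 / \<kappa>) * l) * y"
proof (rule field_le_epsilon)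
  fix e' :: real assume e': "e' > 0"
  define A where "A = (1 + 1 / \<kappa>) * l"
  have A: "A > 0" using \<kappa>0 l by (simp add: A_def add_pos_pos)
  define e where "e = e' / (A * y)"
  have e: "e > 0" using e' A y by (simp add: e_def)
  have lt: "t1 < t2" using t by auto
  note nn = \<Sigma>_nonneg[OF lt] H_nonneg[OF lt]
  define B where "B = (\<lambda>(t::real) y. (H + e) * (A * y - y^2 / \<kappa>))"
  have "w t y \<le> B t y"
  proof (rule comparison[where B=B and \<delta>=e and ?t1.0=t1 and ?t2.0=t2 and ?y1.0=0 and ?y2.0=l])
    show "barrier B (\<lambda>t y. 0) (\<lambda>t y. (H + e) * (A - 2 * y / \<kappa>)) (\<lambda>t y. (H + e) * (- (2 / \<kappa>)))"
      unfolding B_def using \<kappa>0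
      by unfold_locales (auto intro!: derivative_eq_intros continuous_intros simp: case_prod_beta)
    show "{t1<..<t2} \<times> {0<..<l} \<subseteq> Q" using sub by auto
    show "continuous_on {t1<..<t2} b" by (rule cont_b)
    show "continuous_on ({t1..<t2} \<times> {0..l}) (\<lambda>(t, y). w t y)" by (rule continuous_on_subset[OF wcl]) auto
    show "G s \<xi> - b s * wy s \<xi> + e \<le> 0 - \<kappa> * ((H + e) * (- (2 / \<kappa>))) - b s * ((H + e) * (A - 2 * \<xi> / \<kappa>))"
      if "s \<in> {t1<..<t2}" "\<xi> \<in> {0<..<l}" for s \<xi>
    proof -
      have "\<bar>A - 2 * \<xi> / \<kappa>\<bar> \<le> \<bar>A\<bar> + \<bar>2 * \<xi> / \<kappa>\<bar>" by (rule abs_triangle_ineq4)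
      also have "\<bar>2 * \<xi> / \<kappa>\<bar> \<le> 2 * l / \<kappa>" using that \<kappa>0 by (auto simp: divide_right_mono)
      also have "\<bar>A\<bar> + 2 * l / \<kappa> = l * (1 + 3 / \<kappa>)" using A by (simp add: A_def algebra_simps)
      finally have "\<bar>A - 2 * \<xi> / \<kappa>\<bar> \<le> l * (1 + 3 / \<kappa>)" by simp
      then have "\<bar>b s * (A - 2 * \<xi> / \<kappa>)\<bar> \<le> \<Sigma> * (l * (1 + 3 / \<kappa>))"
        unfolding abs_mult using b_bounded[OF that(1)] nn by (intro mult_mono) auto
      then have "b s * (A - 2 * \<xi> / \<kappa>) \<le> 1" using l(3) by (simp add: mult.assoc)
      then have "(H + e) * (b s * (A - 2 * \<xi> / \<kappa>)) \<le> H + e" using nn e by (simp add: mult_left_le)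
      moreover have "\<kappa> * ((H + e) * (- (2 / \<kappa>))) = - 2 * (H + e)" using \<kappa>0 by simp
      moreover have "G s \<xi> - b s * wy s \<xi> \<le> H" using source[of s \<xi>] that by auto
      ultimately show ?thesis by (simp add: mult.left_commute)
    qed
    show "w s \<xi> \<le> B s \<xi>" if *: "s \<in> {t1..<t2}" "\<xi> \<in> {0..l}" "s = t1 \<or> \<xi> = 0 \<or> \<xi> = l" for s \<xi>
    proof -
      (* the chord of the concave parabola over [0, l] has slope l *)
      have "A * x - x^2 / \<kappa> = l * x + x * (l - x) / \<kappa>" for x
        by (simp add: A_def algebra_simps diff_divide_distrib add_divide_distrib power2_eq_square)
      moreover have "x * (l - x) / \<kappa> \<ge> 0" if "0 \<le> x" "x \<le> l" for x using that \<kappa>0 by auto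
      ultimately have Bge: "B s x \<ge> (H + e) * (l * x)" if "0 \<le> x" "x \<le> l" for x
        unfolding B_def using nn e that by (intro mult_left_mono) auto
      have Bnn: "B s x \<ge> 0" if "0 \<le> x" "x \<le> l" for x
        using nn e l that by (intro order_trans[OF _ Bge[OF that]]) auto
      show ?thesis
      proof (cases "s = t1 \<or> \<xi> = 0")
        case True
        then show ?thesis using Bnn[of \<xi>] w_initial[of \<xi>] w_boundary[of s] * by auto
      next
        case False
        then have "w s \<xi> \<le> H * (s - t1)" using upper_bound[of s \<xi>] * l by auto
        also have "\<dots> \<le> (H + e) * l^2" using nn e * l by (intro mult_mono) auto
        finally show ?thesis using Bge[of l] False * l by (auto simp: power2_eq_square)
      qed
    qed
  qed (use e t y in auto)
  also have "B t y \<le> (H + e) * (A * y)" unfolding B_def using nn e \<kappa>0 by (intro mult_left_mono) auto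
  also have "\<dots> = H * A * y + e'" using A y by (simp add: e_def field_simps)
  finally show "w t y \<le> H * ((1 + 1 / \<kappa>) * l) * y + e'" by (simp add: A_def)
qed

lemma boundary_gradient_bound:
  assumes \<kappa>0: "\<kappa> > 0" and l: "l > 0" "t2 \<le> t1 + l^2" "\<Sigma> * l * (1 + 3 / \<kappa>) \<le> 1"
    and t: "t \<in> {t1<..<t2}" and L: "(wy t \<longlongrightarrow> L) (at_right 0)"
  shows "\<bar>L\<bar> \<le> H * ((1 + 1 / \<kappa>) * l)" (is "_ \<le> ?C")
proof (rule ccontr)
  assume neg: "\<not> \<bar>L\<bar> \<le> ?C"
  interpret N: half_line_drift_equation Q \<kappa> "\<lambda>t y. - w t y" "\<lambda>t y. - wy t y" "\<lambda>t y. - G t y" b t1 t2 \<Sigma> H M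
    by (rule uminus_half_line)
  have wC: "\<bar>w t y\<bar> \<le> ?C * y" if "0 < y" "y < l" for y
    using upper_bound_near_boundary[OF \<kappa>0 l t that] N.upper_bound_near_boundary[OF \<kappa>0 l t that] by auto
  have "((\<lambda>y. \<bar>wy t y\<bar>) \<longlongrightarrow> \<bar>L\<bar>) (at_right 0)" by (intro tendsto_intros L)
  then have "eventually (\<lambda>y. \<bar>wy t y\<bar> > ?C) (at_right 0)" using neg by (intro order_tendstoD) auto
  then obtain d where d: "d > 0" "\<And>y. 0 < y \<Longrightarrow> y < d \<Longrightarrow> \<bar>wy t y\<bar> > ?C"
    unfolding eventually_at_right_field by auto
  define y where "y = min d l / 2"
  have y: "0 < y" "y < d" "y < l" using d l by (auto simp: y_def)
  have "continuous_on {0..y} (w t)"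
    by (rule continuous_on_subset[OF continuous_on_slices(1)[OF wcl]]) (use t in auto)
  then obtain z where z: "0 < z" "z < y" "w t y - w t 0 = (y - 0) * wy t z"
    using MVT[of 0 y "w t"] y DERIV_w sub t
    by (smt (verit) DERIV_unique greaterThanLessThan_iff greaterThan_iff mem_Sigma_iff real_differentiable_def subsetD)
  then have "y * \<bar>wy t z\<bar> = \<bar>w t y\<bar>" using w_boundary[of t] t y by (auto simp: abs_mult)
  also have "\<dots> \<le> ?C * y" using wC y by auto
  finally have "\<bar>wy t z\<bar> \<le> ?C" using y(1) by (simp add: mult.commute)
  with d(2)[of z] z y show False by auto
qed

end

section \<open>The radiation operator\<close>

lemma E1_integrand_measurable [measurable]:
  "(\<lambda>p. indicator {\<bar>fst p\<bar>..} (snd p) *\<^sub>R (exp (- snd p) / snd p) :: real) \<in> borel_measurable (lborel \<Otimes>\<^sub>M lborel)"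
proof -
  have "(\<lambda>p. if \<bar>fst p\<bar> \<le> snd p then exp (- snd p) / snd p else (0::real)) \<in> borel_measurable (lborel \<Otimes>\<^sub>M lborel)"
    by measurable
  also have "(\<lambda>p. if \<bar>fst p\<bar> \<le> snd p then exp (- snd p) / snd p else (0::real)) =
    (\<lambda>p. indicator {\<bar>fst p\<bar>..} (snd p) *\<^sub>R (exp (- snd p) / snd p))" by (auto simp: indicator_def)
  finally show ?thesis .
qed

lemma E1_measurable [measurable]: "E1 \<in> borel_measurable borel"
proof -
  have "(\<lambda>(x, r). indicator {\<bar>x\<bar>..} r *\<^sub>R (exp (- r) / r) :: real) \<in> borel_measurable (lborel \<Otimes>\<^sub>M lborel)"
    using E1_integrand_measurable by (simp add: case_prod_beta)
  from lborel.borel_measurable_lebesgue_integral[OF this] show ?thesis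
    unfolding E1_def[abs_def] set_lebesgue_integral_def by simp
qed

lemma E1_nonneg: "E1 x \<ge> 0"
  unfolding E1_def set_lebesgue_integral_def by (rule Bochner_Integration.integral_nonneg) (auto simp: indicator_def)

text \<open>
By Tonelli's theorem the double integral is \<open>\<integral> 2 r * exp (-r) / r dr = 2\<close>. Where the defining integral
diverges, the Bochner integral is 0 and hence still below the true value.
\<close>

lemma nn_integral_E1_le: "(\<integral>\<^sup>+x. ennreal (E1 x) \<partial>lborel) \<le> 2"
proof -
  let ?f = "\<lambda>x r. indicator {\<bar>x\<bar>..} r *\<^sub>R (exp (- r) / r) :: real"
  have "(\<lambda>p. ennreal (?f (fst p) (snd p))) \<in> borel_measurable (lborel \<Otimes>\<^sub>M lborel)"
    using E1_integrand_measurable by measurable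
  then have m: "(\<lambda>(x, r). ennreal (?f x r)) \<in> borel_measurable (lborel \<Otimes>\<^sub>M lborel)"
    by (simp add: case_prod_beta)
  have "E1 x = enn2real (\<integral>\<^sup>+r. ennreal (?f x r) \<partial>lborel)" for x
    unfolding E1_def set_lebesgue_integral_def
    by (rule integral_eq_nn_integral) (auto simp: indicator_def)
  then have "(\<integral>\<^sup>+x. ennreal (E1 x) \<partial>lborel) \<le> (\<integral>\<^sup>+x. (\<integral>\<^sup>+r. ennreal (?f x r) \<partial>lborel) \<partial>lborel)"
    by (intro nn_integral_mono) (simp add: ennreal_enn2real_if)
  also have "\<dots> = (\<integral>\<^sup>+r. (\<integral>\<^sup>+x. ennreal (?f x r) \<partial>lborel) \<partial>lborel)"
    using lborel_pair.Fubini'[OF m] by simp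
  also have "\<dots> \<le> (\<integral>\<^sup>+r. 2 * (ennreal (r ^ 0 * exp (- r)) * indicator {0..} r) \<partial>lborel)"
  proof (rule nn_integral_mono)
    fix r :: real
    show "(\<integral>\<^sup>+x. ennreal (?f x r) \<partial>lborel) \<le> 2 * (ennreal (r ^ 0 * exp (- r)) * indicator {0..} r)"
    proof (cases "r > 0")
      case True
      have "(\<integral>\<^sup>+x. ennreal (?f x r) \<partial>lborel) = (\<integral>\<^sup>+x. ennreal (exp (- r) / r) * indicator {- r..r} x \<partial>lborel)"
        by (rule nn_integral_cong) (auto simp: indicator_def)
      also have "\<dots> = ennreal (exp (- r) / r) * ennreal (2 * r)"
        using True by (simp add: nn_integral_cmult_indicator)
      also have "\<dots> = ennreal (2 * exp (- r))" using True by (simp add: ennreal_mult[symmetric])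
      finally show ?thesis using True by (simp add: ennreal_mult)
    next
      case False
      then have z: "?f x r = 0" for x by (auto simp: indicator_def)
      have "(\<integral>\<^sup>+x. ennreal (?f x r) \<partial>lborel) = (\<integral>\<^sup>+x. 0 \<partial>(lborel :: real measure))"
        by (rule nn_integral_cong) (simp only: z ennreal_0)
      then show ?thesis by simp
    qed
  qed
  also have "\<dots> = 2 * (\<integral>\<^sup>+r. (ennreal (r ^ 0 * exp (- r)) * indicator {0..} r) \<partial>lborel)"
    by (rule nn_integral_cmult) simp
  also have "\<dots> = 2" using nn_intergal_power_times_exp_Ici[of 0] by simp
  finally show ?thesis .
qed

lemma integrable_E1: "integrable lborel E1"
  and integral_E1_le: "integral\<^sup>L lborel E1 \<le> 2"
proof -
  have "(\<integral>\<^sup>+x. ennreal (norm (E1 x)) \<partial>lborel) < \<infinity>"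
    using nn_integral_E1_le E1_nonneg by (auto intro: le_less_trans)
  then show i: "integrable lborel E1" by (intro integrableI_bounded) auto
  show "integral\<^sup>L lborel E1 \<le> 2"
    using nn_integral_eq_integral[OF i] nn_integral_E1_le E1_nonneg
    by (metis AE_I2 ennreal_le_iff ennreal_numeral zero_le_numeral)
qed

definition radiation_kernel :: "real \<Rightarrow> real \<Rightarrow> real" where
  "radiation_kernel \<alpha> z = \<alpha> * E1 (\<alpha> * z) / 2"

lemma radiation_kernel_nonneg: "\<alpha> > 0 \<Longrightarrow> radiation_kernel \<alpha> z \<ge> 0"
  using E1_nonneg by (simp add: radiation_kernel_def)

lemma radiation_kernel_measurable [measurable]: "radiation_kernel \<alpha> \<in> borel_measurable borel"
  unfolding radiation_kernel_def[abs_def] by measurable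

lemma integrable_radiation_kernel: "\<alpha> > 0 \<Longrightarrow> integrable lborel (radiation_kernel \<alpha>)"
  and integral_radiation_kernel_le: "\<alpha> > 0 \<Longrightarrow> integral\<^sup>L lborel (radiation_kernel \<alpha>) \<le> 1"
proof -
  assume a: "\<alpha> > 0"
  have "integrable lborel (\<lambda>z. E1 (0 + \<alpha> * z))"
    using lborel_integrable_real_affine[OF integrable_E1, of \<alpha> 0] a by simp
  then show "integrable lborel (radiation_kernel \<alpha>)"
    unfolding radiation_kernel_def[abs_def] by simp
  have "integral\<^sup>L lborel E1 = \<alpha> * (\<integral>z. E1 (\<alpha> * z) \<partial>lborel)"
    using lborel_integral_real_affine[of \<alpha> E1 0] a by simp
  moreover have "integral\<^sup>L lborel (radiation_kernel \<alpha>) = \<alpha> * (\<integral>z. E1 (\<alpha> * z) \<partial>lborel) / 2"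
    unfolding radiation_kernel_def[abs_def] by simp
  ultimately show "integral\<^sup>L lborel (radiation_kernel \<alpha>) \<le> 1" using integral_E1_le by simp
qed

text \<open>
After the substitution \<open>z = y - \<eta>\<close> the kernel depends neither on \<open>t\<close> nor on \<open>y\<close>, so it serves as a majorant. The
clamp \<open>max 0\<close> keeps the argument in the half-line where the temperature is continuous.
\<close>

lemma I_op_altdef:
  "I_op \<alpha> T t y = (T t y) ^ 4 -
     (\<integral>z. radiation_kernel \<alpha> z * (if z \<le> y then (T t (max 0 (y - z))) ^ 4 else 0) \<partial>lborel)"
proof -
  have "set_lebesgue_integral lborel {0..} (\<lambda>\<eta>. \<alpha> * E1 (\<alpha> * (y - \<eta>)) / 2 * (T t \<eta>) ^ 4) =
    (\<integral>z. indicator {0..} (y - z) * (radiation_kernel \<alpha> z * (T t (y - z)) ^ 4) \<partial>lborel)"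
    unfolding set_lebesgue_integral_def radiation_kernel_def
    by (subst lborel_integral_real_affine[of "-1" _ y]) auto
  also have "\<dots> = (\<integral>z. radiation_kernel \<alpha> z * (if z \<le> y then (T t (max 0 (y - z))) ^ 4 else 0) \<partial>lborel)"
    by (rule Bochner_Integration.integral_cong) (auto simp: indicator_def max_def)
  finally show ?thesis unfolding I_op_def by simp
qed

lemma radiation_integrand_measurable:
  assumes "continuous_on {0..} (T t)"
  shows "(\<lambda>z. radiation_kernel \<alpha> z * (if z \<le> y then (T t (max 0 (y - z))) ^ 4 else 0)) \<in> borel_measurable borel"
proof -
  have "continuous_on UNIV (\<lambda>z. T t (max 0 (y - z)))"
    by (rule continuous_on_compose2[OF assms]) (auto intro!: continuous_intros)
  then have [measurable]: "(\<lambda>z. T t (max 0 (y - z))) \<in> borel_measurable borel"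
    by (rule borel_measurable_continuous_onI)
  show ?thesis by measurable
qed

lemma power4_diff_le:
  assumes "\<bar>a\<bar> \<le> M" "\<bar>b\<bar> \<le> (M::real)"
  shows "\<bar>a ^ 4 - b ^ 4\<bar> \<le> 4 * M ^ 3 * \<bar>a - b\<bar>"
proof -
  have M: "M \<ge> 0" using assms by auto
  have "a ^ 4 - b ^ 4 = (a ^ 3 + a ^ 2 * b + a * b ^ 2 + b ^ 3) * (a - b)"
    by (simp add: algebra_simps power_numeral_reduce)
  then have "\<bar>a ^ 4 - b ^ 4\<bar> = \<bar>a ^ 3 + a ^ 2 * b + a * b ^ 2 + b ^ 3\<bar> * \<bar>a - b\<bar>" by (simp add: abs_mult)
  also have "\<dots> \<le> (4 * M ^ 3) * \<bar>a - b\<bar>"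
  proof (rule mult_right_mono)
    have p: "\<bar>a ^ i * b ^ j\<bar> \<le> M ^ i * M ^ j" for i j
      unfolding abs_mult power_abs using assms M by (intro mult_mono power_mono) auto
    have "\<bar>a ^ 3\<bar> \<le> M ^ 3" "\<bar>a ^ 2 * b\<bar> \<le> M ^ 3" "\<bar>a * b ^ 2\<bar> \<le> M ^ 3" "\<bar>b ^ 3\<bar> \<le> M ^ 3"
      using p[of 3 0] p[of 2 1] p[of 1 2] p[of 0 3] by (simp_all add: power_add[symmetric] power2_eq_square power3_eq_cube mult.assoc)
    then show "\<bar>a ^ 3 + a ^ 2 * b + a * b ^ 2 + b ^ 3\<bar> \<le> 4 * M ^ 3" by linarith
  qed simp
  finally show ?thesis .
qed

text \<open>
The local and the nonlocal term each contribute the Lipschitz constant \<open>4 * M ^ 3\<close> of the fourth power, the latter because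
the kernel has mass at most 1.
\<close>

lemma I_op_lipschitz:
  assumes \<alpha>: "\<alpha> > 0" and c: "continuous_on {0..} (T t)" "continuous_on {0..} (T' t)"
    and M: "\<And>y. y \<ge> 0 \<Longrightarrow> \<bar>T t y\<bar> \<le> M" "\<And>y. y \<ge> 0 \<Longrightarrow> \<bar>T' t y\<bar> \<le> M"
    and \<delta>: "\<And>y. y \<ge> 0 \<Longrightarrow> \<bar>T t y - T' t y\<bar> \<le> \<delta>" and y: "y \<ge> 0"
  shows "\<bar>I_op \<alpha> T t y - I_op \<alpha> T' t y\<bar> \<le> 8 * M ^ 3 * \<delta>"
proof -
  let ?k = "radiation_kernel \<alpha>"
  let ?g = "\<lambda>T z. if z \<le> y then (T t (max 0 (y - z))) ^ 4 else 0"
  have M0: "M \<ge> 0" using M(1)[of 0] by auto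
  have \<delta>0: "\<delta> \<ge> 0" using \<delta>[of 0] by auto
  have 4: "\<bar>(T t x) ^ 4 - (T' t x) ^ 4\<bar> \<le> 4 * M ^ 3 * \<delta>" if "x \<ge> 0" for x
  proof -
    have "\<bar>(T t x) ^ 4 - (T' t x) ^ 4\<bar> \<le> 4 * M ^ 3 * \<bar>T t x - T' t x\<bar>" by (rule power4_diff_le) (use M that in auto)
    also have "\<dots> \<le> 4 * M ^ 3 * \<delta>" using \<delta>[OF that] M0 by (intro mult_left_mono) auto
    finally show ?thesis .
  qed
  have int: "integrable lborel (\<lambda>z. ?k z * ?g S z)"
    if "continuous_on {0..} (S t)" "\<And>y. y \<ge> 0 \<Longrightarrow> \<bar>S t y\<bar> \<le> M" for S
  proof (rule Bochner_Integration.integrable_bound[where f="\<lambda>z. M ^ 4 * ?k z"])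
    show "integrable lborel (\<lambda>z. M ^ 4 * ?k z)" using integrable_radiation_kernel[OF \<alpha>] by simp
    show "AE z in lborel. norm (?k z * ?g S z) \<le> norm (M ^ 4 * ?k z)"
    proof (rule AE_I2)
      fix z
      have "\<bar>?g S z\<bar> \<le> M ^ 4" using that(2) power_mono[of "\<bar>S t (max 0 (y - z))\<bar>" M 4] M0 by (auto simp: power_abs)
      then show "norm (?k z * ?g S z) \<le> norm (M ^ 4 * ?k z)"
        using radiation_kernel_nonneg[OF \<alpha>, of z] M0 by (auto simp: abs_mult mult.commute intro: mult_left_mono)
    qed
  qed (use radiation_integrand_measurable[where T=S and t=t, OF that(1)] in simp)
  have "\<bar>(\<integral>z. ?k z * ?g T z \<partial>lborel) - (\<integral>z. ?k z * ?g T' z \<partial>lborel)\<bar>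
    = \<bar>\<integral>z. ?k z * ?g T z - ?k z * ?g T' z \<partial>lborel\<bar>"
    by (subst Bochner_Integration.integral_diff) (use int c M in auto)
  also have "\<dots> \<le> (\<integral>z. (4 * M ^ 3 * \<delta>) * ?k z \<partial>lborel)"
  proof -
    have "norm (\<integral>z. ?k z * ?g T z - ?k z * ?g T' z \<partial>lborel) \<le> (\<integral>z. (4 * M ^ 3 * \<delta>) * ?k z \<partial>lborel)"
    proof (rule Bochner_Integration.integral_norm_bound_integral)
      fix z
      have "\<bar>?g T z - ?g T' z\<bar> \<le> 4 * M ^ 3 * \<delta>" using 4[of "max 0 (y - z)"] M0 \<delta>0 by auto
      then show "norm (?k z * ?g T z - ?k z * ?g T' z) \<le> (4 * M ^ 3 * \<delta>) * ?k z"
        using radiation_kernel_nonneg[OF \<alpha>, of z]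
        unfolding right_diff_distrib[symmetric] real_norm_def abs_mult mult.commute[of "4 * M ^ 3 * \<delta>"]
        by (intro mult_mono) auto
    qed (use int c M integrable_radiation_kernel[OF \<alpha>] in auto)
    then show ?thesis by simp
  qed
  also have "\<dots> \<le> 4 * M ^ 3 * \<delta>"
    using mult_left_mono[OF integral_radiation_kernel_le[OF \<alpha>], of "4 * M ^ 3 * \<delta>"] M0 \<delta>0 by simp
  finally show ?thesis using 4[OF y] unfolding I_op_altdef by linarith
qed

lemma I_op_zero: "I_op \<alpha> (\<lambda>t y. 0) t y = 0"
proof -
  have "(\<lambda>z. radiation_kernel \<alpha> z * (if z \<le> y then 0 ^ 4 else 0)) = (\<lambda>z. 0)" by auto
  then show ?thesis unfolding I_op_altdef by simp
qed

lemma I_op_bound: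
  assumes \<alpha>: "\<alpha> > 0" and c: "continuous_on {0..} (T t)"
    and M: "\<And>y. y \<ge> 0 \<Longrightarrow> \<bar>T t y\<bar> \<le> M" and y: "y \<ge> 0"
  shows "\<bar>I_op \<alpha> T t y\<bar> \<le> 8 * M ^ 4"
proof -
  have "M \<ge> 0" using M[of 0] by auto
  then have "\<bar>I_op \<alpha> T t y - I_op \<alpha> (\<lambda>t y. 0) t y\<bar> \<le> 8 * M ^ 3 * M"
    by (intro I_op_lipschitz) (use assms in auto)
  then show ?thesis by (simp add: I_op_zero power_numeral_reduce mult.assoc)
qed

lemma continuous_within_local:
  assumes "continuous_on (S \<inter> U) f" "open U" "p \<in> U" "p \<in> S"
  shows "continuous (at p within S) f"
proof -
  have "at p within S = at p within (S \<inter> U)" by (rule at_within_nhd[OF assms(3,2)]) auto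
  then show ?thesis using assms by (simp add: continuous_on_eq_continuous_within)
qed

text \<open>
For fixed \<open>z\<close> the integrand is discontinuous only where \<open>y = z\<close>.
\<close>

lemma continuous_on_I_op:
  assumes \<alpha>: "\<alpha> > 0" and c: "continuous_on (A \<times> {0..}) (\<lambda>(t, y). T t y)"
    and M: "\<And>t y. t \<in> A \<Longrightarrow> y \<ge> 0 \<Longrightarrow> \<bar>T t y\<bar> \<le> M"
  shows "continuous_on (A \<times> {0..}) (\<lambda>(t, y). I_op \<alpha> T t y)"
proof -
  let ?k = "radiation_kernel \<alpha>"
  let ?g = "\<lambda>p z. if z \<le> snd p then (T (fst p) (max 0 (snd p - z))) ^ 4 else 0"
  note ct = continuous_on_slices(1)[OF c]
  have "continuous_on (A \<times> {0..}) (\<lambda>p. \<integral>z. ?k z * ?g p z \<partial>lborel)"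
  proof (rule continuous_on_integral_dominated[where m="\<lambda>z. M ^ 4 * ?k z"])
    fix p assume p: "p \<in> A \<times> {0 :: real..}"
    show "(\<lambda>z. ?k z * ?g p z) \<in> borel_measurable lborel"
      using radiation_integrand_measurable[where T=T and t="fst p" and y="snd p" and \<alpha>=\<alpha>, OF ct] p by (cases p) simp
    show "AE z in lborel. continuous (at p within A \<times> {0..}) (\<lambda>p. ?k z * ?g p z)"
      using AE_lborel_singleton[of "snd p"]
    proof eventually_elim
      case (elim z)
      have cT: "continuous_on (A \<times> {0..}) (\<lambda>p. (T (fst p) (max 0 (snd p - z))) ^ 4)"
        by (intro continuous_on_power continuous_on_compose2[OF c, where f="\<lambda>p. (fst p, max 0 (snd p - z))", simplified])
          (auto intro!: continuous_intros)
      show ?case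
      proof (cases "z < snd p")
        case True
        have "continuous_on ((A \<times> {0..}) \<inter> {p. z < snd p}) (\<lambda>p. ?k z * ?g p z)"
          by (rule continuous_on_eq[where f="\<lambda>p. ?k z * (T (fst p) (max 0 (snd p - z))) ^ 4"])
            (auto intro!: continuous_on_mult continuous_on_const continuous_on_subset[OF cT])
        moreover have "open {p :: real \<times> real. z < snd p}" by (intro open_Collect_less continuous_intros)
        ultimately show ?thesis using True p by (intro continuous_within_local[where U="{p. z < snd p}"]) auto
      next
        case False
        have "continuous_on ((A \<times> {0..}) \<inter> {p. z > snd p}) (\<lambda>p. ?k z * ?g p z)"
          by (rule continuous_on_eq[where f="\<lambda>p. 0"]) auto
        moreover have "open {p :: real \<times> real. z > snd p}" by (intro open_Collect_less continuous_intros)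
        ultimately show ?thesis using False elim p by (intro continuous_within_local[where U="{p. z > snd p}"]) auto
      qed
    qed
    show "AE z in lborel. \<bar>?k z * ?g p z\<bar> \<le> M ^ 4 * ?k z"
    proof (rule AE_I2)
      fix z
      have "\<bar>T (fst p) (max 0 (snd p - z))\<bar> \<le> M" using M p by auto
      then have "\<bar>?g p z\<bar> \<le> M ^ 4"
        using power_mono[of "\<bar>T (fst p) (max 0 (snd p - z))\<bar>" M 4] by (auto simp: power_abs)
      then show "\<bar>?k z * ?g p z\<bar> \<le> M ^ 4 * ?k z"
        using radiation_kernel_nonneg[OF \<alpha>, of z] by (simp only: abs_mult abs_of_nonneg mult.commute mult_left_mono)
    qed
  qed (use integrable_radiation_kernel[OF \<alpha>] in simp)
  moreover have "continuous_on (A \<times> {0..}) (\<lambda>p. (T (fst p) (snd p)) ^ 4)"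
    using c by (intro continuous_on_power) (simp add: case_prod_beta)
  ultimately show ?thesis unfolding I_op_altdef case_prod_beta by (intro continuous_on_diff)
qed

section \<open>The Stefan problem on the half-line and uniqueness\<close>

abbreviation half_cylinder :: "real \<Rightarrow> (real \<times> real) set" where
  "half_cylinder \<tau> \<equiv> {0<..<\<tau>} \<times> {0<..}"

text \<open>
The first argument is the gradient of the reflected first phase. The reflection changes the sign of that gradient and
turns the difference in the Stefan condition into a sum.
\<close>

definition interface_speed :: "real \<Rightarrow> real \<Rightarrow> (real \<Rightarrow> real \<Rightarrow> real) \<Rightarrow> (real \<Rightarrow> real \<Rightarrow> real) \<Rightarrow> real \<Rightarrow> real" where
  "interface_speed K L d1 d2 t = 1 / L * (d2 t 0 + K * d1 t 0)"

lemma continuous_on_interface_speed: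
  assumes "L > 0" "continuous_on (A \<times> {0..}) (\<lambda>(t, y). d1 t y)" "continuous_on (A \<times> {0..}) (\<lambda>(t, y). d2 t y)"
  shows "continuous_on A (interface_speed K L d1 d2)"
  unfolding interface_speed_def[abs_def] using assms continuous_on_slices(2)[of A "{0..}" _ 0]
  by (intro continuous_intros) auto

text \<open>
The free boundary problem on the half-line: \<open>v1\<close> is the reflected first phase, \<open>f1\<close> its initial profile, and \<open>d1\<close>, \<open>d2\<close>
are the gradients together with their continuous extensions to the boundary.
\<close>

locale half_line_stefan =
  fixes \<kappa> K L \<alpha> TM \<tau> M :: real and f1 f2 :: "real \<Rightarrow> real"
    and v1 d1 v2 d2 :: "real \<Rightarrow> real \<Rightarrow> real"
  assumes pos: "\<kappa> > 0" "K > 0" "L > 0" "\<alpha> > 0" "\<tau> > 0"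
    and cont_v: "continuous_on ({0..\<tau>} \<times> {0..}) (\<lambda>(t, y). v1 t y)" "continuous_on ({0..\<tau>} \<times> {0..}) (\<lambda>(t, y). v2 t y)"
    and cont_d: "continuous_on ({0..\<tau>} \<times> {0..}) (\<lambda>(t, y). d1 t y)" "continuous_on ({0..\<tau>} \<times> {0..}) (\<lambda>(t, y). d2 t y)"
    and deriv_v: "\<And>t y. t \<in> {0<..<\<tau>} \<Longrightarrow> y > 0 \<Longrightarrow> (v1 t has_real_derivative d1 t y) (at y)"
      "\<And>t y. t \<in> {0<..<\<tau>} \<Longrightarrow> y > 0 \<Longrightarrow> (v2 t has_real_derivative d2 t y) (at y)"
    and bounded_v: "\<And>t y. t \<in> {0..<\<tau>} \<Longrightarrow> y \<ge> 0 \<Longrightarrow> \<bar>v1 t y\<bar> \<le> M"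
      "\<And>t y. t \<in> {0..<\<tau>} \<Longrightarrow> y \<ge> 0 \<Longrightarrow> \<bar>v2 t y\<bar> \<le> M"
    and boundary: "\<And>t. t \<in> {0..<\<tau>} \<Longrightarrow> v1 t 0 = TM" "\<And>t. t \<in> {0..<\<tau>} \<Longrightarrow> v2 t 0 = TM"
    and initial: "\<And>y. y \<ge> 0 \<Longrightarrow> v1 0 y = f1 y" "\<And>y. y \<ge> 0 \<Longrightarrow> v2 0 y = f2 y"
    and weak1: "weak_heat (half_cylinder \<tau>) \<kappa> v1 (\<lambda>t y. - (interface_speed K L d1 d2 t * d1 t y))"
    and weak2: "weak_heat (half_cylinder \<tau>) 1 v2 (\<lambda>t y. interface_speed K L d1 d2 t * d2 t y - I_op \<alpha> v2 t y)"
begin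

abbreviation speed where "speed \<equiv> interface_speed K L d1 d2"

lemma cylinder_subset: "half_cylinder \<tau> \<subseteq> {0..\<tau>} \<times> {0..}" by auto

lemma open_cylinder: "open (half_cylinder \<tau>)" by (intro open_Times) auto

lemma cont_speed: "continuous_on {0..\<tau>} speed"
  by (rule continuous_on_interface_speed[OF pos(3) cont_d])

lemma cont_speed_cylinder: "continuous_on (half_cylinder \<tau>) (\<lambda>p. speed (fst p))"
  by (rule continuous_on_compose2[OF cont_speed]) (auto intro!: continuous_intros)

lemmas cont_v_slice = continuous_on_slices(1)[OF cont_v(1)] continuous_on_slices(1)[OF cont_v(2)]

lemma cont_source:
  "continuous_on (half_cylinder \<tau>) (\<lambda>(t, y). - (speed t * d1 t y))"
  "continuous_on (half_cylinder \<tau>) (\<lambda>(t, y). speed t * d2 t y - I_op \<alpha> v2 t y)"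
proof -
  have 1: "continuous_on (half_cylinder \<tau>) (\<lambda>p. d1 (fst p) (snd p))" "continuous_on (half_cylinder \<tau>) (\<lambda>p. d2 (fst p) (snd p))"
    using cont_d[THEN continuous_on_subset, OF cylinder_subset] by (simp_all add: case_prod_beta)
  have "continuous_on ({0<..<\<tau>} \<times> {0..}) (\<lambda>(t, y). I_op \<alpha> v2 t y)"
    by (rule continuous_on_I_op[OF pos(4) continuous_on_subset[OF cont_v(2)], where M=M]) (use bounded_v in auto)
  then have 2: "continuous_on (half_cylinder \<tau>) (\<lambda>p. I_op \<alpha> v2 (fst p) (snd p))"
    unfolding case_prod_beta by (rule continuous_on_subset) auto
  show "continuous_on (half_cylinder \<tau>) (\<lambda>(t, y). - (speed t * d1 t y))"
    "continuous_on (half_cylinder \<tau>) (\<lambda>(t, y). speed t * d2 t y - I_op \<alpha> v2 t y)"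
    unfolding case_prod_beta by (intro continuous_intros cont_speed_cylinder 1 2)+
qed

end

text \<open>
Only the first solution has a bounded gradient. In the equation for the difference that gradient is the
coefficient of the difference of the two speeds, while the gradient of the second solution is absorbed in the drift.
\<close>

locale two_half_line_solutions =
  A: half_line_stefan \<kappa> K L \<alpha> TM \<tau> M f1 f2 v1 d1 v2 d2 +
  B: half_line_stefan \<kappa> K L \<alpha> TM \<tau> M f1 f2 v1' d1' v2' d2'
  for \<kappa> K L \<alpha> TM \<tau> M f1 f2 v1 d1 v2 d2 v1' d1' v2' d2' +
  fixes P :: real
  assumes d_bounded: "\<And>t y. t \<in> {0<..<\<tau>} \<Longrightarrow> y > 0 \<Longrightarrow> \<bar>d1 t y\<bar> \<le> P"
    "\<And>t y. t \<in> {0<..<\<tau>} \<Longrightarrow> y > 0 \<Longrightarrow> \<bar>d2 t y\<bar> \<le> P"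
begin

abbreviation "w1 \<equiv> \<lambda>t y. v1' t y - v1 t y"
abbreviation "w2 \<equiv> \<lambda>t y. v2' t y - v2 t y"
abbreviation "e1 \<equiv> \<lambda>t y. d1' t y - d1 t y"
abbreviation "e2 \<equiv> \<lambda>t y. d2' t y - d2 t y"
abbreviation "G1 \<equiv> \<lambda>t y. - (B.speed t * d1' t y) - (- (A.speed t * d1 t y))"
abbreviation "G2 \<equiv> \<lambda>t y. (B.speed t * d2' t y - I_op \<alpha> v2' t y) - (A.speed t * d2 t y - I_op \<alpha> v2 t y)"

text \<open>
The factor by which \<open>H\<close> reproduces itself over a time step of length \<open>l\<^sup>2\<close>: the boundary gradients contribute the
part that is linear in \<open>l\<close>, the radiation term the quadratic one.
\<close>

abbreviation "contraction l \<equiv> 1 / L * ((1 + 1 / 1) * l + K * ((1 + 1 / \<kappa>) * l)) * P + 8 * M ^ 3 * l\<^sup>2"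

lemma difference_equation:
  "weak_drift_equation (half_cylinder \<tau>) \<kappa> w1 e1
     G1" (is ?A)
  "weak_drift_equation (half_cylinder \<tau>) 1 w2 e2
     G2" (is ?B)
proof -
  note o = A.open_cylinder
  note cv = A.cont_v[THEN continuous_on_subset, OF A.cylinder_subset] B.cont_v[THEN continuous_on_subset, OF A.cylinder_subset]
  note cd = A.cont_d[THEN continuous_on_subset, OF A.cylinder_subset] B.cont_d[THEN continuous_on_subset, OF A.cylinder_subset]
  note cs = A.cont_source B.cont_source
  have sub: "continuous_on S (\<lambda>(t, y). f t y) \<Longrightarrow> continuous_on S (\<lambda>(t, y). g t y) \<Longrightarrow> continuous_on S (\<lambda>(t, y). f t y - g t y)"
    for S :: "(real \<times> real) set" and f g :: "real \<Rightarrow> real \<Rightarrow> real"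
    unfolding case_prod_beta by (rule continuous_on_diff)
  show ?A
  proof
    show "weak_heat (half_cylinder \<tau>) \<kappa> w1 G1"
      by (rule weak_heat_diff[OF o B.weak1 A.weak1 cv(3) cv(1) cs(3) cs(1)])
    show "((\<lambda>y. v1' t y - v1 t y) has_real_derivative d1' t y - d1 t y) (at y)" if "(t, y) \<in> half_cylinder \<tau>" for t y
      by (intro DERIV_diff A.deriv_v B.deriv_v) (use that in auto)
  qed (use A.pos o sub[OF cv(3,1)] sub[OF cd(3,1)] sub[OF cs(3,1)] in simp_all)
  show ?B
  proof
    show "weak_heat (half_cylinder \<tau>) 1 w2 G2"
      by (rule weak_heat_diff[OF o B.weak2 A.weak2 cv(4) cv(2) cs(4) cs(2)])
    show "((\<lambda>y. v2' t y - v2 t y) has_real_derivative d2' t y - d2 t y) (at y)" if "(t, y) \<in> half_cylinder \<tau>" for t y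
      by (intro DERIV_diff A.deriv_v B.deriv_v) (use that in auto)
  qed (use A.pos o sub[OF cv(4,2)] sub[OF cd(4,2)] sub[OF cs(4,2)] in simp_all)
qed

text \<open>
With \<open>S\<close> and \<open>W\<close> the suprema of the differences of the speeds and of the second phases on the time step, both sources
are bounded by \<open>H = S * P + 8 * M ^ 3 * W\<close>. The two bounds for drift equations estimate \<open>W\<close> and \<open>S\<close> in terms of \<open>H\<close>, and the
smallness of \<open>l\<close> yields \<open>H \<le> H / 2\<close>.
\<close>

lemma step:
  assumes \<Sigma>: "\<And>t. t \<in> {0..\<tau>} \<Longrightarrow> \<bar>B.speed t\<bar> \<le> \<Sigma>"
    and l: "l > 0" "\<Sigma> * l * (1 + 3 / \<kappa>) \<le> 1" "\<Sigma> * l * (1 + 3 / 1) \<le> 1"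
      "contraction l \<le> 1 / 2"
    and a: "0 \<le> a" "a < \<tau>" and init: "\<And>y. y \<ge> 0 \<Longrightarrow> v1' a y = v1 a y" "\<And>y. y \<ge> 0 \<Longrightarrow> v2' a y = v2 a y"
    and t: "a < t" "t < a + l\<^sup>2" "t < \<tau>"
  shows "y \<ge> 0 \<Longrightarrow> v1' t y = v1 t y" "y \<ge> 0 \<Longrightarrow> v2' t y = v2 t y" "B.speed t = A.speed t"
proof -
  define b where "b = min (a + l\<^sup>2) \<tau>"
  have b: "a < b" "b \<le> \<tau>" "b \<le> a + l\<^sup>2" "t < b" using a t l by (auto simp: b_def)
  have M0: "M \<ge> 0" using A.bounded_v(1)[of 0 0] A.pos by (auto intro: order_trans[OF abs_ge_zero])
  have P0: "P \<ge> 0" using d_bounded(1)[of "\<tau> / 2" 1] A.pos by (auto intro: order_trans[OF abs_ge_zero])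
  define S where "S = (SUP t\<in>{a<..<b}. \<bar>B.speed t - A.speed t\<bar>)"
  define W where "W = (SUP p\<in>{a<..<b} \<times> {0..}. \<bar>v2' (fst p) (snd p) - v2 (fst p) (snd p)\<bar>)"
  have "bounded (A.speed ` {0..\<tau>})" by (intro compact_imp_bounded compact_continuous_image A.cont_speed compact_Icc)
  then obtain \<Sigma>' where \<Sigma>': "\<And>t. t \<in> {0..\<tau>} \<Longrightarrow> \<bar>A.speed t\<bar> \<le> \<Sigma>'" unfolding bounded_iff by (metis imageI real_norm_def)
  have "bdd_above ((\<lambda>t. \<bar>B.speed t - A.speed t\<bar>) ` {a<..<b})"
  proof (rule bdd_aboveI2)
    fix t assume "t \<in> {a<..<b}"
    then show "\<bar>B.speed t - A.speed t\<bar> \<le> \<Sigma> + \<Sigma>'" using \<Sigma>[of t] \<Sigma>'[of t] a b by auto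
  qed
  then have S: "\<bar>B.speed t - A.speed t\<bar> \<le> S" if "t \<in> {a<..<b}" for t
    unfolding S_def by (rule cSUP_upper[OF that])
  have "bdd_above ((\<lambda>p. \<bar>v2' (fst p) (snd p) - v2 (fst p) (snd p)\<bar>) ` ({a<..<b} \<times> {0..}))"
  proof (rule bdd_aboveI2)
    fix p assume "p \<in> {a<..<b} \<times> {0 :: real..}"
    then show "\<bar>v2' (fst p) (snd p) - v2 (fst p) (snd p)\<bar> \<le> M + M"
      using A.bounded_v(2)[of "fst p" "snd p"] B.bounded_v(2)[of "fst p" "snd p"] a b by auto
  qed
  from cSUP_upper[OF _ this] have W: "\<bar>v2' t y - v2 t y\<bar> \<le> W" if "t \<in> {a<..<b}" "y \<ge> 0" for t y
    using that unfolding W_def by force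
  have mid: "(a + b) / 2 \<in> {a<..<b}" using b by auto
  have SW0: "S \<ge> 0" "W \<ge> 0" using S[OF mid] W[OF mid, of 0] by (auto intro: order_trans[OF abs_ge_zero])
  define H where "H = S * P + 8 * M ^ 3 * W"
  have H0: "H \<ge> 0" using SW0 M0 P0 by (simp add: H_def)
  have in_cyl: "t \<in> {0<..<\<tau>}" if "t \<in> {a<..<b}" for t using that a b by auto
  have cw: "continuous_on ({a..<b} \<times> {0..}) (\<lambda>(t, y). u' t y - u t y)"
    if "continuous_on ({0..\<tau>} \<times> {0..}) (\<lambda>(t, y). u t y)" "continuous_on ({0..\<tau>} \<times> {0..}) (\<lambda>(t, y). u' t y)" for u u' :: "real \<Rightarrow> real \<Rightarrow> real"
    unfolding case_prod_beta
    by (rule continuous_on_diff[OF that(2,1)[unfolded case_prod_beta, THEN continuous_on_subset]]) (use a b in auto)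
  have cB: "continuous_on {a<..<b} B.speed" by (rule continuous_on_subset[OF B.cont_speed]) (use a b in auto)
  interpret E1: half_line_drift_equation "half_cylinder \<tau>" \<kappa> w1 e1
     G1 "\<lambda>t. - B.speed t" a b \<Sigma> H "2 * M"
  proof -
    interpret weak_drift_equation "half_cylinder \<tau>" \<kappa> w1 e1
     G1 "\<lambda>t. - B.speed t" by (rule difference_equation)
    show "half_line_drift_equation (half_cylinder \<tau>) \<kappa> w1 e1
     G1 (\<lambda>t. - B.speed t) a b \<Sigma> H (2 * M)"
    proof
      show "\<bar>G1 t y - - B.speed t * e1 t y\<bar> \<le> H"
        if "t \<in> {a<..<b}" "y > 0" for t y
      proof -
        have "G1 t y - - B.speed t * e1 t y = - ((B.speed t - A.speed t) * d1 t y)"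
          by (simp add: algebra_simps)
        then have "\<bar>G1 t y - - B.speed t * e1 t y\<bar> = \<bar>B.speed t - A.speed t\<bar> * \<bar>d1 t y\<bar>"
          by (simp add: abs_mult)
        also have "\<dots> \<le> S * P" using S[OF that(1)] d_bounded(1)[OF in_cyl[OF that(1)] that(2)] SW0 by (intro mult_mono) auto
        also have "\<dots> \<le> H" using SW0 M0 by (simp add: H_def)
        finally show ?thesis .
      qed
      show "\<bar>v1' t y - v1 t y\<bar> \<le> 2 * M" if "t \<in> {a..<b}" "0 \<le> y" for t y
        using A.bounded_v(1)[of t y] B.bounded_v(1)[of t y] that a b by auto
      show "v1' t 0 - v1 t 0 = 0" if "t \<in> {a..<b}" for t
        using A.boundary(1)[of t] B.boundary(1)[of t] that a b by auto
      show "\<bar>- B.speed t\<bar> \<le> \<Sigma>" if "t \<in> {a<..<b}" for t using \<Sigma>[of t] that a b by auto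
    qed (use a b init cw[OF A.cont_v(1) B.cont_v(1)] cB in \<open>auto intro!: continuous_intros\<close>)
  qed
  interpret E2: half_line_drift_equation "half_cylinder \<tau>" 1 w2 e2
     G2 "B.speed" a b \<Sigma> H "2 * M"
  proof -
    interpret weak_drift_equation "half_cylinder \<tau>" 1 w2 e2
     G2 "B.speed" by (rule difference_equation)
    show "half_line_drift_equation (half_cylinder \<tau>) 1 w2 e2
     G2 B.speed a b \<Sigma> H (2 * M)"
    proof
      show "\<bar>G2 t y - B.speed t * e2 t y\<bar> \<le> H"
        if "t \<in> {a<..<b}" "y > 0" for t y
      proof -
        have "G2 t y - B.speed t * e2 t y
          = (B.speed t - A.speed t) * d2 t y - (I_op \<alpha> v2' t y - I_op \<alpha> v2 t y)" by (simp add: algebra_simps)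
        moreover have "\<bar>(B.speed t - A.speed t) * d2 t y\<bar> \<le> S * P"
          unfolding abs_mult using S[OF that(1)] d_bounded(2)[OF in_cyl[OF that(1)] that(2)] SW0 by (intro mult_mono) auto
        moreover have "\<bar>I_op \<alpha> v2' t y - I_op \<alpha> v2 t y\<bar> \<le> 8 * M ^ 3 * W"
          by (rule I_op_lipschitz[OF A.pos(4)])
            (use in_cyl[OF that(1)] that W A.bounded_v B.bounded_v A.cont_v_slice B.cont_v_slice in auto)
        ultimately show ?thesis unfolding H_def by linarith
      qed
      show "\<bar>v2' t y - v2 t y\<bar> \<le> 2 * M" if "t \<in> {a..<b}" "0 \<le> y" for t y
        using A.bounded_v(2)[of t y] B.bounded_v(2)[of t y] that a b by auto
      show "v2' t 0 - v2 t 0 = 0" if "t \<in> {a..<b}" for t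
        using A.boundary(2)[of t] B.boundary(2)[of t] that a b by auto
      show "\<bar>B.speed t\<bar> \<le> \<Sigma>" if "t \<in> {a<..<b}" for t using \<Sigma>[of t] that a b by auto
    qed (use a b init cw[OF A.cont_v(2) B.cont_v(2)] cB in auto)
  qed
  have bnd0: "v1' t 0 - v1 t 0 = 0" "v2' t 0 - v2 t 0 = 0" if "t \<in> {a<..<b}" for t
    using A.boundary[of t] B.boundary[of t] that a b by auto
  have HW: "H * (t - a) \<le> H * l\<^sup>2" if "t \<in> {a<..<b}" for t using that b H0 by (intro mult_left_mono) auto
  have WH: "W \<le> H * l\<^sup>2"
    unfolding W_def
  proof (rule cSUP_least)
    fix p assume p: "p \<in> {a<..<b} \<times> {0 :: real..}"
    then show "\<bar>v2' (fst p) (snd p) - v2 (fst p) (snd p)\<bar> \<le> H * l\<^sup>2"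
      using E2.bound[of "fst p" "snd p"] HW[of "fst p"] bnd0(2)[of "fst p"] H0
      by (cases "snd p = 0") (auto intro: order_trans)
  qed (use mid in auto)
  have lim: "((\<lambda>y. d' t y - d t y) \<longlongrightarrow> d' t 0 - d t 0) (at_right 0)"
    if "continuous_on ({0..\<tau>} \<times> {0..}) (\<lambda>(t, y). d t y)" "continuous_on ({0..\<tau>} \<times> {0..}) (\<lambda>(t, y). d' t y)" "t \<in> {a<..<b}"
    for d d' :: "real \<Rightarrow> real \<Rightarrow> real" and t
    by (intro tendsto_diff tendsto_at_boundary(1)[OF _ that(1)] tendsto_at_boundary(1)[OF _ that(2)]) (use that(3) a b in auto)
  (* the boundary gradient bounds for the diffusivities 1 and \<kappa>, combined as in the Stefan condition *)
  define c where "c = 1 / L * ((1 + 1 / 1) * l + K * ((1 + 1 / \<kappa>) * l))"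
  have SH: "S \<le> c * H"
    unfolding S_def
  proof (rule cSUP_least)
    fix t assume t: "t \<in> {a<..<b}"
    have g1: "\<bar>d1' t 0 - d1 t 0\<bar> \<le> H * ((1 + 1 / \<kappa>) * l)"
      by (rule E1.boundary_gradient_bound[OF A.pos(1) l(1) b(3) l(2) t lim[OF A.cont_d(1) B.cont_d(1) t]])
    have g2: "\<bar>d2' t 0 - d2 t 0\<bar> \<le> H * ((1 + 1 / 1) * l)"
      by (rule E2.boundary_gradient_bound[OF _ l(1) b(3) l(3) t lim[OF A.cont_d(2) B.cont_d(2) t]]) simp
    have "B.speed t - A.speed t = 1 / L * ((d2' t 0 - d2 t 0) + K * (d1' t 0 - d1 t 0))"
      by (simp add: interface_speed_def diff_divide_distrib algebra_simps add_divide_distrib)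
    then have "\<bar>B.speed t - A.speed t\<bar> = 1 / L * \<bar>(d2' t 0 - d2 t 0) + K * (d1' t 0 - d1 t 0)\<bar>"
      using A.pos(3) by (simp add: abs_mult)
    also have "\<dots> \<le> 1 / L * (H * ((1 + 1 / 1) * l) + K * (H * ((1 + 1 / \<kappa>) * l)))"
    proof (rule mult_left_mono)
      have "\<bar>K * (d1' t 0 - d1 t 0)\<bar> \<le> K * (H * ((1 + 1 / \<kappa>) * l))"
        using mult_left_mono[OF g1, of K] A.pos(2) by (simp add: abs_mult)
      with g2 show "\<bar>(d2' t 0 - d2 t 0) + K * (d1' t 0 - d1 t 0)\<bar> \<le> H * ((1 + 1 / 1) * l) + K * (H * ((1 + 1 / \<kappa>) * l))"
        by linarith
    qed (use A.pos in auto)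
    also have "\<dots> = c * H" by (simp add: c_def algebra_simps)
    finally show "\<bar>B.speed t - A.speed t\<bar> \<le> c * H" .
  qed (use mid in auto)
  have "H \<le> (c * P + 8 * M ^ 3 * l\<^sup>2) * H"
  proof -
    have "S * P \<le> c * H * P" using SH P0 by (rule mult_right_mono)
    moreover have "8 * M ^ 3 * W \<le> 8 * M ^ 3 * (H * l\<^sup>2)" using WH M0 by (intro mult_left_mono) auto
    ultimately show ?thesis unfolding H_def[symmetric] by (simp add: H_def[symmetric] algebra_simps) (simp add: H_def algebra_simps)
  qed
  also have "\<dots> \<le> 1 / 2 * H" using l(4) H0 unfolding c_def by (rule mult_right_mono)
  finally have H: "H = 0" using H0 by simp
  have tb: "t \<in> {a<..<b}" using t b by auto
  show "v1' t y = v1 t y" if "y \<ge> 0"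
    using E1.bound[OF tb, of y] bnd0(1)[OF tb] H that by (cases "y = 0") auto
  show "v2' t y = v2 t y" if "y \<ge> 0"
    using E2.bound[OF tb, of y] bnd0(2)[OF tb] H that by (cases "y = 0") auto
  show "B.speed t = A.speed t" using S[OF tb] SH H by auto
qed

lemma step_size_exists:
  obtains \<Sigma> l where "\<And>t. t \<in> {0..\<tau>} \<Longrightarrow> \<bar>B.speed t\<bar> \<le> \<Sigma>" "l > 0" "\<Sigma> * l * (1 + 3 / \<kappa>) \<le> 1" "\<Sigma> * l * (1 + 3 / 1) \<le> 1"
      "contraction l \<le> 1 / 2"
proof -
  have "bounded (B.speed ` {0..\<tau>})" by (intro compact_imp_bounded compact_continuous_image B.cont_speed compact_Icc)
  then obtain \<Sigma> where \<Sigma>: "\<And>t. t \<in> {0..\<tau>} \<Longrightarrow> \<bar>B.speed t\<bar> \<le> \<Sigma>" unfolding bounded_iff by (metis imageI real_norm_def)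
  have ev: "eventually (\<lambda>l. f l < c) (at_right 0)" if "continuous (at 0) f" "f 0 < c" for f :: "real \<Rightarrow> real" and c
  proof -
    have "(f \<longlongrightarrow> f 0) (at_right 0)"
      using that(1) by (auto simp: continuous_at intro: tendsto_within_subset)
    then show ?thesis using that(2) by (rule order_tendstoD(2))
  qed
  have "eventually (\<lambda>l. \<Sigma> * l * (1 + 3 / \<kappa>) < 1) (at_right 0)" "eventually (\<lambda>l. \<Sigma> * l * (1 + 3 / 1) < 1) (at_right 0)"
    "eventually (\<lambda>l. contraction l < 1 / 2) (at_right 0)"
    by (rule ev, intro continuous_intros, simp)+
  moreover have "eventually (\<lambda>l::real. l > 0) (at_right 0)" by (auto simp: eventually_at_filter)
  ultimately have "eventually (\<lambda>l. l > 0 \<and> \<Sigma> * l * (1 + 3 / \<kappa>) < 1 \<and> \<Sigma> * l * (1 + 3 / 1) < 1 \<and>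
      contraction l < 1 / 2) (at_right 0)"
    by eventually_elim auto
  then obtain l where "l > 0 \<and> \<Sigma> * l * (1 + 3 / \<kappa>) < 1 \<and> \<Sigma> * l * (1 + 3 / 1) < 1 \<and>
      contraction l < 1 / 2"
    using eventually_happens'[OF trivial_limit_at_right_real] by blast
  with \<Sigma> show ?thesis by (intro that[of \<Sigma> l]) auto
qed

text \<open>
The admissible step depends only on bounds that hold on the whole time interval, so finitely many steps suffice. Each
step starts at \<open>t - l\<^sup>2 / 2\<close>, inside the interval already covered, or at time 0.
\<close>

lemma unique:
  assumes t: "t \<in> {0<..<\<tau>}"
  shows "y \<ge> 0 \<Longrightarrow> v1' t y = v1 t y" "y \<ge> 0 \<Longrightarrow> v2' t y = v2 t y" "B.speed t = A.speed t"
proof -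
  obtain \<Sigma> l where l: "\<And>t. t \<in> {0..\<tau>} \<Longrightarrow> \<bar>B.speed t\<bar> \<le> \<Sigma>" "l > 0" "\<Sigma> * l * (1 + 3 / \<kappa>) \<le> 1" "\<Sigma> * l * (1 + 3 / 1) \<le> 1"
      "contraction l \<le> 1 / 2"
    using step_size_exists by metis
  have "(\<forall>y\<ge>0. v1' t y = v1 t y \<and> v2' t y = v2 t y) \<and> B.speed t = A.speed t"
    if "0 < t" "t < \<tau>" "t < real (Suc n) * (l\<^sup>2 / 2)" for n t
    using that
  proof (induction n arbitrary: t)
    case (Suc n)
    have l2: "l\<^sup>2 > 0" using l(2) by simp
    define a where "a = max 0 (t - l\<^sup>2 / 2)"
    have a: "0 \<le> a" "a < \<tau>" "a < t" "t < a + l\<^sup>2" "a < real (Suc n) * (l\<^sup>2 / 2)"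
    proof -
      have "real (Suc (Suc n)) * (l\<^sup>2 / 2) = real (Suc n) * (l\<^sup>2 / 2) + l\<^sup>2 / 2" by (simp add: algebra_simps)
      moreover have "real (Suc n) * (l\<^sup>2 / 2) > 0" using l2 by (intro mult_pos_pos) auto
      ultimately show "0 \<le> a" "a < \<tau>" "a < t" "t < a + l\<^sup>2" "a < real (Suc n) * (l\<^sup>2 / 2)"
        using Suc.prems l2 unfolding a_def by linarith+
    qed
    have init: "v1' a y = v1 a y" "v2' a y = v2 a y" if "y \<ge> 0" for y
      using Suc.IH[of a] a that A.initial[of y] B.initial[of y] by (cases "a = 0"; force)+
    show ?case using step[OF l a(1,2) init a(3,4) Suc.prems(2)] by blast
  next
    case 0
    have l2: "l\<^sup>2 > 0" using l(2) by simp
    have init: "v1' 0 y = v1 0 y" "v2' 0 y = v2 0 y" if "y \<ge> 0" for y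
      using that A.initial[of y] B.initial[of y] by auto
    have "t < 0 + l\<^sup>2" using 0 l2 by simp
    from step[OF l order_refl A.pos(5) init 0(1) this 0(2)] show ?case by blast
  qed
  moreover obtain n where "t / (l\<^sup>2 / 2) < real n" using reals_Archimedean2 by blast
  then have "t < real (Suc n) * (l\<^sup>2 / 2)"
  proof -
    have p: "l\<^sup>2 / 2 > 0" using l(2) by simp
    have "t < real n * (l\<^sup>2 / 2)" using \<open>t / (l\<^sup>2 / 2) < real n\<close> p by (simp only: pos_divide_less_eq)
    also have "\<dots> \<le> real (Suc n) * (l\<^sup>2 / 2)" using p by (intro mult_right_mono) auto
    finally show ?thesis .
  qed
  ultimately have *: "(\<forall>y\<ge>0. v1' t y = v1 t y \<and> v2' t y = v2 t y) \<and> B.speed t = A.speed t" using t by auto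
  show "y \<ge> 0 \<Longrightarrow> v1' t y = v1 t y" "y \<ge> 0 \<Longrightarrow> v2' t y = v2 t y" "B.speed t = A.speed t"
    using * by auto
qed

end

section \<open>The heat potential\<close>

definition gauss :: "real \<Rightarrow> real" where "gauss = std_normal_density"

lemma gauss_altdef: "gauss z = (1 / sqrt (2 * pi)) * exp (- z\<^sup>2 / 2)"
  by (simp add: gauss_def std_normal_density_def)

lemma gauss_nonneg: "gauss z \<ge> 0" by (simp add: gauss_def)
lemma gauss_even: "gauss (- z) = gauss z" by (simp add: gauss_altdef)
lemma gauss_measurable [measurable]: "gauss \<in> borel_measurable borel" by (simp add: gauss_def)
lemma integrable_gauss: "integrable lborel gauss" by (simp add: gauss_def)
lemma integral_gauss: "integral\<^sup>L lborel gauss = 1" by (simp add: gauss_def)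

lemma integrable_abs_gauss: "integrable lborel (\<lambda>z. \<bar>z\<bar> * gauss z)"
  using integrable_std_normal_moment_abs[of 1] by (simp add: gauss_def mult.commute)

lemma integrable_id_gauss: "integrable lborel (\<lambda>z. z * gauss z)"
  using integrable_std_normal_moment[of 1] by (simp add: gauss_def mult.commute)

lemma integral_abs_gauss_le: "(\<integral>z. \<bar>z\<bar> * gauss z \<partial>lborel) \<le> 1"
proof -
  have "(\<integral>z. \<bar>z\<bar> * gauss z \<partial>lborel) = sqrt (2 / pi)"
    using integral_std_normal_moment_abs_odd[of 0] by (simp add: gauss_def mult.commute)
  also have "\<dots> \<le> 1" using pi_ge_two by simp
  finally show ?thesis .
qed

lemma DERIV_gauss: "(gauss has_real_derivative - z * gauss z) (at z)"
  unfolding gauss_altdef[abs_def] by (auto intro!: derivative_eq_intros simp: field_simps)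

lemma continuous_gauss: "continuous_on S gauss"
  using DERIV_gauss by (meson DERIV_isCont continuous_at_imp_continuous_on)

text \<open>
A majorant for the derivative of the Gaussian that is uniform under shifts: half of the exponent absorbs the factor \<open>\<bar>v\<bar>\<close>, and
half of the remainder pays for the shift.
\<close>

lemma abs_mult_gauss_le:
  assumes "\<bar>v - w\<bar> \<le> d"
  shows "\<bar>v\<bar> * gauss v \<le> exp (d\<^sup>2 / 4) * gauss (w / 2)"
proof -
  (* (\<bar>v\<bar>/2 - 1)\<^sup>2 \<ge> 0 *)
  have "\<bar>v\<bar> \<le> 1 + v\<^sup>2 / 4"
    using zero_le_power2[of "\<bar>v\<bar> / 2 - 1"] by (simp add: power2_eq_square field_simps)
  also have "\<dots> \<le> exp (v\<^sup>2 / 4)" by (rule exp_ge_add_one_self)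
  finally have "\<bar>v\<bar> * exp (- v\<^sup>2 / 2) \<le> exp (v\<^sup>2 / 4) * exp (- v\<^sup>2 / 2)" by (intro mult_right_mono) auto
  also have "\<dots> = exp (- v\<^sup>2 / 4)" by (simp add: exp_add[symmetric])
  also have "\<dots> \<le> exp (d\<^sup>2 / 4 + - (w / 2)\<^sup>2 / 2)"
  proof -
    have "w\<^sup>2 \<le> 2 * v\<^sup>2 + 2 * (v - w)\<^sup>2"
      using zero_le_power2[of "2 * v - w"] by (simp add: power2_eq_square algebra_simps)
    moreover have "(v - w)\<^sup>2 \<le> d\<^sup>2" using assms by (metis abs_ge_zero power2_abs power_mono)
    ultimately show ?thesis by (simp add: field_simps power2_eq_square)
  qed
  finally have "\<bar>v\<bar> * exp (- v\<^sup>2 / 2) \<le> exp (d\<^sup>2 / 4) * exp (- (w / 2)\<^sup>2 / 2)" by (simp only: exp_add)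
  then have "(1 / sqrt (2 * pi)) * (\<bar>v\<bar> * exp (- v\<^sup>2 / 2)) \<le> (1 / sqrt (2 * pi)) * (exp (d\<^sup>2 / 4) * exp (- (w / 2)\<^sup>2 / 2))"
    by (intro mult_left_mono) auto
  then show ?thesis unfolding gauss_altdef by (simp add: mult_ac)
qed

text \<open>
As \<open>f\<close> is merely measurable, the derivative has to fall on the Gaussian, after the substitution \<open>x = y + a * z\<close>.
\<close>

lemma DERIV_gauss_convolution:
  fixes f :: "real \<Rightarrow> real"
  assumes f [measurable]: "f \<in> borel_measurable borel" and B: "\<And>x. \<bar>f x\<bar> \<le> B" and a: "a > 0"
  shows "((\<lambda>y. \<integral>z. gauss z * f (y + a * z) \<partial>lborel) has_real_derivative
     (\<integral>z. z * gauss z / a * f (y0 + a * z) \<partial>lborel)) (at y0)"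
proof -
  have B0: "B \<ge> 0" using B[of 0] by auto
  have conv: "(\<integral>z. k z * f (y + a * z) \<partial>lborel) = (\<integral>x. k ((x - y) / a) * f x / a \<partial>lborel)" for k y
    using lborel_integral_real_affine[of a "\<lambda>x. k ((x - y) / a) * f x / a" y] a by simp
  have int: "integrable lborel (\<lambda>x. gauss ((x - y) / b) * c)" if "b \<noteq> 0" for y b c
  proof -
    have "integrable lborel (\<lambda>x. gauss (- y / b + (1 / b) * x))"
      using lborel_integrable_real_affine[OF integrable_gauss, of "1 / b" "- y / b"] that by simp
    then show ?thesis using that by (intro integrable_mult_left) (simp add: field_simps)
  qed
  have "((\<lambda>y. \<integral>x. gauss ((x - y) / a) * f x / a \<partial>lborel) has_real_derivative
     (\<integral>x. (((x - y0) / a) * gauss ((x - y0) / a) / a) * f x / a \<partial>lborel)) (at y0)"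
  proof (rule has_real_derivative_integral_dominated[where a="y0 - 1" and b="y0 + 1" and
       m="\<lambda>x. gauss ((x - y0) / (2 * a)) * (exp ((1 / a)\<^sup>2 / 4) / a * B / a)" and
       f'="\<lambda>y x. (((x - y) / a) * gauss ((x - y) / a) / a) * f x / a"])
    fix y x :: real
    have "((\<lambda>y. gauss ((x - y) / a)) has_real_derivative (- ((x - y) / a) * gauss ((x - y) / a)) * (- 1 / a)) (at y)"
      by (rule DERIV_chain2[of gauss, OF DERIV_gauss]) (use a in \<open>auto intro!: derivative_eq_intros\<close>)
    then show "((\<lambda>y. gauss ((x - y) / a) * f x / a) has_real_derivative (((x - y) / a) * gauss ((x - y) / a) / a) * f x / a) (at y)"
      using a by (auto intro!: derivative_eq_intros)
    assume y: "y0 - 1 < y" "y < y0 + 1"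
    have "\<bar>(x - y) / a - (x - y0) / a\<bar> \<le> 1 / a"
    proof -
      have "(x - y) / a - (x - y0) / a = (y0 - y) / a" by (simp add: diff_divide_distrib)
      then show ?thesis using y a by (auto simp: divide_right_mono)
    qed
    from abs_mult_gauss_le[OF this] have k: "\<bar>(x - y) / a\<bar> * gauss ((x - y) / a) \<le> exp ((1 / a)\<^sup>2 / 4) * gauss ((x - y0) / (2 * a))"
      by (simp add: mult.commute)
    have "\<bar>(((x - y) / a) * gauss ((x - y) / a) / a) * f x / a\<bar> = (\<bar>(x - y) / a\<bar> * gauss ((x - y) / a)) / a * \<bar>f x\<bar> / a"
      using a gauss_nonneg[of "(x - y) / a"] by (simp add: abs_mult)
    also have "\<dots> \<le> (exp ((1 / a)\<^sup>2 / 4) * gauss ((x - y0) / (2 * a))) / a * B / a"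
      by (rule divide_right_mono[OF mult_mono[OF divide_right_mono[OF k] B]]) (use a gauss_nonneg in auto)
    finally show "\<bar>(((x - y) / a) * gauss ((x - y) / a) / a) * f x / a\<bar> \<le> gauss ((x - y0) / (2 * a)) * (exp ((1 / a)\<^sup>2 / 4) / a * B / a)"
      by (simp add: mult_ac)
  next
    fix y :: real
    show "integrable lborel (\<lambda>x. gauss ((x - y) / a) * f x / a)"
    proof (rule Bochner_Integration.integrable_bound[OF int[of a y "B / a"]])
      show "AE x in lborel. norm (gauss ((x - y) / a) * f x / a) \<le> norm (gauss ((x - y) / a) * (B / a))"
        using B a B0 gauss_nonneg by (auto simp: abs_mult intro!: divide_right_mono mult_left_mono)
    qed (use a in auto)
  qed (use a int in \<open>auto simp: mult_ac\<close>)
  then show ?thesis unfolding conv[of gauss] conv[of "\<lambda>z. z * gauss z / a"] .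
qed

lemma integrable_product:
  fixes f :: "'a::euclidean_space \<Rightarrow> real" and g :: "'b::euclidean_space \<Rightarrow> real"
  assumes f: "integrable lborel f" and g: "integrable lborel g"
  shows "integrable lborel (\<lambda>p. f (fst p) * g (snd p))"
    and "(\<integral>p. f (fst p) * g (snd p) \<partial>lborel) = integral\<^sup>L lborel f * integral\<^sup>L lborel g"
proof -
  note [measurable] = borel_measurable_integrable[OF f] borel_measurable_integrable[OF g]
  have i: "integrable (lborel \<Otimes>\<^sub>M lborel) (\<lambda>p. f (fst p) * g (snd p))"
  proof (rule lborel_pair.Fubini_integrable)
    show "(\<lambda>p. f (fst p) * g (snd p)) \<in> borel_measurable (lborel \<Otimes>\<^sub>M lborel)" by measurable
  qed (use f g in \<open>auto simp: abs_mult\<close>)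
  then show "integrable lborel (\<lambda>p. f (fst p) * g (snd p))" by (simp add: lborel_prod)
  from lborel_pair.integral_fst'[OF i]
  show "(\<integral>p. f (fst p) * g (snd p) \<partial>lborel) = integral\<^sup>L lborel f * integral\<^sup>L lborel g" by (simp add: lborel_prod)
qed

lemma integrable_inverse_sqrt:
  assumes "\<tau> > 0"
  shows "integrable lborel (\<lambda>r. indicator {0<..<\<tau>} r * (1 / sqrt r) :: real)"
    and "(\<integral>r. indicator {0<..<\<tau>} r * (1 / sqrt r) \<partial>lborel) = 2 * sqrt \<tau>"
proof -
  have *: "set_integrable lborel (einterval (ereal 0) (ereal \<tau>)) (\<lambda>r. 1 / sqrt r)"
    "(LBINT r=ereal 0..ereal \<tau>. 1 / sqrt r) = 2 * sqrt \<tau> - 2 * sqrt 0"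
  proof -
    have D: "((\<lambda>r. 2 * sqrt r) has_real_derivative 1 / sqrt x) (at x)" if "0 < x" for x
      using that by (auto intro!: derivative_eq_intros simp: field_simps)
    have c: "isCont (\<lambda>r. 1 / sqrt r) x" if "0 < x" for x using that by (intro continuous_intros) auto
    have l: "(((\<lambda>r. 2 * sqrt r) \<circ> real_of_ereal) \<longlongrightarrow> 2 * sqrt 0) (at_right (ereal 0))"
      "(((\<lambda>r. 2 * sqrt r) \<circ> real_of_ereal) \<longlongrightarrow> 2 * sqrt \<tau>) (at_left (ereal \<tau>))"
      unfolding ereal_tendsto_simps by (intro tendsto_intros)+
    show "set_integrable lborel (einterval (ereal 0) (ereal \<tau>)) (\<lambda>r. 1 / sqrt r)"
      by (rule interval_integral_FTC_nonneg(1)[where F="\<lambda>r. 2 * sqrt r", OF _ _ _ _ l]) (use assms D c in auto)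
    show "(LBINT r=ereal 0..ereal \<tau>. 1 / sqrt r) = 2 * sqrt \<tau> - 2 * sqrt 0"
      by (rule interval_integral_FTC_nonneg(2)[where F="\<lambda>r. 2 * sqrt r", OF _ _ _ _ l]) (use assms D c in auto)
  qed
  show "integrable lborel (\<lambda>r. indicator {0<..<\<tau>} r * (1 / sqrt r) :: real)"
    using *(1) by (simp add: set_integrable_def)
  show "(\<integral>r. indicator {0<..<\<tau>} r * (1 / sqrt r) \<partial>lborel) = 2 * sqrt \<tau>"
    using *(2) assms by (simp add: interval_lebesgue_integral_le_eq set_lebesgue_integral_def)
qed

text \<open>
The integration variables of the heat potential are the time lag \<open>r\<close> and the normalised displacement \<open>z\<close>: the heat kernel at
lag \<open>r\<close> is the law of \<open>sqrt (2 * \<kappa> * r) * z\<close> for a standard Gaussian \<open>z\<close>. In these variables the kernels of the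
potential and of its gradient are fixed integrable functions, and only the argument of the source moves with the
point of evaluation, so dominated convergence applies. Lags above \<open>\<tau>\<close> are cut off; up to time \<open>\<tau>\<close> they
would meet the source only before time 0, where it vanishes.
\<close>

definition value_kernel :: "real \<Rightarrow> real \<times> real \<Rightarrow> real" where
  "value_kernel \<tau> p = indicator {0<..<\<tau>} (fst p) * gauss (snd p)"

definition gradient_kernel :: "real \<Rightarrow> real \<Rightarrow> real \<times> real \<Rightarrow> real" where
  "gradient_kernel \<kappa> \<tau> p = (indicator {0<..<\<tau>} (fst p) * (1 / sqrt (fst p))) * (snd p * gauss (snd p) / sqrt (2 * \<kappa>))"

definition heat_convolution :: "real \<Rightarrow> (real \<times> real \<Rightarrow> real) \<Rightarrow> (real \<Rightarrow> real \<Rightarrow> real) \<Rightarrow> real \<Rightarrow> real \<Rightarrow> real" where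
  "heat_convolution \<kappa> m F t y = (\<integral>q. m q * F (t - fst q) (y + sqrt (2 * \<kappa>) * sqrt (fst q) * snd q) \<partial>lborel)"

abbreviation heat_potential where
  "heat_potential \<kappa> \<tau> \<equiv> heat_convolution \<kappa> (value_kernel \<tau>)"

abbreviation heat_potential_dy where
  "heat_potential_dy \<kappa> \<tau> \<equiv> heat_convolution \<kappa> (gradient_kernel \<kappa> \<tau>)"

lemma integrable_value_kernel: "\<tau> > 0 \<Longrightarrow> integrable lborel (value_kernel \<tau>)"
  and integral_value_kernel: "\<tau> > 0 \<Longrightarrow> (\<integral>q. \<bar>value_kernel \<tau> q\<bar> \<partial>lborel) = \<tau>"
proof -
  assume \<tau>: "\<tau> > 0"
  have i: "integrable lborel (indicator {0<..<\<tau>} :: real \<Rightarrow> real)"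
    using \<tau> by (auto intro!: integrable_real_indicator)
  show "integrable lborel (value_kernel \<tau>)"
    unfolding value_kernel_def[abs_def] by (rule integrable_product(1)[OF i integrable_gauss])
  have "\<bar>value_kernel \<tau> q\<bar> = indicator {0<..<\<tau>} (fst q) * gauss (snd q)" for q
    using gauss_nonneg by (simp add: value_kernel_def abs_mult)
  then show "(\<integral>q. \<bar>value_kernel \<tau> q\<bar> \<partial>lborel) = \<tau>"
    using integrable_product(2)[OF i integrable_gauss] \<tau> by (simp add: integral_gauss)
qed

lemma integrable_gradient_kernel: "\<tau> > 0 \<Longrightarrow> \<kappa> > 0 \<Longrightarrow> integrable lborel (gradient_kernel \<kappa> \<tau>)"
  and integral_gradient_kernel: "\<tau> > 0 \<Longrightarrow> \<kappa> > 0 \<Longrightarrow> (\<integral>q. \<bar>gradient_kernel \<kappa> \<tau> q\<bar> \<partial>lborel) \<le> 2 * sqrt \<tau> / sqrt (2 * \<kappa>)"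
proof -
  assume \<tau>: "\<tau> > 0" and \<kappa>: "\<kappa> > 0"
  note i = integrable_inverse_sqrt[OF \<tau>]
  have g: "integrable lborel (\<lambda>z. z * gauss z / sqrt (2 * \<kappa>))" "integrable lborel (\<lambda>z. \<bar>z\<bar> * gauss z / sqrt (2 * \<kappa>))"
    using integrable_id_gauss integrable_abs_gauss by auto
  show "integrable lborel (gradient_kernel \<kappa> \<tau>)"
    unfolding gradient_kernel_def[abs_def] by (rule integrable_product(1)[OF i(1) g(1)])
  have "\<bar>gradient_kernel \<kappa> \<tau> q\<bar> = (indicator {0<..<\<tau>} (fst q) * (1 / sqrt (fst q))) * (\<bar>snd q\<bar> * gauss (snd q) / sqrt (2 * \<kappa>))" for q
    using gauss_nonneg[of "snd q"] \<kappa> by (auto simp: gradient_kernel_def abs_mult indicator_def)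
  then have "(\<integral>q. \<bar>gradient_kernel \<kappa> \<tau> q\<bar> \<partial>lborel) = 2 * sqrt \<tau> * ((\<integral>z. \<bar>z\<bar> * gauss z \<partial>lborel) / sqrt (2 * \<kappa>))"
    using integrable_product(2)[OF i(1) g(2)] i(2) by simp
  also have "\<dots> \<le> 2 * sqrt \<tau> * (1 / sqrt (2 * \<kappa>))"
    using integral_abs_gauss_le \<tau> \<kappa> by (intro mult_left_mono divide_right_mono) auto
  finally show "(\<integral>q. \<bar>gradient_kernel \<kappa> \<tau> q\<bar> \<partial>lborel) \<le> 2 * sqrt \<tau> / sqrt (2 * \<kappa>)" by simp
qed

text \<open>
Oddness encodes the Dirichlet condition at \<open>y = 0\<close>, and vanishing for \<open>t \<le> 0\<close> the initial condition. The axes are the only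
places where such an extension of a continuous source may jump.
\<close>

locale heat_source =
  fixes \<kappa> \<tau> B :: real and F :: "real \<Rightarrow> real \<Rightarrow> real"
  assumes \<kappa>: "\<kappa> > 0" and \<tau>: "\<tau> > 0"
    and F_measurable: "(\<lambda>(t, y). F t y) \<in> borel_measurable borel"
    and F_bounded: "\<And>t y. \<bar>F t y\<bar> \<le> B"
    and F_past: "\<And>t y. t \<le> 0 \<Longrightarrow> F t y = 0"
    and F_odd: "\<And>t y. F t (- y) = - F t y"
    and F_cont: "\<And>t y. t \<noteq> 0 \<Longrightarrow> y \<noteq> 0 \<Longrightarrow> isCont (\<lambda>(t, y). F t y) (t, y)"
begin

abbreviation c where "c \<equiv> sqrt (2 * \<kappa>)"
abbreviation "val \<equiv> heat_potential \<kappa> \<tau> F"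
abbreviation "grad \<equiv> heat_potential_dy \<kappa> \<tau> F"

lemma c: "c > 0" using \<kappa> by simp

lemma B0: "B \<ge> 0" using F_bounded[of 0 0] by auto

lemma F_compose [measurable]: "(\<lambda>x. F (g x) (h x)) \<in> borel_measurable M"
  if "g \<in> borel_measurable M" "h \<in> borel_measurable M" for g h
  using measurable_compose[OF borel_measurable_Pair[OF that] F_measurable] by simp

lemma shifted_measurable [measurable]:
  "(\<lambda>q. F (t - fst q) (y + c * sqrt (fst q) * snd q)) \<in> borel_measurable lborel"
  by (intro F_compose) (auto intro!: borel_measurable_continuous_onI continuous_intros)

lemma
  assumes m: "integrable lborel m"
  shows integrable_heat_convolution: "integrable lborel (\<lambda>q. m q * F (t - fst q) (y + c * sqrt (fst q) * snd q))"
    and heat_convolution_bound: "\<bar>heat_convolution \<kappa> m F t y\<bar> \<le> B * (\<integral>q. \<bar>m q\<bar> \<partial>lborel)"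
proof -
  note [measurable] = borel_measurable_integrable[OF m]
  have le: "norm (m q * F (t - fst q) (y + c * sqrt (fst q) * snd q)) \<le> \<bar>m q\<bar> * B" for q
    unfolding real_norm_def abs_mult by (intro mult_left_mono F_bounded) auto
  have i: "integrable lborel (\<lambda>q. \<bar>m q\<bar> * B)" using m by auto
  show *: "integrable lborel (\<lambda>q. m q * F (t - fst q) (y + c * sqrt (fst q) * snd q))"
  proof (rule Bochner_Integration.integrable_bound[OF i])
    show "(\<lambda>q. m q * F (t - fst q) (y + c * sqrt (fst q) * snd q)) \<in> borel_measurable lborel" by measurable
    show "AE q in lborel. norm (m q * F (t - fst q) (y + c * sqrt (fst q) * snd q)) \<le> norm (\<bar>m q\<bar> * B)"
      by (rule AE_I2, rule order_trans[OF le]) simp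
  qed
  have "norm (heat_convolution \<kappa> m F t y) \<le> (\<integral>q. \<bar>m q\<bar> * B \<partial>lborel)"
    unfolding heat_convolution_def by (rule Bochner_Integration.integral_norm_bound_integral[OF * i le])
  then show "\<bar>heat_convolution \<kappa> m F t y\<bar> \<le> B * (\<integral>q. \<bar>m q\<bar> \<partial>lborel)" by (simp add: mult.commute)
qed

text \<open>
For almost every lag and displacement the source is evaluated off the axes.
\<close>

lemma AE_regular: "AE q in lborel. t \<noteq> fst q \<and> (fst q > 0 \<longrightarrow> y + c * sqrt (fst q) * snd q \<noteq> 0)"
proof -
  have "AE q in lborel \<Otimes>\<^sub>M lborel. t \<noteq> fst q \<and> (fst q > 0 \<longrightarrow> y + c * sqrt (fst q) * snd q \<noteq> 0)"
  proof (rule lborel_pair.AE_pair_measure)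
    show "{q \<in> space (lborel \<Otimes>\<^sub>M lborel). t \<noteq> fst q \<and> (fst q > 0 \<longrightarrow> y + c * sqrt (fst q) * snd q \<noteq> 0)} \<in> sets (lborel \<Otimes>\<^sub>M lborel)"
      by measurable
    show "AE r in lborel. AE z in lborel. t \<noteq> fst (r, z) \<and> (fst (r, z) > 0 \<longrightarrow> y + c * sqrt (fst (r, z)) * snd (r, z) \<noteq> 0)"
      using AE_lborel_singleton[of t]
    proof eventually_elim
      case (elim r)
      show ?case using AE_lborel_singleton[of "- y / (c * sqrt r)"]
      proof eventually_elim
        case (elim z)
        then show ?case using \<open>r \<noteq> t\<close> c by (auto simp: field_simps eq_neg_iff_add_eq_0)
      qed
    qed
  qed
  then show ?thesis unfolding lborel_prod .
qed

lemma continuous_on_heat_convolution: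
  assumes m: "integrable lborel m" and z: "\<And>q. fst q \<le> 0 \<Longrightarrow> m q = 0"
  shows "continuous_on UNIV (\<lambda>p. heat_convolution \<kappa> m F (fst p) (snd p))"
  unfolding heat_convolution_def
proof (rule continuous_on_integral_dominated[where m="\<lambda>q. \<bar>m q\<bar> * B"])
  note [measurable] = borel_measurable_integrable[OF m]
  fix p :: "real \<times> real"
  show "(\<lambda>q. m q * F (fst p - fst q) (snd p + c * sqrt (fst q) * snd q)) \<in> borel_measurable lborel" by measurable
  show "AE q in lborel. \<bar>m q * F (fst p - fst q) (snd p + c * sqrt (fst q) * snd q)\<bar> \<le> \<bar>m q\<bar> * B"
    unfolding abs_mult by (intro AE_I2 mult_left_mono F_bounded) auto
  show "AE q in lborel. isCont (\<lambda>p. m q * F (fst p - fst q) (snd p + c * sqrt (fst q) * snd q)) p"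
    using AE_regular[of "fst p" "snd p"]
  proof eventually_elim
    case (elim q)
    show ?case
    proof (cases "fst q > 0")
      case True
      have "isCont (\<lambda>p. case (fst p - fst q, snd p + c * sqrt (fst q) * snd q) of (t, y) \<Rightarrow> F t y) p"
        by (rule isCont_o2[where f="\<lambda>p. (fst p - fst q, snd p + c * sqrt (fst q) * snd q)"])
          (use elim True in \<open>auto intro!: continuous_intros F_cont\<close>)
      then show ?thesis by (intro continuous_intros) simp
    qed (use z in simp)
  qed
qed (use m in auto)

lemma value_kernel_nonpos: "fst q \<le> 0 \<Longrightarrow> value_kernel \<tau> q = 0"
  and gradient_kernel_nonpos: "fst q \<le> 0 \<Longrightarrow> gradient_kernel \<kappa> \<tau> q = 0"
  by (auto simp: value_kernel_def gradient_kernel_def)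

lemmas continuous_on_val = continuous_on_heat_convolution[OF integrable_value_kernel[OF \<tau>] value_kernel_nonpos]
lemmas continuous_on_grad = continuous_on_heat_convolution[OF integrable_gradient_kernel[OF \<tau> \<kappa>] gradient_kernel_nonpos]

lemma val_bound: "\<bar>val t y\<bar> \<le> B * \<tau>"
  using heat_convolution_bound[OF integrable_value_kernel[OF \<tau>]] integral_value_kernel[OF \<tau>] by simp

lemma grad_bound: "\<bar>grad t y\<bar> \<le> B * (2 * sqrt \<tau> / c)"
  by (rule order_trans[OF heat_convolution_bound[OF integrable_gradient_kernel[OF \<tau> \<kappa>]]])
    (intro mult_left_mono integral_gradient_kernel \<tau> \<kappa> B0)

lemma val_initial: "t \<le> 0 \<Longrightarrow> val t y = 0"
proof -
  assume t: "t \<le> 0"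
  have "(\<lambda>q. value_kernel \<tau> q * F (t - fst q) (y + c * sqrt (fst q) * snd q)) = (\<lambda>q. 0)"
  proof
    fix q show "value_kernel \<tau> q * F (t - fst q) (y + c * sqrt (fst q) * snd q) = 0"
      using value_kernel_nonpos[of q] F_past[of "t - fst q"] t by (cases "fst q \<le> 0") auto
  qed
  then show ?thesis unfolding heat_convolution_def by simp
qed

lemma heat_convolution_iterated:
  assumes m: "integrable lborel (\<lambda>q. k (fst q) * l (snd q))"
  shows "heat_convolution \<kappa> (\<lambda>q. k (fst q) * l (snd q)) F t y = (\<integral>r. k r * (\<integral>z. l z * F (t - r) (y + c * sqrt r * z) \<partial>lborel) \<partial>lborel)"
    "integrable lborel (\<lambda>r. k r * (\<integral>z. l z * F (t - r) (y + c * sqrt r * z) \<partial>lborel))"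
proof -
  have i: "integrable (lborel \<Otimes>\<^sub>M lborel) (\<lambda>q. k (fst q) * l (snd q) * F (t - fst q) (y + c * sqrt (fst q) * snd q))"
    using integrable_heat_convolution[OF m] by (simp add: lborel_prod)
  show "heat_convolution \<kappa> (\<lambda>q. k (fst q) * l (snd q)) F t y = (\<integral>r. k r * (\<integral>z. l z * F (t - r) (y + c * sqrt r * z) \<partial>lborel) \<partial>lborel)"
    using lborel_pair.integral_fst'[OF i] by (simp add: heat_convolution_def lborel_prod mult.assoc)
  show "integrable lborel (\<lambda>r. k r * (\<integral>z. l z * F (t - r) (y + c * sqrt r * z) \<partial>lborel))"
    using lborel_pair.integrable_fst'[OF i] by (simp add: mult.assoc)
qed

lemma val_iterated: "val t y = (\<integral>r. indicator {0<..<\<tau>} r * (\<integral>z. gauss z * F (t - r) (y + c * sqrt r * z) \<partial>lborel) \<partial>lborel)"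
  and integrable_val: "integrable lborel (\<lambda>r. indicator {0<..<\<tau>} r * (\<integral>z. gauss z * F (t - r) (y + c * sqrt r * z) \<partial>lborel))"
proof -
  note i = integrable_value_kernel[OF \<tau>, unfolded value_kernel_def[abs_def]]
  from heat_convolution_iterated[OF i]
  show "val t y = (\<integral>r. indicator {0<..<\<tau>} r * (\<integral>z. gauss z * F (t - r) (y + c * sqrt r * z) \<partial>lborel) \<partial>lborel)"
    "integrable lborel (\<lambda>r. indicator {0<..<\<tau>} r * (\<integral>z. gauss z * F (t - r) (y + c * sqrt r * z) \<partial>lborel))"
    unfolding value_kernel_def[abs_def] by auto
qed

lemma val_boundary: "val t 0 = 0"
proof -
  have "(\<integral>z. gauss z * F (t - r) (0 + c * sqrt r * z) \<partial>lborel) = 0" for r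
  proof -
    let ?g = "\<lambda>z. gauss z * F (t - r) (0 + c * sqrt r * z)"
    have "?g (- z) = - ?g z" for z using F_odd[of "t - r" "c * sqrt r * z"] by (simp add: gauss_even)
    then have "integral\<^sup>L lborel ?g = - integral\<^sup>L lborel ?g"
      using lborel_integral_real_affine[of "-1" ?g 0] by simp
    then show ?thesis by simp
  qed
  then show ?thesis unfolding val_iterated by simp
qed

text \<open>
The heat kernel is too singular at lag 0 for a single dominated differentiation. For a fixed lag \<open>r\<close> the Gaussian convolution is
differentiated first; the resulting bound of order \<open>1 / sqrt r\<close> then permits differentiation under the integral over \<open>r\<close>.
\<close>

lemma DERIV_val: "(val t has_real_derivative grad t y) (at y)"
proof -
  let ?J' = "\<lambda>y r. indicator {0<..<\<tau>} r * (\<integral>z. (z * gauss z / (c * sqrt r)) * F (t - r) (y + c * sqrt r * z) \<partial>lborel)"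
  have meas: "(\<lambda>r. \<integral>z. (z * gauss z / (c * sqrt r)) * F (t - r) (y + c * sqrt r * z) \<partial>lborel) \<in> borel_measurable lborel" for y
    by (rule lborel.borel_measurable_lebesgue_integral) (simp add: case_prod_beta, measurable)
  have D: "((\<lambda>y. \<integral>r. indicator {0<..<\<tau>} r * (\<integral>z. gauss z * F (t - r) (y + c * sqrt r * z) \<partial>lborel) \<partial>lborel)
    has_real_derivative (\<integral>r. ?J' y r \<partial>lborel)) (at y)"
  proof (rule has_real_derivative_integral_dominated[where a="y - 1" and b="y + 1" and f'="?J'" and
        m="\<lambda>r. indicator {0<..<\<tau>} r * (1 / sqrt r) * (B / c)"])
    fix y r :: real
    show "((\<lambda>y. indicator {0<..<\<tau>} r * (\<integral>z. gauss z * F (t - r) (y + c * sqrt r * z) \<partial>lborel)) has_real_derivative ?J' y r) (at y)"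
    proof (cases "r \<in> {0<..<\<tau>}")
      case True
      then have "c * sqrt r > 0" using c by auto
      from DERIV_gauss_convolution[where f="F (t - r)" and a="c * sqrt r", OF _ F_bounded this]
      show ?thesis using True by simp
    qed simp
    show "\<bar>?J' y r\<bar> \<le> indicator {0<..<\<tau>} r * (1 / sqrt r) * (B / c)"
    proof (cases "r \<in> {0<..<\<tau>}")
      case True
      then have a: "c * sqrt r > 0" using c by auto
      have i: "integrable lborel (\<lambda>z. \<bar>z\<bar> * gauss z / (c * sqrt r) * B)" using integrable_abs_gauss by auto
      have le: "norm ((z * gauss z / (c * sqrt r)) * F (t - r) (y + c * sqrt r * z)) \<le> \<bar>z\<bar> * gauss z / (c * sqrt r) * B" for z
      proof -
        have "norm ((z * gauss z / s) * x) = \<bar>z\<bar> * gauss z / s * \<bar>x\<bar>" if "s > 0" for s x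
          using that gauss_nonneg by (simp add: abs_mult)
        from this[OF a] show ?thesis
          by (simp only:) (rule mult_left_mono[OF F_bounded], use a gauss_nonneg in auto)
      qed
      have "norm (\<integral>z. (z * gauss z / (c * sqrt r)) * F (t - r) (y + c * sqrt r * z) \<partial>lborel)
         \<le> (\<integral>z. \<bar>z\<bar> * gauss z / (c * sqrt r) * B \<partial>lborel)"
      proof (rule Bochner_Integration.integral_norm_bound_integral[OF _ i le])
        show "integrable lborel (\<lambda>z. (z * gauss z / (c * sqrt r)) * F (t - r) (y + c * sqrt r * z))"
        proof (rule Bochner_Integration.integrable_bound[OF i])
          show "AE z in lborel. norm ((z * gauss z / (c * sqrt r)) * F (t - r) (y + c * sqrt r * z)) \<le> norm (\<bar>z\<bar> * gauss z / (c * sqrt r) * B)"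
            by (rule AE_I2, rule order_trans[OF le]) (simp only: real_norm_def abs_ge_self)
        qed measurable
      qed
      also have "\<dots> = (\<integral>z. \<bar>z\<bar> * gauss z \<partial>lborel) * (B / (c * sqrt r))" by simp
      also have "\<dots> \<le> 1 * (B / (c * sqrt r))"
        using a B0 by (intro mult_right_mono[OF integral_abs_gauss_le]) auto
      finally show ?thesis using True by (simp add: field_simps)
    qed simp
    show "integrable lborel (\<lambda>r. indicator {0<..<\<tau>} r * (\<integral>z. gauss z * F (t - r) (y + c * sqrt r * z) \<partial>lborel))"
      by (rule integrable_val)
    show "integrable lborel (\<lambda>r. indicator {0<..<\<tau>} r * (1 / sqrt r) * (B / c))"
      by (rule integrable_mult_left) (rule integrable_inverse_sqrt(1)[OF \<tau>])
  qed (use meas in auto)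
  have "grad t y = (\<integral>r. ?J' y r \<partial>lborel)"
  proof -
    note i = integrable_gradient_kernel[OF \<tau> \<kappa>, unfolded gradient_kernel_def[abs_def]]
    have "grad t y = (\<integral>r. indicator {0<..<\<tau>} r * (1 / sqrt r) * (\<integral>z. z * gauss z / c * F (t - r) (y + c * sqrt r * z) \<partial>lborel) \<partial>lborel)"
      using heat_convolution_iterated(1)[OF i] unfolding gradient_kernel_def[abs_def] .
    also have "\<dots> = (\<integral>r. ?J' y r \<partial>lborel)"
    proof (rule Bochner_Integration.integral_cong)
      fix r :: real
      have "(1 / sqrt r) * (\<integral>z. z * gauss z / c * F (t - r) (y + c * sqrt r * z) \<partial>lborel)
        = (\<integral>z. (1 / sqrt r) * (z * gauss z / c * F (t - r) (y + c * sqrt r * z)) \<partial>lborel)" by simp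
      then show "indicator {0<..<\<tau>} r * (1 / sqrt r) * (\<integral>z. z * gauss z / c * F (t - r) (y + c * sqrt r * z) \<partial>lborel) = ?J' y r"
        by (simp add: mult.assoc mult.commute[of c])
    qed simp
    finally show ?thesis .
  qed
  then show ?thesis using D unfolding val_iterated[abs_def] by simp
qed

end

section \<open>The heat potential is a weak solution\<close>

lemma test_has_derivative:
  assumes \<phi>: "\<phi> \<in> test_functions Q"
  shows "((\<lambda>p. \<phi> (fst p) (snd p)) has_derivative (\<lambda>h. dt \<phi> (fst p) (snd p) * fst h + dy \<phi> (fst p) (snd p) * snd h)) (at p)"
proof -
  obtain D where "((\<lambda>(t, y). \<phi> t y) has_derivative D) (at p)"
    using test_differentiable[OF \<phi>] unfolding differentiable_def by blast
  then have D: "((\<lambda>p. \<phi> (fst p) (snd p)) has_derivative D) (at p)" by (simp add: case_prod_unfold)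
  interpret D: bounded_linear D using has_derivative_bounded_linear[OF D] .
  obtain t y where p: "p = (t, y)" by (cases p)
  have "((\<lambda>t. (t, y)) has_derivative (\<lambda>h. (h, 0))) (at t)" by (auto intro!: derivative_eq_intros)
  from has_derivative_compose[OF this D[unfolded p]] have "((\<lambda>t. \<phi> t y) has_derivative (\<lambda>h. D (h, 0))) (at t)" by simp
  then have 1: "D (h, 0) = dt \<phi> t y * h" for h
    using has_derivative_unique[OF _ test_DERIV_dt[OF \<phi>, of y t, unfolded has_field_derivative_def]] by metis
  have "((\<lambda>y. (t, y)) has_derivative (\<lambda>h. (0, h))) (at y)" by (auto intro!: derivative_eq_intros)
  from has_derivative_compose[OF this D[unfolded p]] have "((\<lambda>y. \<phi> t y) has_derivative (\<lambda>h. D (0, h))) (at y)" by simp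
  then have 2: "D (0, h) = dy \<phi> t y * h" for h
    using has_derivative_unique[OF _ test_DERIV_dy[OF \<phi>, of t y, unfolded has_field_derivative_def]] by metis
  have "D h = dt \<phi> t y * fst h + dy \<phi> t y * snd h" for h
    using D.add[of "(fst h, 0)" "(0, snd h)"] 1 2 by simp
  then show ?thesis using D p by (metis (no_types, lifting) ext fst_conv snd_conv)
qed

lemma test_bounded:
  assumes \<phi>: "\<phi> \<in> test_functions Q"
  obtains B where "B \<ge> 0" "\<And>t y. \<bar>\<phi> t y\<bar> \<le> B"
proof -
  have "compact ((\<lambda>(t, y). \<phi> t y) ` supp \<phi>)"
    by (intro compact_continuous_image test_continuous[OF \<phi>] compact_supp[OF \<phi>])
  then have "bounded ((\<lambda>(t, y). \<phi> t y) ` supp \<phi>)" by (rule compact_imp_bounded)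
  then obtain B where B: "B > 0" "\<And>x. x \<in> (\<lambda>(t, y). \<phi> t y) ` supp \<phi> \<Longrightarrow> norm x \<le> B" unfolding bounded_pos by blast
  have "\<bar>\<phi> t y\<bar> \<le> B" for t y
  proof (cases "(t, y) \<in> supp \<phi>")
    case True
    then have "\<phi> t y \<in> (\<lambda>(t, y). \<phi> t y) ` supp \<phi>" by force
    from B(2)[OF this] show ?thesis by simp
  qed (use not_in_supp[of t y \<phi>] B(1) in auto)
  with B(1) show ?thesis by (intro that[of B]) auto
qed

lemma test_support_bounded:
  assumes \<phi>: "\<phi> \<in> test_functions Q"
  obtains R where "R > 0" "\<And>t y. \<bar>y\<bar> \<ge> R \<Longrightarrow> \<phi> t y = 0"
proof -
  obtain R where R: "R > 0" "\<And>p. p \<in> supp \<phi> \<Longrightarrow> norm p \<le> R"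
    using compact_imp_bounded[OF compact_supp[OF \<phi>]] unfolding bounded_pos by blast
  have "\<phi> t y = 0" if "\<bar>y\<bar> \<ge> R + 1" for t y
    using R(2)[of "(t, y)"] norm_snd_le[of y t] that not_in_supp[of t y \<phi>] by fastforce
  with R(1) show ?thesis by (intro that[of "R + 1"]) auto
qed

lemma integral_gauss_by_parts:
  fixes g g' :: "real \<Rightarrow> real"
  assumes D: "\<And>z. (g has_real_derivative g' z) (at z)" and c: "continuous_on UNIV g'"
    and R: "R > 0" "\<And>z. \<bar>z\<bar> \<ge> R \<Longrightarrow> g z = 0" "\<And>z. \<bar>z\<bar> \<ge> R \<Longrightarrow> g' z = 0"
  shows "(\<integral>z. z * gauss z * g z \<partial>lborel) = (\<integral>z. gauss z * g' z \<partial>lborel)"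
proof -
  have cg: "continuous_on UNIV g" using D by (meson DERIV_isCont continuous_at_imp_continuous_on)
  have i: "integrable lborel (\<lambda>z. z * gauss z * g z)" "integrable lborel (\<lambda>z. gauss z * g' z)"
    by (rule integrable_continuous_compact_support[where S="{-R..R}"],
      use R in \<open>auto intro!: continuous_intros continuous_gauss cg c\<close>)+
  have "(\<integral>z. - z * gauss z * g z + gauss z * g' z \<partial>lborel) = 0"
  proof (rule integral_deriv_compact_support[where F="\<lambda>z. gauss z * g z" and R=R])
    show "((\<lambda>z. gauss z * g z) has_real_derivative - z * gauss z * g z + gauss z * g' z) (at z)" for z
      using DERIV_mult[OF DERIV_gauss D] by (simp add: algebra_simps)
  qed (use R in \<open>auto intro!: continuous_intros continuous_gauss cg c\<close>)
  moreover have "(\<integral>z. - z * gauss z * g z + gauss z * g' z \<partial>lborel) = - (\<integral>z. z * gauss z * g z \<partial>lborel) + (\<integral>z. gauss z * g' z \<partial>lborel)"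
    using Bochner_Integration.integral_add[OF integrable_minus[OF i(1)] i(2)] by simp
  ultimately show ?thesis by simp
qed

lemma integrable_weight_mult:
  fixes w h :: "real \<Rightarrow> real"
  assumes w: "integrable lborel w" and h: "continuous_on UNIV h" "\<And>z. \<bar>h z\<bar> \<le> B"
  shows "integrable lborel (\<lambda>z. w z * h z)"
proof (rule Bochner_Integration.integrable_bound[where f="\<lambda>z. w z * B"])
  show "(\<lambda>z. w z * h z) \<in> borel_measurable lborel"
    using borel_measurable_integrable[OF w] borel_measurable_continuous_onI[OF h(1)] by simp
  show "AE z in lborel. norm (w z * h z) \<le> norm (w z * B)"
    using order_trans[OF h(2) abs_ge_self] by (auto simp: abs_mult intro!: mult_left_mono)
qed (use w in auto)

lemma continuous_on_gauss_integral:
  fixes h :: "real \<Rightarrow> real \<Rightarrow> real"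
  assumes r: "\<And>z. continuous_on S (\<lambda>r. h r z)" and z: "\<And>r. continuous_on UNIV (h r)" and B: "\<And>r z. \<bar>h r z\<bar> \<le> B"
  shows "continuous_on S (\<lambda>r. \<integral>z. gauss z * h r z \<partial>lborel)"
proof (rule continuous_on_integral_dominated[where m="\<lambda>z. gauss z * B"])
  show "(\<lambda>z. gauss z * h r z) \<in> borel_measurable lborel" for r
    using borel_measurable_integrable[OF integrable_weight_mult[OF integrable_gauss z B]] .
  show "AE z in lborel. continuous (at x within S) (\<lambda>r. gauss z * h r z)" if "x \<in> S" for x
    using r that by (auto simp: continuous_on_eq_continuous_within intro!: continuous_intros)
  show "AE z in lborel. \<bar>gauss z * h r z\<bar> \<le> gauss z * B" for r
    using B gauss_nonneg by (auto simp: abs_mult intro!: mult_left_mono)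
qed (use integrable_gauss in auto)

text \<open>
The Gaussian average \<open>\<Theta> r\<close> of \<open>\<phi>\<close> at time \<open>s + r\<close> equals \<open>\<phi> s \<xi>\<close> at \<open>r = 0\<close> and vanishes at \<open>r = \<tau>\<close>,
beyond the support of \<open>\<phi>\<close>. Its derivative is the Gaussian average of \<open>\<phi>\<^sub>t + \<kappa> \<phi>\<^sub>y\<^sub>y\<close>: the factor \<open>z / sqrt r\<close> that arises
from the displacement is traded for a second derivative in \<open>y\<close> by Gaussian integration by parts.
\<close>

lemma backward_duhamel:
  assumes \<kappa>: "\<kappa> > 0" and \<tau>: "\<tau> > 0" and \<phi>: "\<phi> \<in> test_functions (half_cylinder \<tau>)" and s: "s > 0"
  shows "(\<integral>q. value_kernel \<tau> q * (- dt \<phi> (s + fst q) (\<xi> - sqrt (2 * \<kappa>) * sqrt (fst q) * snd q)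
     - \<kappa> * dy (dy \<phi>) (s + fst q) (\<xi> - sqrt (2 * \<kappa>) * sqrt (fst q) * snd q)) \<partial>lborel) = \<phi> s \<xi>"
proof -
  let ?c = "sqrt (2 * \<kappa>)"
  let ?x = "\<lambda>r z. \<xi> - ?c * sqrt r * z"
  have c: "?c > 0" using \<kappa> by simp
  define \<psi> where "\<psi> = (\<lambda>t y. - dt \<phi> t y - \<kappa> * dy (dy \<phi>) t y)"
  note T = test_dt[OF \<phi>] test_dy[OF \<phi>] test_dy[OF test_dy[OF \<phi>]]
  obtain B0 where B0: "B0 \<ge> 0" "\<And>t y. \<bar>\<phi> t y\<bar> \<le> B0" using test_bounded[OF \<phi>] by blast
  obtain B1 where B1: "B1 \<ge> 0" "\<And>t y. \<bar>dt \<phi> t y\<bar> \<le> B1" using test_bounded[OF T(1)] by blast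
  obtain B2 where B2: "B2 \<ge> 0" "\<And>t y. \<bar>dy \<phi> t y\<bar> \<le> B2" using test_bounded[OF T(2)] by blast
  obtain B3 where B3: "B3 \<ge> 0" "\<And>t y. \<bar>dy (dy \<phi>) t y\<bar> \<le> B3" using test_bounded[OF T(3)] by blast
  have cont: "continuous_on S (\<lambda>x. f (g x) (h x))" if "f \<in> test_functions Q" "continuous_on S g" "continuous_on S h"
    for S :: "'x::topological_space set" and f Q g h
    using continuous_on_compose2[OF test_continuous[OF that(1), of UNIV], of S "\<lambda>x. (g x, h x)"] that(2,3)
    by (auto intro: continuous_on_Pair)
  have cont\<psi>: "continuous_on S (\<lambda>x. \<psi> (g x) (h x))" if "continuous_on S g" "continuous_on S h"
    for S :: "'x::topological_space set" and g h
    unfolding \<psi>_def by (intro continuous_intros cont[OF T(1)] cont[OF T(3)] that)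
  have B\<psi>: "\<bar>\<psi> t y\<bar> \<le> B1 + \<kappa> * B3" for t y
  proof -
    have "\<bar>\<psi> t y\<bar> \<le> \<bar>dt \<phi> t y\<bar> + \<bar>\<kappa> * dy (dy \<phi>) t y\<bar>" unfolding \<psi>_def by linarith
    also have "\<dots> \<le> B1 + \<kappa> * B3" unfolding abs_mult using B1(2) B3(2) \<kappa> by (intro add_mono mult_mono) auto
    finally show ?thesis .
  qed
  define \<Theta> where "\<Theta> r = (\<integral>z. gauss z * \<phi> (s + r) (?x r z) \<partial>lborel)" for r
  define \<theta> where "\<theta> r = (\<integral>z. gauss z * \<psi> (s + r) (?x r z) \<partial>lborel)" for r
  have c\<Theta>: "continuous_on {0..\<tau>} \<Theta>"
    unfolding \<Theta>_def[abs_def] by (rule continuous_on_gauss_integral[OF _ _ B0(2)]) (intro continuous_intros cont[OF \<phi>])+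
  have c\<theta>: "continuous_on {0..\<tau>} \<theta>"
    unfolding \<theta>_def[abs_def] by (rule continuous_on_gauss_integral[OF _ _ B\<psi>]) (intro continuous_intros cont\<psi>)+
  have deriv: "(\<Theta> has_real_derivative - \<theta> r) (at r)" if r: "r > 0" for r
  proof -
    have D: "(\<Theta> has_real_derivative (\<integral>z. gauss z * (dt \<phi> (s + r) (?x r z) + dy \<phi> (s + r) (?x r z) * (- (?c * z / (2 * sqrt r)))) \<partial>lborel)) (at r)"
      unfolding \<Theta>_def[abs_def]
    proof (rule has_real_derivative_integral_dominated[where a="r / 4" and b="2 * r" and
       f'="\<lambda>r z. gauss z * (dt \<phi> (s + r) (?x r z) + dy \<phi> (s + r) (?x r z) * (- (?c * z / (2 * sqrt r))))" and
       m="\<lambda>z. gauss z * B1 + (\<bar>z\<bar> * gauss z) * (B2 * ?c / sqrt r)"])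
      fix \<rho> z :: real assume \<rho>: "r / 4 < \<rho>" "\<rho> < 2 * r"
      then have \<rho>0: "\<rho> > 0" using r by auto
      have "((\<lambda>\<rho>. (s + \<rho>, \<xi> - ?c * sqrt \<rho> * z)) has_derivative (\<lambda>h. (h, - (?c * z / (2 * sqrt \<rho>)) * h))) (at \<rho>)"
        using \<rho>0 by (auto intro!: derivative_eq_intros simp: field_simps)
      from has_derivative_compose[OF this test_has_derivative[OF \<phi>]]
      have "((\<lambda>\<rho>. \<phi> (s + \<rho>) (?x \<rho> z)) has_real_derivative
         (dt \<phi> (s + \<rho>) (?x \<rho> z) + dy \<phi> (s + \<rho>) (?x \<rho> z) * (- (?c * z / (2 * sqrt \<rho>))))) (at \<rho>)"
        unfolding has_field_derivative_def fst_conv snd_conv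
        by (rule has_derivative_eq_rhs) (simp add: fun_eq_iff algebra_simps)
      then show "((\<lambda>\<rho>. gauss z * \<phi> (s + \<rho>) (?x \<rho> z)) has_real_derivative
         gauss z * (dt \<phi> (s + \<rho>) (?x \<rho> z) + dy \<phi> (s + \<rho>) (?x \<rho> z) * (- (?c * z / (2 * sqrt \<rho>))))) (at \<rho>)"
        by (rule DERIV_cmult)
      have sq: "sqrt r / 2 \<le> sqrt \<rho>"
      proof -
        have "sqrt r / 2 = sqrt (r / 4)" by (simp add: real_sqrt_divide)
        then show ?thesis using \<rho> by simp
      qed
      have "\<bar>?c * z / (2 * sqrt \<rho>)\<bar> = ?c * \<bar>z\<bar> / (2 * sqrt \<rho>)" using \<rho>0 \<kappa> by (simp add: abs_mult)
      also have "\<dots> \<le> ?c * \<bar>z\<bar> / (2 * (sqrt r / 2))" using sq r \<rho>0 c by (intro divide_left_mono mult_left_mono) auto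
      finally have "\<bar>?c * z / (2 * sqrt \<rho>)\<bar> \<le> ?c * \<bar>z\<bar> / sqrt r" by simp
      then have "\<bar>dy \<phi> (s + \<rho>) (?x \<rho> z) * (- (?c * z / (2 * sqrt \<rho>)))\<bar> \<le> B2 * (?c * \<bar>z\<bar> / sqrt r)"
        unfolding abs_mult abs_minus_cancel using B2 by (intro mult_mono) auto
      then have "\<bar>dt \<phi> (s + \<rho>) (?x \<rho> z) + dy \<phi> (s + \<rho>) (?x \<rho> z) * (- (?c * z / (2 * sqrt \<rho>)))\<bar>
          \<le> B1 + B2 * (?c * \<bar>z\<bar> / sqrt r)"
        using B1(2)[of "s + \<rho>" "?x \<rho> z"] by linarith
      from mult_left_mono[OF this gauss_nonneg[of z]]
      show "\<bar>gauss z * (dt \<phi> (s + \<rho>) (?x \<rho> z) + dy \<phi> (s + \<rho>) (?x \<rho> z) * (- (?c * z / (2 * sqrt \<rho>))))\<bar>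
          \<le> gauss z * B1 + (\<bar>z\<bar> * gauss z) * (B2 * ?c / sqrt r)"
        unfolding abs_mult[of "gauss z"] abs_of_nonneg[OF gauss_nonneg] by (simp add: algebra_simps)
    next
      fix \<rho> :: real
      show "integrable lborel (\<lambda>z. gauss z * \<phi> (s + \<rho>) (?x \<rho> z))"
        by (rule integrable_weight_mult[OF integrable_gauss _ B0(2)]) (intro continuous_intros cont[OF \<phi>])
      show "(\<lambda>z. gauss z * (dt \<phi> (s + r) (?x r z) + dy \<phi> (s + r) (?x r z) * (- (?c * z / (2 * sqrt r))))) \<in> borel_measurable lborel"
        using r by (simp, intro borel_measurable_continuous_onI continuous_intros continuous_gauss cont[OF T(1)] cont[OF T(2)]) auto
      show "integrable lborel (\<lambda>z. gauss z * B1 + (\<bar>z\<bar> * gauss z) * (B2 * ?c / sqrt r))"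
        using integrable_gauss integrable_abs_gauss by (intro Bochner_Integration.integrable_add integrable_mult_left) auto
    qed (use r in auto)
    have a: "?c * sqrt r > 0" using c r by simp
    obtain R2 where R2: "R2 > 0" "\<And>t y. \<bar>y\<bar> \<ge> R2 \<Longrightarrow> dy \<phi> t y = 0" using test_support_bounded[OF T(2)] by blast
    obtain R3 where R3: "R3 > 0" "\<And>t y. \<bar>y\<bar> \<ge> R3 \<Longrightarrow> dy (dy \<phi>) t y = 0" using test_support_bounded[OF T(3)] by blast
    (* beyond R' the argument of the test function leaves its support *)
    define R' where "R' = (R2 + R3 + \<bar>\<xi>\<bar>) / (?c * sqrt r)"
    have far: "\<bar>\<xi> - ?c * sqrt r * z\<bar> \<ge> R2" "\<bar>\<xi> - ?c * sqrt r * z\<bar> \<ge> R3" if "\<bar>z\<bar> \<ge> R'" for z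
    proof -
      have "R2 + R3 + \<bar>\<xi>\<bar> \<le> \<bar>z\<bar> * (?c * sqrt r)" using that a unfolding R'_def by (simp only: pos_divide_le_eq)
      also have "\<dots> = \<bar>?c * sqrt r * z\<bar>" 
        by (simp only: abs_mult[of "?c * sqrt r" z] abs_of_pos[OF a] mult.commute[of "\<bar>z\<bar>"])
      finally show "\<bar>\<xi> - ?c * sqrt r * z\<bar> \<ge> R2" "\<bar>\<xi> - ?c * sqrt r * z\<bar> \<ge> R3" using R2(1) R3(1) by linarith+
    qed
    have bp: "(\<integral>z. z * gauss z * dy \<phi> (s + r) (?x r z) \<partial>lborel)
        = (\<integral>z. gauss z * (dy (dy \<phi>) (s + r) (?x r z) * (- (?c * sqrt r))) \<partial>lborel)"
    proof (rule integral_gauss_by_parts[where R=R'])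
      show "((\<lambda>z. dy \<phi> (s + r) (?x r z)) has_real_derivative
         dy (dy \<phi>) (s + r) (?x r z) * (- (?c * sqrt r))) (at z)" for z
        by (rule DERIV_chain2[where f="dy \<phi> (s + r)", OF test_DERIV_dy[OF T(2)]]) (auto intro!: derivative_eq_intros)
      show "continuous_on UNIV (\<lambda>z. dy (dy \<phi>) (s + r) (?x r z) * (- (?c * sqrt r)))"
        by (intro continuous_intros cont[OF T(3)])
      show "R' > 0" unfolding R'_def using a R2(1) R3(1) by (intro divide_pos_pos) auto
    qed (use far R2 R3 in auto)
    have int: "integrable lborel (\<lambda>z. gauss z * dt \<phi> (s + r) (?x r z))"
      "integrable lborel (\<lambda>z. z * gauss z * dy \<phi> (s + r) (?x r z))"
      "integrable lborel (\<lambda>z. gauss z * dy (dy \<phi>) (s + r) (?x r z))"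
      by (rule integrable_weight_mult[OF integrable_gauss _ B1(2)], intro continuous_intros cont[OF T(1)])
        (rule integrable_weight_mult[OF integrable_id_gauss _ B2(2)], intro continuous_intros cont[OF T(2)],
         rule integrable_weight_mult[OF integrable_gauss _ B3(2)], intro continuous_intros cont[OF T(3)])
    have "(\<integral>z. gauss z * (dt \<phi> (s + r) (?x r z) + dy \<phi> (s + r) (?x r z) * (- (?c * z / (2 * sqrt r)))) \<partial>lborel)
       = (\<integral>z. gauss z * dt \<phi> (s + r) (?x r z) - (?c / (2 * sqrt r)) * (z * gauss z * dy \<phi> (s + r) (?x r z)) \<partial>lborel)"
      by (rule Bochner_Integration.integral_cong) (auto simp: algebra_simps)
    also have "\<dots> = (\<integral>z. gauss z * dt \<phi> (s + r) (?x r z) \<partial>lborel)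
       - (?c / (2 * sqrt r)) * (\<integral>z. z * gauss z * dy \<phi> (s + r) (?x r z) \<partial>lborel)"
      using Bochner_Integration.integral_diff[OF int(1) integrable_mult_right[OF int(2)], of "?c / (2 * sqrt r)"] by simp
    also have "(\<integral>z. z * gauss z * dy \<phi> (s + r) (?x r z) \<partial>lborel)
       = - (?c * sqrt r) * (\<integral>z. gauss z * dy (dy \<phi>) (s + r) (?x r z) \<partial>lborel)"
      unfolding bp integral_mult_right_zero[symmetric]
      by (rule Bochner_Integration.integral_cong) (auto simp: algebra_simps)
    also have "(?c / (2 * sqrt r)) * (- (?c * sqrt r) * (\<integral>z. gauss z * dy (dy \<phi>) (s + r) (?x r z) \<partial>lborel))
       = - \<kappa> * (\<integral>z. gauss z * dy (dy \<phi>) (s + r) (?x r z) \<partial>lborel)"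
    proof -
      (* the square-root singularity at r = 0 cancels *)
      have "(?c / (2 * sqrt r)) * (?c * sqrt r) = \<kappa>" using r \<kappa> by (simp add: field_simps)
      then show ?thesis by (simp add: mult.assoc[symmetric])
    qed
    also have "(\<integral>z. gauss z * dt \<phi> (s + r) (?x r z) \<partial>lborel) - - \<kappa> * (\<integral>z. gauss z * dy (dy \<phi>) (s + r) (?x r z) \<partial>lborel) = - \<theta> r"
    proof -
      have "\<theta> r = (\<integral>z. - (gauss z * dt \<phi> (s + r) (?x r z)) - \<kappa> * (gauss z * dy (dy \<phi>) (s + r) (?x r z)) \<partial>lborel)"
        unfolding \<theta>_def \<psi>_def by (rule Bochner_Integration.integral_cong) (auto simp: algebra_simps)
      also have "\<dots> = - (\<integral>z. gauss z * dt \<phi> (s + r) (?x r z) \<partial>lborel) - \<kappa> * (\<integral>z. gauss z * dy (dy \<phi>) (s + r) (?x r z) \<partial>lborel)"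
        using Bochner_Integration.integral_diff[OF integrable_minus[OF int(1)] integrable_mult_right[OF int(3)], of \<kappa>] by simp
      finally show ?thesis by simp
    qed
    finally show ?thesis using D by simp
  qed
  have \<Theta>0: "\<Theta> 0 = \<phi> s \<xi>" unfolding \<Theta>_def using integral_gauss by simp
  have \<Theta>\<tau>: "\<Theta> \<tau> = 0"
  proof -
    have "\<phi> (s + \<tau>) y = 0" for y
      using not_in_supp[of "s + \<tau>" y \<phi>] subsetD[OF supp_subset[OF \<phi>], of "(s + \<tau>, y)"] s by auto
    then show ?thesis unfolding \<Theta>_def by simp
  qed
  have "((\<lambda>r. - \<theta> r) has_integral \<Theta> \<tau> - \<Theta> 0) {0..\<tau>}"
    by (rule fundamental_theorem_of_calculus_interior[OF less_imp_le[OF \<tau>] c\<Theta>])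
      (use deriv in \<open>auto simp: has_real_derivative_iff_has_vector_derivative[symmetric]\<close>)
  from has_integral_neg[OF this] have "(\<theta> has_integral \<phi> s \<xi>) {0..\<tau>}" by (simp add: \<Theta>0 \<Theta>\<tau>)
  moreover have "set_integrable lborel {0..\<tau>} \<theta>" by (rule borel_integrable_atLeastAtMost'[OF c\<theta>])
  ultimately have I: "(LINT r:{0..\<tau>}|lborel. \<theta> r) = \<phi> s \<xi>"
    using set_borel_integral_eq_integral(2) integral_unique by metis
  have m: "(\<lambda>q. value_kernel \<tau> q * \<psi> (s + fst q) (\<xi> - ?c * sqrt (fst q) * snd q)) \<in> borel_measurable borel"
  proof -
    have "(\<lambda>q. \<psi> (s + fst q) (\<xi> - ?c * sqrt (fst q) * snd q)) \<in> borel_measurable borel"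
      by (intro borel_measurable_continuous_onI cont\<psi> continuous_intros)
    then show ?thesis using borel_measurable_integrable[OF integrable_value_kernel[OF \<tau>]] by simp
  qed
  have "integrable lborel (\<lambda>q. value_kernel \<tau> q * \<psi> (s + fst q) (\<xi> - ?c * sqrt (fst q) * snd q))"
  proof (rule Bochner_Integration.integrable_bound[where f="\<lambda>q. value_kernel \<tau> q * (B1 + \<kappa> * B3)"])
    show "AE q in lborel. norm (value_kernel \<tau> q * \<psi> (s + fst q) (\<xi> - ?c * sqrt (fst q) * snd q)) \<le> norm (value_kernel \<tau> q * (B1 + \<kappa> * B3))"
      unfolding norm_mult using B\<psi> order_trans[OF B\<psi> abs_ge_self] by (auto intro!: mult_left_mono)
  qed (use m integrable_value_kernel[OF \<tau>] in auto)
  then have i: "integrable (lborel \<Otimes>\<^sub>M lborel) (\<lambda>q. value_kernel \<tau> q * \<psi> (s + fst q) (\<xi> - ?c * sqrt (fst q) * snd q))"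
    by (simp add: lborel_prod)
  have "(\<integral>q. value_kernel \<tau> q * \<psi> (s + fst q) (\<xi> - ?c * sqrt (fst q) * snd q) \<partial>lborel)
    = (\<integral>r. indicator {0<..<\<tau>} r * \<theta> r \<partial>lborel)"
    using lborel_pair.integral_fst'[OF i] by (simp add: lborel_prod value_kernel_def \<theta>_def mult.assoc)
  also have "\<dots> = (LINT r:{0..\<tau>}|lborel. \<theta> r)"
    unfolding set_lebesgue_integral_def
  proof (rule integral_cong_AE)
    have [measurable]: "(\<lambda>r. indicator {0..\<tau>} r *\<^sub>R \<theta> r) \<in> borel_measurable lborel"
      using borel_measurable_continuous_on_indicator[OF _ c\<theta>] by simp
    then show "(\<lambda>r. indicator {0..\<tau>} r *\<^sub>R \<theta> r) \<in> borel_measurable lborel" .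
    have eq: "(\<lambda>r. indicator {0<..<\<tau>} r * \<theta> r) = (\<lambda>r. indicator {0<..<\<tau>} r * (indicator {0..\<tau>} r *\<^sub>R \<theta> r))"
      by (auto simp: indicator_def)
    show "(\<lambda>r. indicator {0<..<\<tau>} r * \<theta> r) \<in> borel_measurable lborel" unfolding eq by measurable
    show "AE r in lborel. indicator {0<..<\<tau>} r * \<theta> r = indicator {0..\<tau>} r *\<^sub>R \<theta> r"
      using AE_lborel_singleton[of 0] AE_lborel_singleton[of \<tau>] by eventually_elim (auto simp: indicator_def)
  qed
  finally show ?thesis using I by (simp add: \<psi>_def)
qed

lemma integral_translation:
  fixes f :: "'a::euclidean_space \<Rightarrow> real"
  assumes "f \<in> borel_measurable borel"
  shows "(\<integral>p. f (p + h) \<partial>lborel) = integral\<^sup>L lborel f"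
proof -
  have "integral\<^sup>L (distr lborel borel ((+) h)) f = (\<integral>p. f (h + p) \<partial>lborel)"
    by (rule integral_distr) (use assms in auto)
  then show ?thesis by (simp add: lborel_distr_plus add.commute)
qed

context heat_source
begin

text \<open>
Two applications of Fubini's theorem with a translation of the plane in between move the heat kernel from the source to the test
function, where the previous identity applies.
\<close>

lemma weak_heat_val: "weak_heat (half_cylinder \<tau>) \<kappa> val F"
  unfolding weak_heat_def
proof
  fix \<phi> assume \<phi>: "\<phi> \<in> test_functions (half_cylinder \<tau>)"
  note T = test_dt[OF \<phi>] test_dy[OF test_dy[OF \<phi>]]
  define \<psi> where "\<psi> p = - dt \<phi> (fst p) (snd p) - \<kappa> * dy (dy \<phi>) (fst p) (snd p)" for p
  define \<Psi> where "\<Psi> q = (fst q, - (c * sqrt (fst q) * snd q))" for q :: "real \<times> real"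
  define f where "f p = F (fst p) (snd p)" for p
  define k where "k = value_kernel \<tau>"
  have k: "integrable lborel k" unfolding k_def by (rule integrable_value_kernel[OF \<tau>])
  note [measurable] = borel_measurable_integrable[OF k]
  have f [measurable]: "f \<in> borel_measurable borel" unfolding f_def[abs_def] using F_measurable by (simp add: case_prod_unfold)
  have f_bound: "\<bar>f p\<bar> \<le> B" for p unfolding f_def by (rule F_bounded)
  have fb: "\<bar>k q * f u * \<psi> v\<bar> \<le> \<bar>k q * (B * \<psi> v)\<bar>" for q u v
  proof -
    have "\<bar>k q\<bar> * (\<bar>f u\<bar> * \<bar>\<psi> v\<bar>) \<le> \<bar>k q\<bar> * (B * \<bar>\<psi> v\<bar>)"
      by (intro mult_left_mono mult_right_mono f_bound) auto
    then show ?thesis using B0 by (simp add: abs_mult mult.assoc)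
  qed
  have ctest: "continuous_on UNIV (\<lambda>p. g (fst p) (snd p))" if "g \<in> test_functions Q" for g Q
    using test_continuous[OF that, of UNIV] by (simp add: case_prod_beta)
  have c\<psi>: "continuous_on UNIV \<psi>" unfolding \<psi>_def[abs_def] by (intro continuous_intros ctest[OF T(1)] ctest[OF T(2)])
  have z\<psi>: "\<psi> p = 0" if "p \<notin> supp \<phi>" for p
  proof -
    obtain t y where p: "p = (t, y)" by (cases p)
    have "(t, y) \<notin> supp (dy \<phi>)"
    proof -
      have "supp (dy \<phi>) \<subseteq> supp \<phi>" unfolding supp_def[of "dy \<phi>"]
        by (rule closure_minimal[OF _ closed_supp]) (use supp_derivatives(2)[of _ _ \<phi>] in auto)
      then show ?thesis using that p by auto
    qed
    then show ?thesis using supp_derivatives[of t y \<phi>] supp_derivatives[of t y "dy \<phi>"] that p by (simp add: \<psi>_def)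
  qed
  have i\<psi>: "integrable lborel \<psi>" by (rule integrable_continuous_compact_support[OF c\<psi> compact_supp[OF \<phi>] z\<psi>])
  have [measurable]: "\<psi> \<in> borel_measurable borel" by (rule borel_measurable_continuous_onI[OF c\<psi>])
  have \<Psi>m [measurable]: "\<Psi> \<in> borel_measurable borel" unfolding \<Psi>_def[abs_def] by (intro borel_measurable_continuous_onI continuous_intros)
  have cval: "continuous_on S (\<lambda>(t, y). val t y)" for S
    using continuous_on_val continuous_on_subset by (fastforce simp: case_prod_beta)
  have Q: "open (half_cylinder \<tau>)" by (intro open_Times) auto
  have "- distr_of (half_cylinder \<tau>) val (dt \<phi>) - \<kappa> * distr_of (half_cylinder \<tau>) val (dy (dy \<phi>)) = (\<integral>p. val (fst p) (snd p) * \<psi> p \<partial>lborel)"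
  proof -
    have eq: "distr_of (half_cylinder \<tau>) val g = (\<integral>p. val (fst p) (snd p) * g (fst p) (snd p) \<partial>lborel)"
      and ii: "integrable lborel (\<lambda>p. val (fst p) (snd p) * g (fst p) (snd p))"
      if "g \<in> test_functions (half_cylinder \<tau>)" for g
    proof -
      have "(\<lambda>p. if p \<in> half_cylinder \<tau> then (case p of (t, y) \<Rightarrow> val t y * g t y) else 0) = (\<lambda>p. val (fst p) (snd p) * g (fst p) (snd p))"
      proof
        fix p show "(if p \<in> half_cylinder \<tau> then (case p of (t, y) \<Rightarrow> val t y * g t y) else 0) = val (fst p) (snd p) * g (fst p) (snd p)"
          using supp_subset[OF that] not_in_supp[of "fst p" "snd p" g]
          by (cases "p \<in> half_cylinder \<tau>") (auto simp: case_prod_unfold)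
      qed
      then show "distr_of (half_cylinder \<tau>) val g = (\<integral>p. val (fst p) (snd p) * g (fst p) (snd p) \<partial>lborel)"
         "integrable lborel (\<lambda>p. val (fst p) (snd p) * g (fst p) (snd p))"
        unfolding distr_of_altdef using test_mult_integrable[OF that Q cval] by simp_all
    qed
    have "(\<integral>p. val (fst p) (snd p) * \<psi> p \<partial>lborel) = (\<integral>p. - (val (fst p) (snd p) * dt \<phi> (fst p) (snd p)) - \<kappa> * (val (fst p) (snd p) * dy (dy \<phi>) (fst p) (snd p)) \<partial>lborel)"
      unfolding \<psi>_def by (rule Bochner_Integration.integral_cong) (auto simp: algebra_simps)
    then show ?thesis
      using Bochner_Integration.integral_diff[OF integrable_minus[OF ii[OF T(1)]] integrable_mult_right[OF ii[OF T(2)]], of \<kappa>]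
      unfolding eq[OF T(1)] eq[OF T(2)] by simp
  qed
  also have "\<dots> = (\<integral>p. (\<integral>q. k q * f (p - \<Psi> q) * \<psi> p \<partial>lborel) \<partial>lborel)"
    unfolding heat_convolution_def k_def f_def \<Psi>_def
    by (simp add: mult.assoc flip: integral_mult_left_zero)
  also have "\<dots> = (\<integral>q. (\<integral>p. k q * f (p - \<Psi> q) * \<psi> p \<partial>lborel) \<partial>lborel)"
  proof (rule lborel_pair.Fubini_integral)
    show "integrable (lborel \<Otimes>\<^sub>M lborel) (\<lambda>(q, p). k q * f (p - \<Psi> q) * \<psi> p)"
    proof (rule Bochner_Integration.integrable_bound[where f="\<lambda>x. k (fst x) * (B * \<psi> (snd x))"])
      show "integrable (lborel \<Otimes>\<^sub>M lborel) (\<lambda>x. k (fst x) * (B * \<psi> (snd x)))"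
        using integrable_product(1)[OF k integrable_mult_right[OF i\<psi>]] by (simp add: lborel_prod)
      show "(\<lambda>(q, p). k q * f (p - \<Psi> q) * \<psi> p) \<in> borel_measurable (lborel \<Otimes>\<^sub>M lborel)" by measurable
      show "AE x in lborel \<Otimes>\<^sub>M lborel. norm (case x of (q, p) \<Rightarrow> k q * f (p - \<Psi> q) * \<psi> p) \<le> norm (k (fst x) * (B * \<psi> (snd x)))"
        by (rule AE_I2) (use fb in \<open>simp add: case_prod_unfold\<close>)
    qed
  qed
  also have "\<dots> = (\<integral>q. (\<integral>p. k q * f p * \<psi> (p + \<Psi> q) \<partial>lborel) \<partial>lborel)"
  proof (rule Bochner_Integration.integral_cong)
    fix q
    show "(\<integral>p. k q * f (p - \<Psi> q) * \<psi> p \<partial>lborel) = (\<integral>p. k q * f p * \<psi> (p + \<Psi> q) \<partial>lborel)"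
      using integral_translation[of "\<lambda>p. k q * f (p - \<Psi> q) * \<psi> p" "\<Psi> q"] by simp
  qed simp
  also have "\<dots> = (\<integral>p. (\<integral>q. k q * f p * \<psi> (p + \<Psi> q) \<partial>lborel) \<partial>lborel)"
  proof (rule lborel_pair.Fubini_integral[symmetric])
    have m: "(\<lambda>x. k (fst x) * f (snd x) * \<psi> (snd x + \<Psi> (fst x))) \<in> borel_measurable (lborel \<Otimes>\<^sub>M lborel)" by measurable
    have t: "integrable lborel (\<lambda>p. \<psi> (p + h))" "(\<integral>p. \<bar>\<psi> (p + h)\<bar> \<partial>lborel) = (\<integral>p. \<bar>\<psi> p\<bar> \<partial>lborel)" for h
    proof -
      show "integrable lborel (\<lambda>p. \<psi> (p + h))"
      proof (rule integrable_continuous_compact_support[where S="(\<lambda>p. p - h) ` supp \<phi>"])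
        show "continuous_on UNIV (\<lambda>p. \<psi> (p + h))" by (rule continuous_on_compose2[OF c\<psi>]) (auto intro!: continuous_intros)
        show "compact ((\<lambda>p. p - h) ` supp \<phi>)" by (intro compact_continuous_image compact_supp[OF \<phi>] continuous_intros)
        show "\<psi> (p + h) = 0" if "p \<notin> (\<lambda>p. p - h) ` supp \<phi>" for p
          by (rule z\<psi>) (use that in \<open>auto simp: image_iff algebra_simps\<close>)
      qed
      show "(\<integral>p. \<bar>\<psi> (p + h)\<bar> \<partial>lborel) = (\<integral>p. \<bar>\<psi> p\<bar> \<partial>lborel)" by (rule integral_translation) simp
    qed
    have "integrable (lborel \<Otimes>\<^sub>M lborel) (\<lambda>x. k (fst x) * (B * \<psi> (snd x + \<Psi> (fst x))))"
    proof (rule lborel_pair.Fubini_integrable)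
      show "(\<lambda>x. k (fst x) * (B * \<psi> (snd x + \<Psi> (fst x)))) \<in> borel_measurable (lborel \<Otimes>\<^sub>M lborel)" by measurable
      have "(\<lambda>q. \<integral>p. norm (k (fst (q, p)) * (B * \<psi> (snd (q, p) + \<Psi> (fst (q, p))))) \<partial>lborel) = (\<lambda>q. \<bar>k q\<bar> * (B * (\<integral>p. \<bar>\<psi> p\<bar> \<partial>lborel)))"
        using B0 by (simp add: abs_mult t(2))
      then show "integrable lborel (\<lambda>q. \<integral>p. norm (k (fst (q, p)) * (B * \<psi> (snd (q, p) + \<Psi> (fst (q, p))))) \<partial>lborel)"
        using k by simp
    qed (use t(1) in auto)
    then show "integrable (lborel \<Otimes>\<^sub>M lborel) (\<lambda>(p, q). k p * f q * \<psi> (q + \<Psi> p))"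
    proof (rule Bochner_Integration.integrable_bound)
      show "AE x in lborel \<Otimes>\<^sub>M lborel. norm (case x of (p, q) \<Rightarrow> k p * f q * \<psi> (q + \<Psi> p)) \<le> norm (k (fst x) * (B * \<psi> (snd x + \<Psi> (fst x))))"
        by (rule AE_I2) (use fb in \<open>simp add: case_prod_unfold\<close>)
    qed (use m in \<open>simp add: case_prod_beta\<close>)
  qed
  also have "\<dots> = (\<integral>p. f p * \<phi> (fst p) (snd p) \<partial>lborel)"
  proof (rule Bochner_Integration.integral_cong)
    fix p
    have "(\<integral>q. k q * f p * \<psi> (p + \<Psi> q) \<partial>lborel) = f p * (\<integral>q. k q * \<psi> (p + \<Psi> q) \<partial>lborel)"
      by (simp add: mult.assoc mult.left_commute[of _ "f p"])
    also have "\<dots> = f p * \<phi> (fst p) (snd p)"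
    proof (cases "fst p > 0")
      case True
      from backward_duhamel[OF \<kappa> \<tau> \<phi> this, of "snd p"] show ?thesis
        by (simp add: k_def \<psi>_def \<Psi>_def)
    qed (use F_past in \<open>simp add: f_def\<close>)
    finally show "(\<integral>q. k q * f p * \<psi> (p + \<Psi> q) \<partial>lborel) = f p * \<phi> (fst p) (snd p)" .
  qed simp
  also have "\<dots> = distr_of (half_cylinder \<tau>) F \<phi>"
    unfolding distr_of_altdef
  proof (rule Bochner_Integration.integral_cong)
    fix p show "f p * \<phi> (fst p) (snd p) = (if p \<in> half_cylinder \<tau> then (case p of (t, y) \<Rightarrow> F t y * \<phi> t y) else 0)"
      using supp_subset[OF \<phi>] not_in_supp[of "fst p" "snd p" \<phi>]
      by (cases "p \<in> half_cylinder \<tau>") (auto simp: case_prod_unfold f_def)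
  qed simp
  finally show "- distr_of (half_cylinder \<tau>) val (dt \<phi>) - \<kappa> * distr_of (half_cylinder \<tau>) val (dy (dy \<phi>)) = distr_of (half_cylinder \<tau>) F \<phi>" .
qed

end

section \<open>Local existence\<close>

lemma weak_heat_cong:
  assumes "weak_heat Q \<kappa> w G" "\<And>t y. (t, y) \<in> Q \<Longrightarrow> w t y = w' t y" "\<And>t y. (t, y) \<in> Q \<Longrightarrow> G t y = G' t y"
  shows "weak_heat Q \<kappa> w' G'"
proof -
  have "distr_of Q f \<phi> = distr_of Q f' \<phi>" if "\<And>t y. (t, y) \<in> Q \<Longrightarrow> f t y = f' t y" for f f' \<phi>
    unfolding distr_of_altdef by (rule Bochner_Integration.integral_cong) (use that in auto)
  from this[of w w'] this[of G G'] show ?thesis using assms unfolding weak_heat_def by auto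
qed

definition odd_extension :: "(real \<Rightarrow> real \<Rightarrow> real) \<Rightarrow> real \<Rightarrow> real \<Rightarrow> real" where
  "odd_extension f t y = (if t > 0 then if y > 0 then f t y else if y < 0 then - f t (- y) else 0 else 0)"

lemma heat_source_odd_extension:
  assumes pos: "\<kappa> > 0" "\<tau> > 0" and c: "continuous_on ({0<..} \<times> {0<..}) (\<lambda>(t, y). f t y)"
    and B: "B \<ge> 0" "\<And>t y. t > 0 \<Longrightarrow> y > 0 \<Longrightarrow> \<bar>f t y\<bar> \<le> B"
  shows "heat_source \<kappa> \<tau> B (odd_extension f)"
proof
  let ?P = "{0<..} \<times> {0<..} :: (real \<times> real) set" and ?N = "{0<..} \<times> {..<0} :: (real \<times> real) set"
  have oP: "open ?P" and oN: "open ?N" by (intro open_Times open_greaterThan open_lessThan)+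
  have cN: "continuous_on ?N (\<lambda>p. - f (fst p) (- snd p))"
    by (rule continuous_on_minus, rule continuous_on_compose2[OF c, where f="\<lambda>p. (fst p, - snd p)", simplified])
      (auto intro!: continuous_intros)
  have "(\<lambda>p. indicator ?P p *\<^sub>R f (fst p) (snd p)) \<in> borel_measurable borel"
    using c oP by (intro borel_measurable_continuous_on_indicator) (auto simp: case_prod_unfold)
  moreover have "(\<lambda>p. indicator ?N p *\<^sub>R (- f (fst p) (- snd p))) \<in> borel_measurable borel"
    using cN oN by (intro borel_measurable_continuous_on_indicator) auto
  ultimately have "(\<lambda>p. indicator ?P p *\<^sub>R f (fst p) (snd p) + indicator ?N p *\<^sub>R (- f (fst p) (- snd p))) \<in> borel_measurable borel"
    by (rule borel_measurable_add)
  also have "(\<lambda>p. indicator ?P p *\<^sub>R f (fst p) (snd p) + indicator ?N p *\<^sub>R (- f (fst p) (- snd p)))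
     = (\<lambda>(t, y). odd_extension f t y)"
    by (auto simp: odd_extension_def fun_eq_iff indicator_def)
  finally show "(\<lambda>(t, y). odd_extension f t y) \<in> borel_measurable borel" .
  show "\<bar>odd_extension f t y\<bar> \<le> B" for t y using B(1) B(2)[of t y] B(2)[of t "- y"] by (auto simp: odd_extension_def)
  show "isCont (\<lambda>(t, y). odd_extension f t y) (t, y)" if ty: "t \<noteq> 0" "y \<noteq> 0" for t y
  proof -
    have loc: "isCont (\<lambda>(t, y). odd_extension f t y) p"
      if "open U" "p \<in> U" "continuous_on U g" "\<And>q. q \<in> U \<Longrightarrow> g q = (case q of (t, y) \<Rightarrow> odd_extension f t y)" for p U g
    proof -
      have "continuous_on U (\<lambda>(t, y). odd_extension f t y)" by (rule continuous_on_eq[OF that(3)]) (use that(4) in auto)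
      then show ?thesis using that(1,2) by (simp add: continuous_on_eq_continuous_at)
    qed
    consider "t < 0" | "t > 0" "y > 0" | "t > 0" "y < 0" using ty by linarith
    then show ?thesis
    proof cases
      case 1
      have "open {p :: real \<times> real. fst p < 0}" by (intro open_Collect_less continuous_intros)
      then show ?thesis by (rule loc[where g="\<lambda>p. 0"]) (use 1 in \<open>auto simp: odd_extension_def\<close>)
    next
      case 2
      show ?thesis by (rule loc[OF oP _ c]) (use 2 in \<open>auto simp: odd_extension_def\<close>)
    next
      case 3
      show ?thesis by (rule loc[OF oN _ cN]) (use 3 in \<open>auto simp: odd_extension_def\<close>)
    qed
  qed
qed (use pos in \<open>auto simp: odd_extension_def\<close>)

text \<open>
Together with the next lemma this reduces the contraction estimate to the bounds for a single potential.
\<close>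

lemma heat_convolution_diff:
  assumes "heat_source \<kappa> \<tau> B F" "heat_source \<kappa> \<tau> B F'" "integrable lborel m"
  shows "heat_convolution \<kappa> m F t y - heat_convolution \<kappa> m F' t y = heat_convolution \<kappa> m (\<lambda>t y. F t y - F' t y) t y"
  unfolding heat_convolution_def
  using Bochner_Integration.integral_diff[OF heat_source.integrable_heat_convolution[OF assms(1,3), of t y]
      heat_source.integrable_heat_convolution[OF assms(2,3), of t y]]
  by (simp add: right_diff_distrib)

lemma odd_extension_diff: "(\<lambda>t y. odd_extension f t y - odd_extension g t y) = odd_extension (\<lambda>t y. f t y - g t y)"
  by (auto simp: odd_extension_def fun_eq_iff)

text \<open>
Initial profiles on the half-line, the first one reflected. The first derivatives are extended continuously to \<open>y = 0\<close>; the second ones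
are only bounded there.
\<close>

locale stefan_data =
  fixes \<kappa> K L \<alpha> TM A :: real and f1 f2 f1' f2' f1'' f2'' :: "real \<Rightarrow> real"
  assumes pos: "\<kappa> > 0" "K > 0" "L > 0" "\<alpha> > 0"
    and cont_f: "continuous_on {0..} f1" "continuous_on {0..} f2"
    and cont_f': "continuous_on {0..} f1'" "continuous_on {0..} f2'"
    and cont_f'': "continuous_on {0<..} f1''" "continuous_on {0<..} f2''"
    and deriv_f: "\<And>y. y > 0 \<Longrightarrow> (f1 has_real_derivative f1' y) (at y)" "\<And>y. y > 0 \<Longrightarrow> (f2 has_real_derivative f2' y) (at y)"
    and deriv_f': "\<And>y. y > 0 \<Longrightarrow> (f1' has_real_derivative f1'' y) (at y)" "\<And>y. y > 0 \<Longrightarrow> (f2' has_real_derivative f2'' y) (at y)"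
    and bound_f: "\<And>y. y \<ge> 0 \<Longrightarrow> \<bar>f1 y\<bar> \<le> A" "\<And>y. y \<ge> 0 \<Longrightarrow> \<bar>f2 y\<bar> \<le> A"
    and bound_f': "\<And>y. y \<ge> 0 \<Longrightarrow> \<bar>f1' y\<bar> \<le> A" "\<And>y. y \<ge> 0 \<Longrightarrow> \<bar>f2' y\<bar> \<le> A"
    and bound_f'': "\<And>y. y > 0 \<Longrightarrow> \<bar>f1'' y\<bar> \<le> A" "\<And>y. y > 0 \<Longrightarrow> \<bar>f2'' y\<bar> \<le> A"
    and boundary_f: "f1 0 = TM" "f2 0 = TM"
begin

text \<open>
A state consists of the two corrections and their gradients. Treating the gradients as independent unknowns makes the
fixed point map a contraction in the supremum norm; at the fixed point they are the derivatives of the corrections.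
\<close>

type_synonym state = "(real \<times> real) \<Rightarrow>\<^sub>C (real \<times> real \<times> real \<times> real)"

definition u1 where "u1 X t y = fst (apply_bcontfun X (t, y))" for X :: state and t y :: real
definition p1 where "p1 X t y = fst (snd (apply_bcontfun X (t, y)))" for X :: state and t y :: real
definition u2 where "u2 X t y = fst (snd (snd (apply_bcontfun X (t, y))))" for X :: state and t y :: real
definition p2 where "p2 X t y = snd (snd (snd (apply_bcontfun X (t, y))))" for X :: state and t y :: real

definition speed where "speed X = interface_speed K L (\<lambda>t y. f1' y + p1 X t y) (\<lambda>t y. f2' y + p2 X t y)"
definition source1 where "source1 X t y = \<kappa> * f1'' y - speed X t * (f1' y + p1 X t y)"
definition source2 where "source2 X t y = f2'' y + speed X t * (f2' y + p2 X t y) - I_op \<alpha> (\<lambda>t y. f2 y + u2 X t y) t y"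

text \<open>
\<open>\<Sigma>\<close> bounds the speed, and \<open>\<Lambda>\<close> the size and the Lipschitz constant of the sources, on the unit ball of states.
\<close>

definition \<Sigma> where "\<Sigma> = (1 + K) / L * (A + 1)"
definition \<Lambda> where "\<Lambda> = (\<kappa> + 1) * A + \<Sigma> * (A + 1) + 8 * (A + 1) ^ 4 + 2 * \<Sigma> + 8 * (A + 1) ^ 3"

lemma A0: "A \<ge> 0" using bound_f(1)[of 0] by auto

lemma \<Sigma>0: "\<Sigma> \<ge> 0" using A0 pos by (simp add: \<Sigma>_def)

lemma \<Lambda>_ge: "\<kappa> * A + \<Sigma> * (A + 1) \<le> \<Lambda>" "A + \<Sigma> * (A + 1) + 8 * (A + 1) ^ 4 \<le> \<Lambda>" "2 * \<Sigma> \<le> \<Lambda>" "2 * \<Sigma> + 8 * (A + 1) ^ 3 \<le> \<Lambda>"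
proof -
  have "\<kappa> * A \<ge> 0" "A \<ge> 0" "\<Sigma> * (A + 1) \<ge> 0" "8 * (A + 1) ^ 4 \<ge> 0" "8 * (A + 1) ^ 3 \<ge> 0" using A0 \<Sigma>0 pos by auto
  moreover have "(\<kappa> + 1) * A = \<kappa> * A + A" by (simp add: algebra_simps)
  ultimately show "\<kappa> * A + \<Sigma> * (A + 1) \<le> \<Lambda>" "A + \<Sigma> * (A + 1) + 8 * (A + 1) ^ 4 \<le> \<Lambda>" "2 * \<Sigma> \<le> \<Lambda>" "2 * \<Sigma> + 8 * (A + 1) ^ 3 \<le> \<Lambda>"
    using \<Sigma>0 unfolding \<Lambda>_def by linarith+
qed

lemma \<Lambda>0: "\<Lambda> \<ge> 0" using \<Lambda>_ge(3) \<Sigma>0 by linarith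

lemma component_bounds:
  "\<bar>u1 X t y\<bar> \<le> norm X" "\<bar>p1 X t y\<bar> \<le> norm X" "\<bar>u2 X t y\<bar> \<le> norm X" "\<bar>p2 X t y\<bar> \<le> norm X"
proof -
  obtain a b c d where x: "apply_bcontfun X (t, y) = (a, b, c, d)" by (metis prod.exhaust)
  have "\<bar>a\<bar> \<le> norm (a, b, c, d)" using norm_fst_le[of a "(b, c, d)"] by simp
  moreover have "norm (b, c, d) \<le> norm (a, b, c, d)" by (rule norm_snd_le)
  moreover have "\<bar>b\<bar> \<le> norm (b, c, d)" using norm_fst_le[of b "(c, d)"] by simp
  moreover have "norm (c, d) \<le> norm (b, c, d)" by (rule norm_snd_le)
  moreover have "\<bar>c\<bar> \<le> norm (c, d)" using norm_fst_le[of c d] by simp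
  moreover have "\<bar>d\<bar> \<le> norm (c, d)" using norm_snd_le[of d c] by simp
  moreover have "norm (a, b, c, d) \<le> norm X" using norm_bounded[of X "(t, y)"] x by simp
  ultimately show "\<bar>u1 X t y\<bar> \<le> norm X" "\<bar>p1 X t y\<bar> \<le> norm X" "\<bar>u2 X t y\<bar> \<le> norm X" "\<bar>p2 X t y\<bar> \<le> norm X"
    unfolding u1_def p1_def u2_def p2_def x by auto
qed

lemma component_diff:
  "u1 X t y - u1 Y t y = u1 (X - Y) t y" "p1 X t y - p1 Y t y = p1 (X - Y) t y"
  "u2 X t y - u2 Y t y = u2 (X - Y) t y" "p2 X t y - p2 Y t y = p2 (X - Y) t y"
  by (simp_all add: u1_def p1_def u2_def p2_def)

lemma component_continuous:
  "continuous_on S (\<lambda>p. u1 X (fst p) (snd p))" "continuous_on S (\<lambda>p. p1 X (fst p) (snd p))"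
  "continuous_on S (\<lambda>p. u2 X (fst p) (snd p))" "continuous_on S (\<lambda>p. p2 X (fst p) (snd p))"
proof -
  have "continuous_on S (apply_bcontfun X)" by (rule continuous_on_apply_bcontfun)
  then have "continuous_on S (\<lambda>p. apply_bcontfun X (fst p, snd p))" by simp
  then show "continuous_on S (\<lambda>p. u1 X (fst p) (snd p))" "continuous_on S (\<lambda>p. p1 X (fst p) (snd p))"
  "continuous_on S (\<lambda>p. u2 X (fst p) (snd p))" "continuous_on S (\<lambda>p. p2 X (fst p) (snd p))"
    unfolding u1_def p1_def u2_def p2_def by (auto intro!: continuous_on_fst continuous_on_snd)
qed

lemma speed_continuous: "continuous_on S (speed X)"
proof -
  have "continuous_on S (\<lambda>t. p1 X (fst (t, 0 :: real)) (snd (t :: real, 0)))"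
    by (rule continuous_on_compose2[OF component_continuous(2)[of UNIV X], where f="\<lambda>t. (t, 0)"]) (auto intro!: continuous_intros)
  moreover have "continuous_on S (\<lambda>t. p2 X (fst (t, 0 :: real)) (snd (t :: real, 0)))"
    by (rule continuous_on_compose2[OF component_continuous(4)[of UNIV X], where f="\<lambda>t. (t, 0)"]) (auto intro!: continuous_intros)
  ultimately show ?thesis unfolding speed_def interface_speed_def[abs_def]
    using pos(3) by (auto intro!: continuous_intros)
qed

lemma speed_bound:
  assumes "norm X \<le> 1" shows "\<bar>speed X t\<bar> \<le> \<Sigma>"
proof -
  have "\<bar>f1' 0 + p1 X t 0\<bar> \<le> A + 1" "\<bar>f2' 0 + p2 X t 0\<bar> \<le> A + 1"
    using bound_f'[of 0] component_bounds(2,4)[of X t 0] assms by auto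
  then have "\<bar>(f2' 0 + p2 X t 0) + K * (f1' 0 + p1 X t 0)\<bar> \<le> (A + 1) + K * (A + 1)"
    using mult_left_mono[of "\<bar>f1' 0 + p1 X t 0\<bar>" "A + 1" K] pos(2) abs_mult[of K "f1' 0 + p1 X t 0"] by linarith
  then have "1 / L * \<bar>(f2' 0 + p2 X t 0) + K * (f1' 0 + p1 X t 0)\<bar> \<le> 1 / L * ((A + 1) + K * (A + 1))"
    using pos(3) by (intro mult_left_mono) auto
  also have "\<dots> = \<Sigma>" by (simp add: \<Sigma>_def algebra_simps add_divide_distrib)
  finally have "1 / L * \<bar>(f2' 0 + p2 X t 0) + K * (f1' 0 + p1 X t 0)\<bar> \<le> \<Sigma>" .
  moreover have "\<bar>speed X t\<bar> = 1 / L * \<bar>(f2' 0 + p2 X t 0) + K * (f1' 0 + p1 X t 0)\<bar>"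
    unfolding speed_def interface_speed_def abs_mult[of "1 / L"] using pos(3) by simp
  ultimately show ?thesis by simp
qed

lemma speed_lipschitz: "\<bar>speed X t - speed Y t\<bar> \<le> (1 + K) / L * dist X Y"
proof -
  have "speed X t - speed Y t = 1 / L * ((p2 X t 0 - p2 Y t 0) + K * (p1 X t 0 - p1 Y t 0))"
    by (simp add: speed_def interface_speed_def diff_divide_distrib add_divide_distrib algebra_simps)
  then have "\<bar>speed X t - speed Y t\<bar> = 1 / L * \<bar>p2 (X - Y) t 0 + K * p1 (X - Y) t 0\<bar>"
    using pos(3) by (simp add: abs_mult component_diff)
  also have "\<dots> \<le> 1 / L * (dist X Y + K * dist X Y)"
  proof (rule mult_left_mono)
    have "\<bar>K * p1 (X - Y) t 0\<bar> \<le> K * dist X Y"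
      using component_bounds(2)[of "X - Y" t 0] pos(2) by (simp add: abs_mult dist_norm)
    then show "\<bar>p2 (X - Y) t 0 + K * p1 (X - Y) t 0\<bar> \<le> dist X Y + K * dist X Y"
      using component_bounds(4)[of "X - Y" t 0] unfolding dist_norm by linarith
  qed (use pos in auto)
  finally show ?thesis by (simp add: algebra_simps add_divide_distrib)
qed

lemma radiation_argument:
  "continuous_on (S \<times> {0..}) (\<lambda>(t, y). f2 y + u2 X t y)" "continuous_on {0..} (\<lambda>y. f2 y + u2 X t y)"
  "y \<ge> 0 \<Longrightarrow> norm X \<le> 1 \<Longrightarrow> \<bar>f2 y + u2 X t y\<bar> \<le> A + 1"
proof -
  show "continuous_on (S \<times> {0..}) (\<lambda>(t, y). f2 y + u2 X t y)" unfolding case_prod_unfold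
    by (intro continuous_on_add component_continuous continuous_on_compose2[OF cont_f(2)]) (auto intro!: continuous_intros)
  have "continuous_on {0..} (\<lambda>y. u2 X (fst (t, y)) (snd (t, y)))"
    by (rule continuous_on_compose2[OF component_continuous(3)[of UNIV X], where f="\<lambda>y. (t, y)"]) (auto intro!: continuous_intros)
  then show "continuous_on {0..} (\<lambda>y. f2 y + u2 X t y)" using cont_f(2) by (intro continuous_on_add) auto
  show "y \<ge> 0 \<Longrightarrow> norm X \<le> 1 \<Longrightarrow> \<bar>f2 y + u2 X t y\<bar> \<le> A + 1"
    using bound_f(2)[of y] component_bounds(3)[of X t y] by auto
qed

lemma source_continuous:
  assumes X: "norm X \<le> 1"
  shows "continuous_on ({0<..} \<times> {0<..}) (\<lambda>(t, y). source1 X t y)" "continuous_on ({0<..} \<times> {0<..}) (\<lambda>(t, y). source2 X t y)"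
proof -
  have s: "continuous_on ({0<..} \<times> {0<..}) (\<lambda>p. g (snd p))" if "continuous_on {0<..} g" for g :: "real \<Rightarrow> real"
    by (rule continuous_on_compose2[OF that]) (auto intro!: continuous_intros)
  have s': "continuous_on ({0<..} \<times> {0<..}) (\<lambda>p. g (snd p))" if "continuous_on {0..} g" for g :: "real \<Rightarrow> real"
    by (rule s[OF continuous_on_subset[OF that]]) auto
  have sp: "continuous_on ({0<..} \<times> {0<..}) (\<lambda>p :: real \<times> real. speed X (fst p))"
    by (rule continuous_on_compose2[OF speed_continuous[of UNIV]]) (auto intro!: continuous_intros)
  have "continuous_on ({0<..} \<times> {0..}) (\<lambda>(t, y). I_op \<alpha> (\<lambda>t y. f2 y + u2 X t y) t y)"
    by (rule continuous_on_I_op[OF pos(4) radiation_argument(1)]) (use radiation_argument(3) X in auto)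
  then have I: "continuous_on ({0<..} \<times> {0<..}) (\<lambda>p. I_op \<alpha> (\<lambda>t y. f2 y + u2 X t y) (fst p) (snd p))"
    unfolding case_prod_unfold by (rule continuous_on_subset) auto
  show "continuous_on ({0<..} \<times> {0<..}) (\<lambda>(t, y). source1 X t y)" "continuous_on ({0<..} \<times> {0<..}) (\<lambda>(t, y). source2 X t y)"
    unfolding source1_def source2_def case_prod_unfold
    by (intro continuous_intros s s' sp I cont_f' cont_f'' component_continuous)+
qed

lemma source_bound:
  assumes X: "norm X \<le> 1" and y: "y > 0"
  shows "\<bar>source1 X t y\<bar> \<le> \<Lambda>" "\<bar>source2 X t y\<bar> \<le> \<Lambda>"
proof -
  have 1: "\<bar>f1' y + p1 X t y\<bar> \<le> A + 1" "\<bar>f2' y + p2 X t y\<bar> \<le> A + 1"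
    using bound_f'[of y] component_bounds(2,4)[of X t y] X y by auto
  have 2: "\<bar>speed X t * (f1' y + p1 X t y)\<bar> \<le> \<Sigma> * (A + 1)" "\<bar>speed X t * (f2' y + p2 X t y)\<bar> \<le> \<Sigma> * (A + 1)"
    unfolding abs_mult using 1 speed_bound[OF X] \<Sigma>0 by (intro mult_mono; auto)+
  have 3: "\<bar>I_op \<alpha> (\<lambda>t y. f2 y + u2 X t y) t y\<bar> \<le> 8 * (A + 1) ^ 4"
    by (rule I_op_bound[OF pos(4) radiation_argument(2)]) (use radiation_argument(3) X y in auto)
  have "\<bar>\<kappa> * f1'' y\<bar> \<le> \<kappa> * A" using bound_f''(1)[OF y] pos by (simp add: abs_mult)
  then show "\<bar>source1 X t y\<bar> \<le> \<Lambda>" using 2(1) \<Lambda>_ge(1) unfolding source1_def by linarith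
  show "\<bar>source2 X t y\<bar> \<le> \<Lambda>" using 2(2) 3 bound_f''(2)[OF y] \<Lambda>_ge(2) unfolding source2_def by linarith
qed

lemma source_lipschitz:
  assumes X: "norm X \<le> 1" and Y: "norm Y \<le> 1" and y: "y > 0"
  shows "\<bar>source1 X t y - source1 Y t y\<bar> \<le> \<Lambda> * dist X Y" "\<bar>source2 X t y - source2 Y t y\<bar> \<le> \<Lambda> * dist X Y"
proof -
  have 1: "\<bar>f1' y + p1 X t y\<bar> \<le> A + 1" "\<bar>f2' y + p2 X t y\<bar> \<le> A + 1"
    using bound_f'[of y] component_bounds(2,4)[of X t y] X y by auto
  have 2: "\<bar>speed X t * (g + a) - speed Y t * (g + b)\<bar> \<le> 2 * \<Sigma> * dist X Y"
    if "\<bar>g + a\<bar> \<le> A + 1" "\<bar>a - b\<bar> \<le> dist X Y" for g a b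
  proof -
    have "speed X t * (g + a) - speed Y t * (g + b) = (speed X t - speed Y t) * (g + a) + speed Y t * (a - b)"
      by (simp add: algebra_simps)
    moreover have "\<bar>(speed X t - speed Y t) * (g + a)\<bar> \<le> ((1 + K) / L * dist X Y) * (A + 1)"
      unfolding abs_mult using speed_lipschitz that(1) pos by (intro mult_mono) auto
    moreover have "\<bar>speed Y t * (a - b)\<bar> \<le> \<Sigma> * dist X Y"
      unfolding abs_mult using speed_bound[OF Y] that(2) \<Sigma>0 by (intro mult_mono) auto
    moreover have "((1 + K) / L * dist X Y) * (A + 1) = \<Sigma> * dist X Y" by (simp add: \<Sigma>_def)
    ultimately show ?thesis by linarith
  qed
  have d: "\<bar>p1 X t y - p1 Y t y\<bar> \<le> dist X Y" "\<bar>p2 X t y - p2 Y t y\<bar> \<le> dist X Y" "\<And>t y. \<bar>u2 X t y - u2 Y t y\<bar> \<le> dist X Y"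
    unfolding component_diff dist_norm by (rule component_bounds)+
  note \<Lambda>d = mult_right_mono[OF \<Lambda>_ge(3), of "dist X Y"] mult_right_mono[OF \<Lambda>_ge(4), of "dist X Y"]
  show "\<bar>source1 X t y - source1 Y t y\<bar> \<le> \<Lambda> * dist X Y"
    using 2[OF 1(1) d(1)] \<Lambda>d(1) unfolding source1_def by simp
  have "\<bar>I_op \<alpha> (\<lambda>t y. f2 y + u2 X t y) t y - I_op \<alpha> (\<lambda>t y. f2 y + u2 Y t y) t y\<bar> \<le> 8 * (A + 1) ^ 3 * dist X Y"
    by (rule I_op_lipschitz[OF pos(4) radiation_argument(2) radiation_argument(2)]) (use radiation_argument(3) X Y y d(3) in auto)
  then show "\<bar>source2 X t y - source2 Y t y\<bar> \<le> \<Lambda> * dist X Y"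
    using 2[OF 1(2) d(2)] \<Lambda>d(2) unfolding source2_def distrib_right by simp
qed

definition update where
  "update \<tau> X p = (heat_potential \<kappa> \<tau> (odd_extension (source1 X)) (fst p) (snd p),
     heat_potential_dy \<kappa> \<tau> (odd_extension (source1 X)) (fst p) (snd p),
     heat_potential 1 \<tau> (odd_extension (source2 X)) (fst p) (snd p),
     heat_potential_dy 1 \<tau> (odd_extension (source2 X)) (fst p) (snd p))"

text \<open>
The sum of the bounds for the operator norms of the two potentials and their gradients over the time \<open>\<tau>\<close>.
\<close>

definition gain where "gain \<tau> = \<tau> + 2 * sqrt \<tau> / sqrt (2 * \<kappa>) + \<tau> + 2 * sqrt \<tau> / sqrt (2 * 1)"

lemma heat_sources:
  assumes "\<tau> > 0" "norm X \<le> 1"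
  shows "heat_source \<kappa> \<tau> \<Lambda> (odd_extension (source1 X))" "heat_source 1 \<tau> \<Lambda> (odd_extension (source2 X))"
  using assms pos \<Lambda>0 source_bound source_continuous by (auto intro!: heat_source_odd_extension)

lemma norm4_le: "norm (a, b, c, d) \<le> \<bar>a\<bar> + \<bar>b\<bar> + \<bar>c\<bar> + \<bar>d\<bar>" for a b c d :: real
  using norm_Pair_le[of a "(b, c, d)"] norm_Pair_le[of b "(c, d)"] norm_Pair_le[of c d] by simp

lemma update_norm:
  assumes "heat_source \<kappa> \<tau> B F1" "heat_source 1 \<tau> B F2"
  shows "norm (heat_potential \<kappa> \<tau> F1 t y, heat_potential_dy \<kappa> \<tau> F1 t y,
     heat_potential 1 \<tau> F2 t y, heat_potential_dy 1 \<tau> F2 t y) \<le> B * gain \<tau>"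
  using norm4_le[of "heat_potential \<kappa> \<tau> F1 t y" "heat_potential_dy \<kappa> \<tau> F1 t y"
     "heat_potential 1 \<tau> F2 t y" "heat_potential_dy 1 \<tau> F2 t y"]
    heat_source.val_bound[OF assms(1), of t y] heat_source.grad_bound[OF assms(1), of t y]
    heat_source.val_bound[OF assms(2), of t y] heat_source.grad_bound[OF assms(2), of t y]
  unfolding gain_def distrib_left by linarith

lemma update_bcontfun:
  assumes "\<tau> > 0" "norm X \<le> 1"
  shows "update \<tau> X \<in> bcontfun"
proof -
  interpret H1: heat_source \<kappa> \<tau> \<Lambda> "odd_extension (source1 X)" by (rule heat_sources[OF assms])
  interpret H2: heat_source 1 \<tau> \<Lambda> "odd_extension (source2 X)" by (rule heat_sources[OF assms])
  have "continuous_on UNIV (update \<tau> X)"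
    unfolding update_def[abs_def]
    by (intro continuous_on_Pair H1.continuous_on_val H1.continuous_on_grad H2.continuous_on_val H2.continuous_on_grad)
  moreover have "bounded (range (update \<tau> X))"
    unfolding bounded_iff update_def using update_norm[OF heat_sources[OF assms]] by blast
  ultimately show ?thesis by (simp add: bcontfun_def)
qed

lemma apply_update: "\<tau> > 0 \<Longrightarrow> norm X \<le> 1 \<Longrightarrow> apply_bcontfun (Bcontfun (update \<tau> X)) = update \<tau> X"
  by (rule Bcontfun_inverse[OF update_bcontfun])

lemma fixed_point_exists:
  assumes \<tau>: "\<tau> > 0" and small: "\<Lambda> * gain \<tau> \<le> 1 / 2"
  obtains X :: state where "norm X \<le> 1" "\<And>p. apply_bcontfun X p = update \<tau> X p"
proof -
  let ?\<Phi> = "\<lambda>X. Bcontfun (update \<tau> X)"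
  have "\<exists>!X\<in>cball 0 1. ?\<Phi> X = X"
  proof (rule Banach_fix[where c="1 / 2"])
    show "complete (cball (0 :: state) 1)" using complete_eq_closed by blast
    show "?\<Phi> ` cball 0 1 \<subseteq> cball 0 1"
    proof (rule image_subsetI)
      fix X :: state assume "X \<in> cball 0 1"
      then have X: "norm X \<le> 1" by simp
      have "norm (?\<Phi> X) \<le> \<Lambda> * gain \<tau>"
        by (rule norm_bound) (unfold apply_update[OF \<tau> X] update_def, rule update_norm[OF heat_sources[OF \<tau> X]])
      with small show "?\<Phi> X \<in> cball 0 1" by simp
    qed
    show "dist (?\<Phi> X) (?\<Phi> Y) \<le> 1 / 2 * dist X Y" if "X \<in> cball 0 1" "Y \<in> cball 0 1" for X Y
    proof -
      from that
      have X: "norm X \<le> 1" and Y: "norm Y \<le> 1" by auto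
      note HX = heat_sources[OF \<tau> X] and HY = heat_sources[OF \<tau> Y]
      have k: "integrable lborel (value_kernel \<tau>)" "integrable lborel (gradient_kernel \<kappa> \<tau>)" "integrable lborel (gradient_kernel 1 \<tau>)"
        using integrable_value_kernel integrable_gradient_kernel \<tau> pos by auto
      have H: "heat_source \<kappa> \<tau> (\<Lambda> * dist X Y) (odd_extension (\<lambda>t y. source1 X t y - source1 Y t y))"
        "heat_source 1 \<tau> (\<Lambda> * dist X Y) (odd_extension (\<lambda>t y. source2 X t y - source2 Y t y))"
        using \<tau> pos \<Lambda>0 source_lipschitz[OF X Y] source_continuous[OF X] source_continuous[OF Y]
        by (auto intro!: heat_source_odd_extension continuous_on_diff simp: case_prod_unfold)
      have "dist (?\<Phi> X) (?\<Phi> Y) \<le> \<Lambda> * dist X Y * gain \<tau>"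
      proof (rule dist_bound)
        fix p
        show "dist (apply_bcontfun (?\<Phi> X) p) (apply_bcontfun (?\<Phi> Y) p) \<le> \<Lambda> * dist X Y * gain \<tau>"
          unfolding apply_update[OF \<tau> X] apply_update[OF \<tau> Y] update_def dist_norm diff_Pair
            heat_convolution_diff[OF HX(1) HY(1) k(1)] heat_convolution_diff[OF HX(1) HY(1) k(2)]
            heat_convolution_diff[OF HX(2) HY(2) k(1)] heat_convolution_diff[OF HX(2) HY(2) k(3)] odd_extension_diff
          using update_norm[OF H] by (simp add: dist_norm)
      qed
      also have "\<dots> = (\<Lambda> * gain \<tau>) * dist X Y" by simp
      also have "\<dots> \<le> 1 / 2 * dist X Y" using small by (intro mult_right_mono) auto
      finally show "dist (?\<Phi> X) (?\<Phi> Y) \<le> 1 / 2 * dist X Y" .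
    qed
  qed auto
  then obtain X where X: "X \<in> cball 0 1" "?\<Phi> X = X" by blast
  then have "norm X \<le> 1" by simp
  with X(2) apply_update[OF \<tau> this] show ?thesis by (intro that[of X]) auto
qed

text \<open>
The second derivatives of the profiles cancel between the stationary equations and the sources.
\<close>

lemma half_line_solution:
  assumes \<tau>: "\<tau> > 0" and X: "norm X \<le> 1" and fixed: "\<And>p. apply_bcontfun X p = update \<tau> X p"
  shows "half_line_stefan \<kappa> K L \<alpha> TM \<tau> (A + 1) f1 f2 (\<lambda>t y. f1 y + u1 X t y) (\<lambda>t y. f1' y + p1 X t y)
     (\<lambda>t y. f2 y + u2 X t y) (\<lambda>t y. f2' y + p2 X t y)"
proof -
  interpret H1: heat_source \<kappa> \<tau> \<Lambda> "odd_extension (source1 X)" by (rule heat_sources[OF \<tau> X])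
  interpret H2: heat_source 1 \<tau> \<Lambda> "odd_extension (source2 X)" by (rule heat_sources[OF \<tau> X])
  have eq: "u1 X = H1.val" "p1 X = H1.grad" "u2 X = H2.val" "p2 X = H2.grad"
    unfolding u1_def[abs_def] p1_def[abs_def] u2_def[abs_def] p2_def[abs_def] fixed update_def by simp_all
  have Q: "open (half_cylinder \<tau>)" by (intro open_Times) auto
  have s: "continuous_on ({0..\<tau>} \<times> {0..}) (\<lambda>p. g (snd p))" if "continuous_on {0..} g" for g :: "real \<Rightarrow> real"
    by (rule continuous_on_compose2[OF that]) (auto intro!: continuous_intros)
  have q: "continuous_on (half_cylinder \<tau>) (\<lambda>(t, y). g y)" if "continuous_on {0<..} g" for g :: "real \<Rightarrow> real"
    unfolding case_prod_unfold by (rule continuous_on_compose2[OF that]) (auto intro!: continuous_intros)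
  have q': "continuous_on (half_cylinder \<tau>) (\<lambda>(t, y). g y)" if "continuous_on {0..} g" for g :: "real \<Rightarrow> real"
    by (rule q[OF continuous_on_subset[OF that]]) auto
  have src: "continuous_on (half_cylinder \<tau>) (\<lambda>(t, y). odd_extension g t y)"
    if "continuous_on ({0<..} \<times> {0<..}) (\<lambda>(t, y). g t y)" for g
    by (rule continuous_on_eq[OF continuous_on_subset[OF that]]) (auto simp: odd_extension_def)
  have cu: "continuous_on (half_cylinder \<tau>) (\<lambda>(t, y). u1 X t y)" "continuous_on (half_cylinder \<tau>) (\<lambda>(t, y). u2 X t y)"
    using component_continuous by (auto simp: case_prod_unfold)
  have W1: "weak_heat (half_cylinder \<tau>) \<kappa> (\<lambda>t y. f1 y + u1 X t y) (\<lambda>t y. - (\<kappa> * f1'' y) + odd_extension (source1 X) t y)"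
  proof (rule weak_heat_add[OF Q])
    show "weak_heat (half_cylinder \<tau>) \<kappa> (\<lambda>t. f1) (\<lambda>t y. - (\<kappa> * f1'' y))"
      by (rule weak_heat_stationary[OF Q q'[OF cont_f(1)] q'[OF cont_f'(1)] q[OF cont_f''(1)]]) (use deriv_f deriv_f' in auto)
    show "weak_heat (half_cylinder \<tau>) \<kappa> (u1 X) (odd_extension (source1 X))" unfolding eq by (rule H1.weak_heat_val)
  qed (use q'[OF cont_f(1)] cu src[OF source_continuous(1)[OF X]] q[OF cont_f''(1)] in \<open>auto simp: case_prod_unfold intro!: continuous_intros\<close>)
  have W2: "weak_heat (half_cylinder \<tau>) 1 (\<lambda>t y. f2 y + u2 X t y) (\<lambda>t y. - (1 * f2'' y) + odd_extension (source2 X) t y)"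
  proof (rule weak_heat_add[OF Q])
    show "weak_heat (half_cylinder \<tau>) 1 (\<lambda>t. f2) (\<lambda>t y. - (1 * f2'' y))"
      by (rule weak_heat_stationary[OF Q q'[OF cont_f(2)] q'[OF cont_f'(2)] q[OF cont_f''(2)]]) (use deriv_f deriv_f' in auto)
    show "weak_heat (half_cylinder \<tau>) 1 (u2 X) (odd_extension (source2 X))" unfolding eq by (rule H2.weak_heat_val)
  qed (use q'[OF cont_f(2)] cu src[OF source_continuous(2)[OF X]] q[OF cont_f''(2)] in \<open>auto simp: case_prod_unfold intro!: continuous_intros\<close>)
  show ?thesis
  proof
    show "continuous_on ({0..\<tau>} \<times> {0..}) (\<lambda>(t, y). f1 y + u1 X t y)" "continuous_on ({0..\<tau>} \<times> {0..}) (\<lambda>(t, y). f2 y + u2 X t y)"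
      "continuous_on ({0..\<tau>} \<times> {0..}) (\<lambda>(t, y). f1' y + p1 X t y)" "continuous_on ({0..\<tau>} \<times> {0..}) (\<lambda>(t, y). f2' y + p2 X t y)"
      unfolding case_prod_unfold by (intro continuous_on_add s cont_f cont_f' component_continuous)+
    show "((\<lambda>y. f1 y + u1 X t y) has_real_derivative f1' y + p1 X t y) (at y)" if "y > 0" for t y
      unfolding eq by (intro DERIV_add deriv_f that H1.DERIV_val)
    show "((\<lambda>y. f2 y + u2 X t y) has_real_derivative f2' y + p2 X t y) (at y)" if "y > 0" for t y
      unfolding eq by (intro DERIV_add deriv_f that H2.DERIV_val)
    show "\<bar>f1 y + u1 X t y\<bar> \<le> A + 1" if "y \<ge> 0" for t y using bound_f(1)[OF that] component_bounds(1)[of X t y] X by auto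
    show "\<bar>f2 y + u2 X t y\<bar> \<le> A + 1" if "y \<ge> 0" for t y by (rule radiation_argument(3)[OF that X])
    show "f1 0 + u1 X t 0 = TM" "f2 0 + u2 X t 0 = TM" for t unfolding eq H1.val_boundary H2.val_boundary using boundary_f by auto
    show "f1 y + u1 X 0 y = f1 y" "f2 y + u2 X 0 y = f2 y" for y unfolding eq by (simp_all add: H1.val_initial H2.val_initial)
    show "weak_heat (half_cylinder \<tau>) \<kappa> (\<lambda>t y. f1 y + u1 X t y)
        (\<lambda>t y. - (interface_speed K L (\<lambda>t y. f1' y + p1 X t y) (\<lambda>t y. f2' y + p2 X t y) t * (f1' y + p1 X t y)))"
      by (rule weak_heat_cong[OF W1]) (auto simp: odd_extension_def source1_def speed_def)
    show "weak_heat (half_cylinder \<tau>) 1 (\<lambda>t y. f2 y + u2 X t y)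
        (\<lambda>t y. interface_speed K L (\<lambda>t y. f1' y + p1 X t y) (\<lambda>t y. f2' y + p2 X t y) t * (f2' y + p2 X t y) - I_op \<alpha> (\<lambda>t y. f2 y + u2 X t y) t y)"
      by (rule weak_heat_cong[OF W2]) (auto simp: odd_extension_def source2_def speed_def)
  qed (use pos \<tau> in auto)
qed

lemma gain_small: obtains \<tau>0 where "\<tau>0 > 0" "\<And>\<tau>. 0 < \<tau> \<Longrightarrow> \<tau> \<le> \<tau>0 \<Longrightarrow> \<Lambda> * gain \<tau> \<le> 1 / 2"
proof -
  have "((\<lambda>\<tau>. \<Lambda> * gain \<tau>) \<longlongrightarrow> \<Lambda> * (0 + 2 * sqrt 0 / sqrt (2 * \<kappa>) + 0 + 2 * sqrt 0 / sqrt (2 * 1))) (at_right 0)"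
    unfolding gain_def using pos by (intro tendsto_intros) auto
  then have "eventually (\<lambda>\<tau>. \<Lambda> * gain \<tau> < 1 / 2) (at_right 0)" by (rule order_tendstoD) simp
  then obtain b where "b > 0" "\<And>\<tau>. 0 < \<tau> \<Longrightarrow> \<tau> < b \<Longrightarrow> \<Lambda> * gain \<tau> < 1 / 2"
    unfolding eventually_at_right_field by auto
  then show ?thesis by (intro that[of "b / 2"]) (auto intro: less_imp_le)
qed

theorem local_existence:
  obtains \<tau>0 where "\<tau>0 > 0" "\<And>\<tau>. 0 < \<tau> \<Longrightarrow> \<tau> \<le> \<tau>0 \<Longrightarrow>
    \<exists>v1 d1 v2 d2. half_line_stefan \<kappa> K L \<alpha> TM \<tau> (A + 1) f1 f2 v1 d1 v2 d2 \<and> 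
      (\<forall>t. \<forall>y>0. \<bar>d1 t y\<bar> \<le> A + 1 \<and> \<bar>d2 t y\<bar> \<le> A + 1)"
proof -
  obtain \<tau>0 where \<tau>0: "\<tau>0 > 0" "\<And>\<tau>. 0 < \<tau> \<Longrightarrow> \<tau> \<le> \<tau>0 \<Longrightarrow> \<Lambda> * gain \<tau> \<le> 1 / 2" using gain_small by blast
  have "\<exists>v1 d1 v2 d2. half_line_stefan \<kappa> K L \<alpha> TM \<tau> (A + 1) f1 f2 v1 d1 v2 d2 \<and> 
      (\<forall>t. \<forall>y>0. \<bar>d1 t y\<bar> \<le> A + 1 \<and> \<bar>d2 t y\<bar> \<le> A + 1)" if \<tau>: "0 < \<tau>" "\<tau> \<le> \<tau>0" for \<tau>
  proof -
    obtain X where X: "norm X \<le> 1" "\<And>p. apply_bcontfun X p = update \<tau> X p"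
      using fixed_point_exists[OF \<tau>(1) \<tau>0(2)[OF \<tau>]] by blast
    have "\<bar>f1' y + p1 X t y\<bar> \<le> A + 1 \<and> \<bar>f2' y + p2 X t y\<bar> \<le> A + 1" if "y > 0" for t y
      using bound_f'[of y] component_bounds(2,4)[of X t y] X that by auto
    with half_line_solution[OF \<tau>(1) X] show ?thesis by blast
  qed
  with \<tau>0(1) show ?thesis using that by blast
qed

end

section \<open>Transfer between the free boundary problem and the half-line problem\<close>

lemma closure_cylinders:
  assumes "\<tau> > (0::real)"
  shows "closure ({0<..<\<tau>} \<times> {0::real<..}) = {0..\<tau>} \<times> {0..}" "closure ({0<..<\<tau>} \<times> {..<0::real}) = {0..\<tau>} \<times> {..0}"
  using assms by (simp_all add: closure_Times)

lemma reflect_cylinders: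
  "(\<lambda>(t, y). (t, - y)) ` ({0<..<\<tau>} \<times> {..<0::real}) = {0<..<\<tau>::real} \<times> {0<..}"
  "(\<lambda>(t, y). (t, - y)) ` ({0<..<\<tau>} \<times> {0::real<..}) = {0<..<\<tau>::real} \<times> {..<0}"
proof -
  have "(\<lambda>(t, y). (t, - y)) ` (A \<times> B) = A \<times> uminus ` B" for A B :: "real set" by force
  then show "(\<lambda>(t, y). (t, - y)) ` ({0<..<\<tau>} \<times> {..<0::real}) = {0<..<\<tau>::real} \<times> {0<..}"
    "(\<lambda>(t, y). (t, - y)) ` ({0<..<\<tau>} \<times> {0::real<..}) = {0<..<\<tau>::real} \<times> {..<0}" by simp_all
qed

lemma continuous_on_reflect:
  assumes "continuous_on (S \<times> {..0}) (\<lambda>(t, y). f t y)"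
  shows "continuous_on (S \<times> {0..}) (\<lambda>(t, y). f t (- y :: real))"
  unfolding case_prod_unfold
  by (rule continuous_on_compose2[OF assms, where f="\<lambda>p. (fst p, - snd p)", simplified case_prod_unfold fst_conv snd_conv])
    (auto intro!: continuous_intros)

lemma continuous_on_reflect':
  assumes "continuous_on (S \<times> {0..}) (\<lambda>(t, y). f t y)"
  shows "continuous_on (S \<times> {..0}) (\<lambda>(t, y). f t (- y :: real))"
  unfolding case_prod_unfold
  by (rule continuous_on_compose2[OF assms, where f="\<lambda>p. (fst p, - snd p)", simplified case_prod_unfold fst_conv snd_conv])
    (auto intro!: continuous_intros)

text \<open>
Stated for an arbitrary \<open>G\<close>, which later is the drift term of the moving frame.
\<close>

lemma stefan_equation1_iff:
  "(\<forall>\<phi> \<in> test_functions Q. distr_dt (distr_of Q T) \<phi> - distr_of Q G \<phi> = \<kappa> * distr_dy (distr_dy (distr_of Q T)) \<phi>)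
    \<longleftrightarrow> weak_heat Q \<kappa> T G"
  unfolding weak_heat_def distr_dt_def distr_dy_def by (auto simp: algebra_simps)

lemma stefan_equation2_iff:
  assumes "open Q" "continuous_on Q (\<lambda>(t, y). G t y)" "continuous_on Q (\<lambda>(t, y). I t y)"
  shows "(\<forall>\<phi> \<in> test_functions Q. distr_dt (distr_of Q T) \<phi> - distr_of Q G \<phi> = distr_dy (distr_dy (distr_of Q T)) \<phi> - distr_of Q I \<phi>)
    \<longleftrightarrow> weak_heat Q 1 T (\<lambda>t y. G t y - I t y)"
  unfolding weak_heat_def distr_dt_def distr_dy_def
proof (rule ball_cong[OF refl])
  fix \<phi> assume "\<phi> \<in> test_functions Q"
  from distr_of_diff[OF this assms]
  show "(- distr_of Q T (dt \<phi>) - distr_of Q G \<phi> = - (- distr_of Q T (dy (dy \<phi>))) - distr_of Q I \<phi>) \<longleftrightarrow>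
    (- distr_of Q T (dt \<phi>) - 1 * distr_of Q T (dy (dy \<phi>)) = distr_of Q (\<lambda>t y. G t y - I t y) \<phi>)"
    by linarith
qed

lemma C_ty_0_1_D:
  assumes "T \<in> C_ty 0 1 \<tau> U"
  shows "continuous_on (closure ({0<..<\<tau>} \<times> U)) (\<lambda>(t, y). T t y)"
    and "t \<in> {0<..<\<tau>} \<Longrightarrow> y \<in> U \<Longrightarrow> (T t has_real_derivative dy T t y) (at y)"
    and "continuous_up_to_boundary ({0<..<\<tau>} \<times> U) (dy T)"
proof -
  show "continuous_on (closure ({0<..<\<tau>} \<times> U)) (\<lambda>(t, y). T t y)" using assms by (simp add: C_ty_def)
  have "\<forall>l<1. \<forall>t\<in>{0<..<\<tau>}. \<forall>y\<in>U. (\<lambda>y'. (dy ^^ l) T t y') field_differentiable (at y)"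
    using assms unfolding C_ty_def by blast
  then have "t \<in> {0<..<\<tau>} \<Longrightarrow> y \<in> U \<Longrightarrow> (\<lambda>y'. T t y') field_differentiable (at y)" by fastforce
  then show "t \<in> {0<..<\<tau>} \<Longrightarrow> y \<in> U \<Longrightarrow> (T t has_real_derivative dy T t y) (at y)"
    unfolding dy_def by (simp add: field_differentiable_derivI)
  have "\<forall>l\<le>1. continuous_up_to_boundary ({0<..<\<tau>} \<times> U) ((dy ^^ l) T)" using assms unfolding C_ty_def by blast
  from this[rule_format, of 1] show "continuous_up_to_boundary ({0<..<\<tau>} \<times> U) (dy T)" by simp
qed

lemma C_ty_0_1_I:
  assumes "continuous_on (closure ({0<..<\<tau>} \<times> U)) (\<lambda>(t, y). T t y)"
    and "continuous_on (closure ({0<..<\<tau>} \<times> U)) (\<lambda>(t, y). d t y)"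
    and D: "\<And>t y. t \<in> {0<..<\<tau>} \<Longrightarrow> y \<in> U \<Longrightarrow> (T t has_real_derivative d t y) (at y)"
  shows "T \<in> C_ty 0 1 \<tau> U"
proof -
  have dyT: "dy T t y = d t y" if "t \<in> {0<..<\<tau>}" "y \<in> U" for t y
    unfolding dy_def by (rule DERIV_imp_deriv[OF D[OF that]])
  have 1: "continuous_up_to_boundary ({0<..<\<tau>} \<times> U) T"
    unfolding continuous_up_to_boundary_def using assms(1) by (intro exI[of _ "\<lambda>(t, y). T t y"]) auto
  have 2: "continuous_up_to_boundary ({0<..<\<tau>} \<times> U) (dy T)"
    unfolding continuous_up_to_boundary_def using assms(2) dyT by (intro exI[of _ "\<lambda>(t, y). d t y"]) auto
  have "continuous_up_to_boundary ({0<..<\<tau>} \<times> U) ((dy ^^ l) T)" if "l \<le> 1" for l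
    using that 1 2 by (cases l) auto
  moreover have "(\<lambda>y'. T t y') field_differentiable (at y)" if "t \<in> {0<..<\<tau>}" "y \<in> U" for t y
    using D[OF that] unfolding field_differentiable_def by blast
  ultimately show ?thesis unfolding C_ty_def using assms(1) 1 by auto
qed

lemma bounded_on_closure:
  fixes f :: "real \<Rightarrow> real \<Rightarrow> real"
  assumes "continuous_on (closure S) (\<lambda>(t, y). f t y)" "bounded ((\<lambda>(t, y). f t y) ` S)"
  obtains M :: real where "\<And>t y. (t, y) \<in> closure S \<Longrightarrow> \<bar>f t y\<bar> \<le> M"
proof -
  obtain M where M: "\<And>x. x \<in> (\<lambda>(t, y). f t y) ` S \<Longrightarrow> norm x \<le> M" using assms(2) unfolding bounded_iff by blast
  have "norm (case p of (t, y) \<Rightarrow> f t y) \<le> M" if "p \<in> closure S" for p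
    by (rule continuous_on_closure_norm_le[OF assms(1) _ that]) (use M in auto)
  then have "\<bar>f t y\<bar> \<le> M" if "(t, y) \<in> closure S" for t y using that by fastforce
  then show ?thesis by (rule that)
qed

text \<open>
The gradients supplied by the half-line problem are the continuous extensions of the classical ones, so their boundary values are the
one-sided limits in the Stefan condition. The initial value at the corner \<open>y = 0\<close> follows by continuity from those for \<open>y > 0\<close>.
\<close>

lemma solution_imp_half_line:
  assumes sol: "bounded_stefan_solution K C L \<alpha> TM T0 \<tau> T1 T2 s"
    and pos: "K > 0" "C > 0" "L > 0" "\<alpha> > 0" "\<tau> > 0"
    and T0: "continuous_on UNIV T0" "T0 0 = TM"
  obtains M d1 d2 where "half_line_stefan (K / C) K L \<alpha> TM \<tau> M (\<lambda>y. T0 (- y)) T0 (\<lambda>t y. T1 t (- y)) d1 T2 d2"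
    "\<And>t. t \<in> {0<..<\<tau>} \<Longrightarrow> (s has_real_derivative interface_speed K L d1 d2 t) (at t)"
    "continuous_on {0..<\<tau>} s" "s 0 = 0"
proof -
  let ?Q1 = "{0<..<\<tau>} \<times> {..<0::real}" and ?Q2 = "{0<..<\<tau>} \<times> {0::real<..}"
  note S = sol[unfolded bounded_stefan_solution_def Let_def]
  have T1: "T1 \<in> C_ty 0 1 \<tau> {..<0}" and T2: "T2 \<in> C_ty 0 1 \<tau> {0<..}" using S by auto
  have sdiff: "s C1_differentiable_on {0<..<\<tau>}" and s_cont: "continuous_on {0..<\<tau>} s" and s0: "s 0 = 0" using S by auto
  have bdd: "bounded ((\<lambda>(t, y). T1 t y) ` ?Q1)" "bounded ((\<lambda>(t, y). T2 t y) ` ?Q2)" using S by auto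
  have eq1: "\<forall>\<phi> \<in> test_functions ?Q1. distr_dt (distr_of ?Q1 T1) \<phi> - distr_of ?Q1 (\<lambda>t y. deriv s t * dy T1 t y) \<phi>
            = K / C * distr_dy (distr_dy (distr_of ?Q1 T1)) \<phi>" using S by blast
  have eq2: "\<forall>\<phi> \<in> test_functions ?Q2. distr_dt (distr_of ?Q2 T2) \<phi> - distr_of ?Q2 (\<lambda>t y. deriv s t * dy T2 t y) \<phi>
            = distr_dy (distr_dy (distr_of ?Q2 T2)) \<phi> - distr_of ?Q2 (I_op \<alpha> T2) \<phi>" using S by blast
  have bdry: "\<forall>t\<in>{0<..<\<tau>}. T1 t 0 = TM \<and> T2 t 0 = TM" and init: "\<forall>y<0. T1 0 y = T0 y" "\<forall>y>0. T2 0 y = T0 y" using S by auto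
  have stefan: "\<forall>t\<in>{0<..<\<tau>}. deriv s t = 1 / L * (Lim (at_right 0) (\<lambda>y. dy T2 t y) - K * Lim (at_left 0) (\<lambda>y. dy T1 t y))"
    using S by blast
  note cl = closure_cylinders[OF pos(5)]
  obtain g1 where g1: "continuous_on ({0..\<tau>} \<times> {..0}) g1" "\<And>t y. t \<in> {0<..<\<tau>} \<Longrightarrow> y < 0 \<Longrightarrow> g1 (t, y) = dy T1 t y"
    using C_ty_0_1_D(3)[OF T1] unfolding continuous_up_to_boundary_def cl by fastforce
  obtain g2 where g2: "continuous_on ({0..\<tau>} \<times> {0..}) g2" "\<And>t y. t \<in> {0<..<\<tau>} \<Longrightarrow> y > 0 \<Longrightarrow> g2 (t, y) = dy T2 t y"
    using C_ty_0_1_D(3)[OF T2] unfolding continuous_up_to_boundary_def cl by fastforce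
  define d1 where "d1 = (\<lambda>t y. - g1 (t, - y))"
  define d2 where "d2 = (\<lambda>t y. g2 (t, y))"
  note c1 = C_ty_0_1_D(1)[OF T1, unfolded cl] and c2 = C_ty_0_1_D(1)[OF T2, unfolded cl]
  obtain M1 where M1: "\<And>t y. t \<in> {0..\<tau>} \<Longrightarrow> y \<le> 0 \<Longrightarrow> \<bar>T1 t y\<bar> \<le> M1"
  proof -
    obtain M where "\<And>t y. (t, y) \<in> closure ?Q1 \<Longrightarrow> \<bar>T1 t y\<bar> \<le> M"
      using bounded_on_closure[OF C_ty_0_1_D(1)[OF T1] bdd(1)] by blast
    then show ?thesis unfolding cl by (intro that[of M]) auto
  qed
  obtain M2 where M2: "\<And>t y. t \<in> {0..\<tau>} \<Longrightarrow> y \<ge> 0 \<Longrightarrow> \<bar>T2 t y\<bar> \<le> M2"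
  proof -
    obtain M where "\<And>t y. (t, y) \<in> closure ?Q2 \<Longrightarrow> \<bar>T2 t y\<bar> \<le> M"
      using bounded_on_closure[OF C_ty_0_1_D(1)[OF T2] bdd(2)] by blast
    then show ?thesis unfolding cl by (intro that[of M]) auto
  qed
  define M where "M = max M1 M2"
  have cd1: "continuous_on ({0..\<tau>} \<times> {0..}) (\<lambda>(t, y). d1 t y)"
    using continuous_on_minus[OF continuous_on_reflect[of "{0..\<tau>}" "\<lambda>t y. g1 (t, y)"]] g1(1)
    by (simp add: d1_def case_prod_unfold)
  have cd2: "continuous_on ({0..\<tau>} \<times> {0..}) (\<lambda>(t, y). d2 t y)" using g2(1) by (simp add: d2_def case_prod_unfold)
  have speed: "deriv s t = interface_speed K L d1 d2 t" if t: "t \<in> {0<..<\<tau>}" for t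
  proof -
    have "((\<lambda>y. g2 (t, y)) \<longlongrightarrow> g2 (t, 0)) (at_right 0)" "((\<lambda>y. g1 (t, y)) \<longlongrightarrow> g1 (t, 0)) (at_left 0)"
      using tendsto_at_boundary(1)[of t "{0..\<tau>}" "\<lambda>t y. g2 (t, y)"] tendsto_at_boundary(2)[of t "{0..\<tau>}" "\<lambda>t y. g1 (t, y)"] g1(1) g2(1) t
      by (auto simp: case_prod_unfold)
    then have "((\<lambda>y. dy T2 t y) \<longlongrightarrow> g2 (t, 0)) (at_right 0)" "((\<lambda>y. dy T1 t y) \<longlongrightarrow> g1 (t, 0)) (at_left 0)"
      using g1(2)[OF t] g2(2)[OF t] by (auto elim!: Lim_transform_eventually simp: eventually_at_filter)
    then have "Lim (at_right 0) (\<lambda>y. dy T2 t y) = g2 (t, 0)" "Lim (at_left 0) (\<lambda>y. dy T1 t y) = g1 (t, 0)"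
      by (auto intro!: tendsto_Lim)
    then show ?thesis using stefan t by (simp add: interface_speed_def d1_def d2_def)
  qed
  have Ds: "(s has_real_derivative interface_speed K L d1 d2 t) (at t)" if t: "t \<in> {0<..<\<tau>}" for t
  proof -
    have "s differentiable (at t)"
      using sdiff t unfolding C1_differentiable_on_def by (auto intro: differentiableI_vector)
    then have "(s has_real_derivative deriv s t) (at t)" by (simp add: DERIV_deriv_iff_real_differentiable)
    then show ?thesis by (simp add: speed[OF t])
  qed
  have zero: "T1 0 0 = TM" "T2 0 0 = TM"
  proof -
    have "(T2 0 \<longlongrightarrow> T2 0 0) (at_right 0)" "(T1 0 \<longlongrightarrow> T1 0 0) (at_left 0)"
      by (rule tendsto_at_boundary(1)[OF _ c2] tendsto_at_boundary(2)[OF _ c1], use pos in simp)+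
    then have l: "(T0 \<longlongrightarrow> T2 0 0) (at_right 0)" "(T0 \<longlongrightarrow> T1 0 0) (at_left 0)"
      using init by (auto elim!: Lim_transform_eventually simp: eventually_at_filter)
    have "(T0 \<longlongrightarrow> T0 0) (at 0)" using T0(1) by (simp add: continuous_on_def)
    then have "(T0 \<longlongrightarrow> TM) (at_right 0)" "(T0 \<longlongrightarrow> TM) (at_left 0)" using T0(2) by (auto elim: tendsto_within_subset)
    with l show "T1 0 0 = TM" "T2 0 0 = TM"
      using tendsto_unique[OF trivial_limit_at_left_real] tendsto_unique[OF trivial_limit_at_right_real] by blast+
  qed
  have bdry': "T1 t 0 = TM" "T2 t 0 = TM" if "t \<in> {0..<\<tau>}" for t
    using bdry zero that by (cases "t = 0"; auto)+
  have sub1: "?Q1 \<subseteq> {0..\<tau>} \<times> {..0}" and sub2: "?Q2 \<subseteq> {0..\<tau>} \<times> {0..}" by auto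
  have o: "open ?Q1" "open ?Q2" by (intro open_Times; simp)+
  have csp: "continuous_on {0..\<tau>} (interface_speed K L d1 d2)"
    by (rule continuous_on_interface_speed[OF pos(3) cd1 cd2])
  have cspQ: "continuous_on ({0<..<\<tau>} \<times> U) (\<lambda>p. interface_speed K L d1 d2 (fst p))" for U :: "real set"
    by (rule continuous_on_compose2[OF csp]) (auto intro!: continuous_intros)
  have cG1: "continuous_on ?Q1 (\<lambda>(t, y). deriv s t * dy T1 t y)"
  proof (rule continuous_on_eq[where f="\<lambda>p. interface_speed K L d1 d2 (fst p) * g1 p"])
    show "continuous_on ?Q1 (\<lambda>p. interface_speed K L d1 d2 (fst p) * g1 p)"
      by (intro continuous_on_mult cspQ continuous_on_subset[OF g1(1) sub1])
  qed (use g1(2) speed in auto)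
  have cG2: "continuous_on ?Q2 (\<lambda>(t, y). deriv s t * dy T2 t y)"
  proof (rule continuous_on_eq[where f="\<lambda>p. interface_speed K L d1 d2 (fst p) * g2 p"])
    show "continuous_on ?Q2 (\<lambda>p. interface_speed K L d1 d2 (fst p) * g2 p)"
      by (intro continuous_on_mult cspQ continuous_on_subset[OF g2(1) sub2])
  qed (use g2(2) speed in auto)
  have "continuous_on ({0<..<\<tau>} \<times> {0..}) (\<lambda>(t, y). I_op \<alpha> T2 t y)"
    by (rule continuous_on_I_op[OF pos(4) continuous_on_subset[OF c2], where M=M2]) (use M2 in auto)
  then have cI: "continuous_on ?Q2 (\<lambda>(t, y). I_op \<alpha> T2 t y)" by (rule continuous_on_subset) auto
  have W1: "weak_heat ?Q2 (K / C) (\<lambda>t y. T1 t (- y)) (\<lambda>t y. deriv s t * dy T1 t (- y))"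
    using weak_heat_reflect[OF o(1) eq1[unfolded stefan_equation1_iff] continuous_on_subset[OF c1 sub1] cG1]
    unfolding reflect_cylinders .
  have W2: "weak_heat ?Q2 1 T2 (\<lambda>t y. deriv s t * dy T2 t y - I_op \<alpha> T2 t y)"
    using eq2 unfolding stefan_equation2_iff[OF o(2) cG2 cI] .
  have "half_line_stefan (K / C) K L \<alpha> TM \<tau> M (\<lambda>y. T0 (- y)) T0 (\<lambda>t y. T1 t (- y)) d1 T2 d2"
  proof
    show "((\<lambda>y. T1 t (- y)) has_real_derivative d1 t y) (at y)" if "t \<in> {0<..<\<tau>}" "y > 0" for t y
    proof -
      have "((\<lambda>y. T1 t (- y)) has_real_derivative dy T1 t (- y) * - 1) (at y)"
        by (rule DERIV_chain2[of "T1 t", OF C_ty_0_1_D(2)[OF T1]]) (use that in \<open>auto intro!: derivative_eq_intros\<close>)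
      then show ?thesis using g1(2)[of t "- y"] that by (simp add: d1_def)
    qed
    show "(T2 t has_real_derivative d2 t y) (at y)" if "t \<in> {0<..<\<tau>}" "y > 0" for t y
      using C_ty_0_1_D(2)[OF T2] g2(2) that by (simp add: d2_def)
    show "\<bar>T1 t (- y)\<bar> \<le> M" if "t \<in> {0..<\<tau>}" "y \<ge> 0" for t y using M1[of t "- y"] that by (auto simp: M_def)
    show "\<bar>T2 t y\<bar> \<le> M" if "t \<in> {0..<\<tau>}" "y \<ge> 0" for t y using M2[of t y] that by (auto simp: M_def)
    show "T1 0 (- y) = T0 (- y)" if "y \<ge> 0" for y using init(1) zero T0(2) that by (cases "y = 0") auto
    show "T2 0 y = T0 y" if "y \<ge> 0" for y using init(2) zero T0(2) that by (cases "y = 0") auto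
    show "weak_heat ?Q2 (K / C) (\<lambda>t y. T1 t (- y)) (\<lambda>t y. - (interface_speed K L d1 d2 t * d1 t y))"
      by (rule weak_heat_cong[OF W1]) (use speed g1(2) in \<open>auto simp: d1_def\<close>)
    show "weak_heat ?Q2 1 T2 (\<lambda>t y. interface_speed K L d1 d2 t * d2 t y - I_op \<alpha> T2 t y)"
      by (rule weak_heat_cong[OF W2]) (use speed g2(2) in \<open>auto simp: d2_def\<close>)
  qed (use pos bdry' cd1 cd2 c2 continuous_on_reflect[OF c1] in auto)
  then show ?thesis using Ds s_cont s0 by (rule that)
qed

context half_line_stefan
begin

definition interface where "interface t = integral {0..t} speed"

lemma DERIV_interface: "t \<in> {0<..<\<tau>} \<Longrightarrow> (interface has_real_derivative speed t) (at t)"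
  using integral_has_real_derivative[OF cont_speed, of t] unfolding interface_def[abs_def]
  by (simp add: at_within_Icc_at)

lemma continuous_interface: "continuous_on {0..\<tau>} interface"
  unfolding interface_def[abs_def] by (rule indefinite_integral_continuous_1[OF integrable_continuous_real[OF cont_speed]])

lemma interface_0: "interface 0 = 0" by (simp add: interface_def)

lemma stefan_solution:
  assumes f: "\<And>y. y \<ge> 0 \<Longrightarrow> f1 y = T0 (- y)" "\<And>y. y \<ge> 0 \<Longrightarrow> f2 y = T0 y" and \<kappa>: "\<kappa> = K / C"
  shows "bounded_stefan_solution K C L \<alpha> TM T0 \<tau> (\<lambda>t y. v1 t (- y)) v2 interface"
proof -
  let ?Q1 = "{0<..<\<tau>} \<times> {..<0::real}" and ?Q2 = "{0<..<\<tau>} \<times> {0::real<..}"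
  note cl = closure_cylinders[OF pos(5)]
  have sub2: "?Q2 \<subseteq> {0..\<tau>} \<times> {0..}" by auto
  have D1: "((\<lambda>y. v1 t (- y)) has_real_derivative - d1 t (- y)) (at y)" if "t \<in> {0<..<\<tau>}" "y < 0" for t y
  proof -
    have "((\<lambda>y. v1 t (- y)) has_real_derivative d1 t (- y) * - 1) (at y)"
      by (rule DERIV_chain2[of "v1 t", OF deriv_v(1)]) (use that in \<open>auto intro!: derivative_eq_intros\<close>)
    then show ?thesis by simp
  qed
  have dy1: "dy (\<lambda>t y. v1 t (- y)) t y = - d1 t (- y)" if "t \<in> {0<..<\<tau>}" "y < 0" for t y
    unfolding dy_def by (rule DERIV_imp_deriv[OF D1[OF that]])
  have dy2: "dy v2 t y = d2 t y" if "t \<in> {0<..<\<tau>}" "y > 0" for t y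
    unfolding dy_def by (rule DERIV_imp_deriv[OF deriv_v(2)[OF that]])
  have ds: "deriv interface t = speed t" if "t \<in> {0<..<\<tau>}" for t by (rule DERIV_imp_deriv[OF DERIV_interface[OF that]])
  have T1: "(\<lambda>t y. v1 t (- y)) \<in> C_ty 0 1 \<tau> {..<0}"
  proof (rule C_ty_0_1_I[where d="\<lambda>t y. - d1 t (- y)"])
    show "continuous_on (closure ?Q1) (\<lambda>(t, y). - d1 t (- y))"
      unfolding cl using continuous_on_minus[OF continuous_on_reflect'[OF cont_d(1)]] by (simp add: case_prod_unfold)
  qed (use D1 continuous_on_reflect'[OF cont_v(1)] cl in auto)
  have T2: "v2 \<in> C_ty 0 1 \<tau> {0<..}"
    by (rule C_ty_0_1_I[where d=d2]) (use deriv_v cont_v cont_d cl in auto)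
  have L2: "Lim (at_right 0) (\<lambda>y. dy v2 t y) = d2 t 0" if t: "t \<in> {0<..<\<tau>}" for t
  proof (rule tendsto_Lim)
    show "((\<lambda>y. dy v2 t y) \<longlongrightarrow> d2 t 0) (at_right 0)"
      by (rule Lim_transform_eventually[OF tendsto_at_boundary(1)[OF _ cont_d(2)]]) (use dy2 t in \<open>auto simp: eventually_at_filter\<close>)
  qed simp
  have L1: "Lim (at_left 0) (\<lambda>y. dy (\<lambda>t y. v1 t (- y)) t y) = - d1 t 0" if t: "t \<in> {0<..<\<tau>}" for t
  proof (rule tendsto_Lim)
    have "((\<lambda>y. - d1 t (- y)) \<longlongrightarrow> - d1 t 0) (at_left 0)"
      using tendsto_at_boundary(1)[OF _ cont_d(1), of t] t by (intro tendsto_minus) (simp add: at_left_minus filterlim_filtermap)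
    then show "((\<lambda>y. dy (\<lambda>t y. v1 t (- y)) t y) \<longlongrightarrow> - d1 t 0) (at_left 0)"
      by (rule Lim_transform_eventually) (use dy1 t in \<open>auto simp: eventually_at_filter\<close>)
  qed simp
  have o: "open ?Q1" "open ?Q2" by (intro open_Times; simp)+
  have cI: "continuous_on ?Q2 (\<lambda>(t, y). I_op \<alpha> v2 t y)"
  proof -
    have "continuous_on ({0<..<\<tau>} \<times> {0..}) (\<lambda>(t, y). I_op \<alpha> v2 t y)"
      by (rule continuous_on_I_op[OF pos(4) continuous_on_subset[OF cont_v(2)], where M=M]) (use bounded_v in auto)
    then show ?thesis by (rule continuous_on_subset) auto
  qed
  have cG2: "continuous_on ?Q2 (\<lambda>(t, y). deriv interface t * dy v2 t y)"
  proof (rule continuous_on_eq[where f="\<lambda>p. speed (fst p) * d2 (fst p) (snd p)"])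
    show "continuous_on ?Q2 (\<lambda>p. speed (fst p) * d2 (fst p) (snd p))"
      using continuous_on_subset[OF cont_d(2) sub2] cont_speed_cylinder by (intro continuous_on_mult) (auto simp: case_prod_unfold)
  qed (use ds dy2 in auto)
  have E1: "weak_heat ?Q1 (K / C) (\<lambda>t y. v1 t (- y)) (\<lambda>t y. deriv interface t * dy (\<lambda>t y. v1 t (- y)) t y)"
    by (rule weak_heat_cong[OF weak_heat_reflect[OF open_cylinder weak1 continuous_on_subset[OF cont_v(1) sub2] cont_source(1), unfolded reflect_cylinders \<kappa>]])
      (use ds dy1 in auto)
  have E2: "weak_heat ?Q2 1 v2 (\<lambda>t y. deriv interface t * dy v2 t y - I_op \<alpha> v2 t y)"
    by (rule weak_heat_cong[OF weak2]) (use ds dy2 in auto)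
  have C1: "interface C1_differentiable_on {0<..<\<tau>}"
    unfolding C1_differentiable_on_def
    using DERIV_interface continuous_on_subset[OF cont_speed, of "{0<..<\<tau>}"] greaterThanLessThan_subseteq_atLeastAtMost_iff[of 0 \<tau> 0 \<tau>]
    by (intro exI[of _ speed]) (auto simp: has_real_derivative_iff_has_vector_derivative)
  have Cs: "continuous_on {0..<\<tau>} interface" by (rule continuous_on_subset[OF continuous_interface]) auto
  have B: "bounded (interface ` {0<..<\<tau>})"
    by (rule bounded_subset[OF compact_imp_bounded[OF compact_continuous_image[OF continuous_interface compact_Icc]]]) auto
  have B12: "bounded ((\<lambda>(t, y). v1 t (- y)) ` ?Q1)" "bounded ((\<lambda>(t, y). v2 t y) ` ?Q2)"
    unfolding bounded_iff using bounded_v by (auto intro!: exI[of _ M])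
  show ?thesis
    unfolding bounded_stefan_solution_def Let_def stefan_equation1_iff stefan_equation2_iff[OF o(2) cG2 cI]
    using T1 T2 C1 B B12 E1 E2 boundary initial f interface_0 Cs pos(5)
    by (auto simp: ds L1 L2 interface_speed_def)
qed

lemma weaken_bound: "M \<le> M' \<Longrightarrow> half_line_stefan \<kappa> K L \<alpha> TM \<tau> M' f1 f2 v1 d1 v2 d2"
  by unfold_locales
    (use pos cont_v cont_d deriv_v boundary initial weak1 weak2 in \<open>auto intro: order_trans[OF bounded_v(1)] order_trans[OF bounded_v(2)]\<close>)

end

text \<open>
A bounded second derivative makes the first derivative Lipschitz, hence uniformly continuous up to \<open>y = 0\<close>.
\<close>

lemma continuous_extension_of_derivative:
  fixes g' g'' :: "real \<Rightarrow> real"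
  assumes D: "\<And>y. y > 0 \<Longrightarrow> (g' has_real_derivative g'' y) (at y)"
    and B: "\<And>y. y > 0 \<Longrightarrow> \<bar>g' y\<bar> \<le> B" "\<And>y. y > 0 \<Longrightarrow> \<bar>g'' y\<bar> \<le> B"
  obtains h where "continuous_on {0..} h" "\<And>y. y > 0 \<Longrightarrow> h y = g' y" "\<And>y. y \<ge> 0 \<Longrightarrow> \<bar>h y\<bar> \<le> B"
proof -
  have "B-lipschitz_on {0<..} g'"
  proof (rule lipschitz_onI)
    show "dist (g' x) (g' y) \<le> B * dist x y" if "x \<in> {0<..}" "y \<in> {0<..}" for x y
      unfolding dist_norm
      by (rule field_differentiable_bound[where S="{0<..}" and f'=g'']) (use D B that in \<open>auto intro: DERIV_subset\<close>)
    show "B \<ge> 0" using B(1)[of 1] by auto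
  qed
  then have "uniformly_continuous_on {0<..} g'" by (rule lipschitz_on_uniformly_continuous)
  then obtain h where h: "uniformly_continuous_on (closure {0<..}) h" "\<And>x. x \<in> {0<..} \<Longrightarrow> g' x = h x"
    using uniformly_continuous_on_extension_on_closure by metis
  have c: "continuous_on {0..} h" using uniformly_continuous_imp_continuous[OF h(1)] by simp
  have "\<bar>h y\<bar> \<le> B" if "y \<ge> 0" for y
  proof -
    have "norm (h y) \<le> B"
      by (rule continuous_on_closure_norm_le[where s="{0<..}"]) (use c h(2) B(1) that in auto)
    then show ?thesis by simp
  qed
  with c h(2) show ?thesis by (intro that[of h]) auto
qed

lemma stefan_data_exists:
  assumes pos: "K > 0" "C > 0" "L > 0" "\<alpha> > 0"
    and lip: "bounded_lipschitz T0" and T00: "T0 0 = TM"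
    and C2: "C_on 2 {..<0} T0" "C_on 2 {0<..} T0"
    and bd: "\<forall>j\<in>{1, 2}. bounded ((deriv ^^ j) T0 ` {..<0}) \<and> bounded ((deriv ^^ j) T0 ` {0<..})"
  obtains A f1' f2' f1'' f2'' where "stefan_data (K / C) K L \<alpha> TM A (\<lambda>y. T0 (- y)) T0 f1' f2' f1'' f2''"
proof -
  obtain Lip where "Lip-lipschitz_on UNIV T0" using lip by (auto simp: bounded_lipschitz_def)
  then have cT: "continuous_on S T0" for S using lipschitz_on_continuous_on continuous_on_subset by blast
  have two: "(deriv ^^ 2) T0 = deriv (deriv T0)" by (simp add: numeral_2_eq_2)
  have dif: "(T0 has_real_derivative deriv T0 y) (at y)" "(deriv T0 has_real_derivative deriv (deriv T0) y) (at y)" if "y \<noteq> 0" for y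
  proof -
    have "(deriv ^^ j) T0 field_differentiable (at y)" if "j < 2" for j
      using C2 \<open>y \<noteq> 0\<close> that unfolding C_on_def by (cases "y < 0") auto
    from this[of 0] this[of 1] show "(T0 has_real_derivative deriv T0 y) (at y)" "(deriv T0 has_real_derivative deriv (deriv T0) y) (at y)"
      by (auto simp: field_differentiable_derivI)
  qed
  have c2: "continuous_on {..<0} (deriv (deriv T0))" "continuous_on {0<..} (deriv (deriv T0))"
    using C2 by (simp_all add: C_on_def two)
  have bdd: "bounded (range T0)" "bounded (deriv T0 ` {..<0})" "bounded (deriv T0 ` {0<..})"
     "bounded (deriv (deriv T0) ` {..<0})" "bounded (deriv (deriv T0) ` {0<..})"
    using lip bd by (auto simp: bounded_lipschitz_def two)
  have "bounded (range T0 \<union> deriv T0 ` {..<0} \<union> deriv T0 ` {0<..} \<union> deriv (deriv T0) ` {..<0} \<union> deriv (deriv T0) ` {0<..})"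
    using bdd by simp
  then obtain A where A: "\<And>x. x \<in> range T0 \<union> deriv T0 ` {..<0} \<union> deriv T0 ` {0<..} \<union> deriv (deriv T0) ` {..<0} \<union> deriv (deriv T0) ` {0<..} \<Longrightarrow> \<bar>x\<bar> \<le> A"
    unfolding bounded_iff real_norm_def by blast
  have A': "\<bar>T0 y\<bar> \<le> A" "y \<noteq> 0 \<Longrightarrow> \<bar>deriv T0 y\<bar> \<le> A" "y \<noteq> 0 \<Longrightarrow> \<bar>deriv (deriv T0) y\<bar> \<le> A" for y
    using A by (auto simp: neq_iff)
  have D1: "((\<lambda>y. T0 (- y)) has_real_derivative - deriv T0 (- y)) (at y)"
    and D2: "((\<lambda>y. - deriv T0 (- y)) has_real_derivative deriv (deriv T0) (- y)) (at y)" if "y > 0" for y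
  proof -
    have m: "(uminus has_real_derivative - 1) (at y)" by (auto intro!: derivative_eq_intros)
    show "((\<lambda>y. T0 (- y)) has_real_derivative - deriv T0 (- y)) (at y)"
      using DERIV_chain2[of T0, OF dif(1)[of "- y"] m] that by simp
    show "((\<lambda>y. - deriv T0 (- y)) has_real_derivative deriv (deriv T0) (- y)) (at y)"
      using DERIV_minus[OF DERIV_chain2[of "deriv T0", OF dif(2)[of "- y"] m]] that by simp
  qed
  obtain h1 where h1: "continuous_on {0..} h1" "\<And>y. y > 0 \<Longrightarrow> h1 y = - deriv T0 (- y)" "\<And>y. y \<ge> 0 \<Longrightarrow> \<bar>h1 y\<bar> \<le> A"
    using continuous_extension_of_derivative[of "\<lambda>y. - deriv T0 (- y)" "\<lambda>y. deriv (deriv T0) (- y)" A] D2 A' by auto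
  obtain h2 where h2: "continuous_on {0..} h2" "\<And>y. y > 0 \<Longrightarrow> h2 y = deriv T0 y" "\<And>y. y \<ge> 0 \<Longrightarrow> \<bar>h2 y\<bar> \<le> A"
    using continuous_extension_of_derivative[of "deriv T0" "deriv (deriv T0)" A] dif(2) A' by auto
  have tr: "(h has_real_derivative b) (at y)" if "(g has_real_derivative b) (at y)" "y > 0" "\<And>y. y > 0 \<Longrightarrow> h y = g y"
    for h g :: "real \<Rightarrow> real" and b y
    by (rule has_field_derivative_transform_within_open[OF that(1), where S="{0<..}"]) (use that in auto)
  have "stefan_data (K / C) K L \<alpha> TM A (\<lambda>y. T0 (- y)) T0 h1 h2 (\<lambda>y. deriv (deriv T0) (- y)) (deriv (deriv T0))"
  proof
    show "continuous_on {0..} (\<lambda>y. T0 (- y))" by (rule continuous_on_compose2[OF cT[of UNIV]]) (auto intro!: continuous_intros)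
    show "continuous_on {0<..} (\<lambda>y. deriv (deriv T0) (- y))" by (rule continuous_on_compose2[OF c2(1)]) (auto intro!: continuous_intros)
    show "((\<lambda>y. T0 (- y)) has_real_derivative h1 y) (at y)" "(T0 has_real_derivative h2 y) (at y)"
      "(h1 has_real_derivative deriv (deriv T0) (- y)) (at y)" "(h2 has_real_derivative deriv (deriv T0) y) (at y)" if "y > 0" for y
      using D1[OF that] dif(1)[of y] h1(2)[OF that] h2(2)[OF that] that tr[OF D2[OF that] that h1(2)] tr[OF dif(2)[of y] that h2(2)] by auto
  qed (use pos T00 A' h1 h2 c2 cT in auto)
  then show ?thesis by (rule that)
qed

theorem theorem2p1:
  fixes K C L \<alpha> TM :: real and T0 :: "real \<Rightarrow> real"
  assumes "K > 0" and "C > 0" and "L > 0" and "\<alpha> > 0" and "TM > 0"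
    and "bounded_lipschitz T0" and "\<forall>y. T0 y > 0"
    and "T0 0 = TM" and "\<forall>y<0. T0 y > TM" and "\<forall>y>0. T0 y < TM"
    and "C_on 2 {..<0} T0" and "C_on 2 {0<..} T0"
    and "\<forall>j\<in>{1, 2}. bounded ((deriv ^^ j) T0 ` {..<0}) \<and> bounded ((deriv ^^ j) T0 ` {0<..})"
  shows "\<exists>\<tau>0>0. \<forall>tstar. 0 < tstar \<and> tstar \<le> \<tau>0 \<longrightarrow>
    (\<exists>T1 T2 s. bounded_stefan_solution K C L \<alpha> TM T0 tstar T1 T2 s \<and>
      (\<forall>T1' T2' s'. bounded_stefan_solution K C L \<alpha> TM T0 tstar T1' T2' s' \<longrightarrow>
        (\<forall>t\<in>{0<..<tstar}. (\<forall>y<0. T1' t y = T1 t y) \<and> (\<forall>y>0. T2' t y = T2 t y) \<and>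
          s' t = s t)))"
proof -
  note pos = assms(1-4)
  obtain Lip where "Lip-lipschitz_on UNIV T0" using assms(6) by (auto simp: bounded_lipschitz_def)
  then have cT: "continuous_on UNIV T0" by (rule lipschitz_on_continuous_on)
  obtain A f1' f2' f1'' f2'' where data: "stefan_data (K / C) K L \<alpha> TM A (\<lambda>y. T0 (- y)) T0 f1' f2' f1'' f2''"
    using stefan_data_exists[OF pos assms(6,8,11,12,13)] by blast
  obtain \<tau>0 where \<tau>0: "\<tau>0 > 0" "\<And>\<tau>. 0 < \<tau> \<Longrightarrow> \<tau> \<le> \<tau>0 \<Longrightarrow>
    \<exists>v1 d1 v2 d2. half_line_stefan (K / C) K L \<alpha> TM \<tau> (A + 1) (\<lambda>y. T0 (- y)) T0 v1 d1 v2 d2 \<and> 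
      (\<forall>t. \<forall>y>0. \<bar>d1 t y\<bar> \<le> A + 1 \<and> \<bar>d2 t y\<bar> \<le> A + 1)"
    using stefan_data.local_existence[OF data] by metis
  have "\<exists>T1 T2 s. bounded_stefan_solution K C L \<alpha> TM T0 \<tau> T1 T2 s \<and>
      (\<forall>T1' T2' s'. bounded_stefan_solution K C L \<alpha> TM T0 \<tau> T1' T2' s' \<longrightarrow>
        (\<forall>t\<in>{0<..<\<tau>}. (\<forall>y<0. T1' t y = T1 t y) \<and> (\<forall>y>0. T2' t y = T2 t y) \<and> s' t = s t))"
    if \<tau>: "0 < \<tau>" "\<tau> \<le> \<tau>0" for \<tau>
  proof -
    obtain v1 d1 v2 d2 where v: "half_line_stefan (K / C) K L \<alpha> TM \<tau> (A + 1) (\<lambda>y. T0 (- y)) T0 v1 d1 v2 d2"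
      and d: "\<And>t y. y > 0 \<Longrightarrow> \<bar>d1 t y\<bar> \<le> A + 1 \<and> \<bar>d2 t y\<bar> \<le> A + 1" using \<tau>0(2)[OF \<tau>] by blast
    interpret V: half_line_stefan "K / C" K L \<alpha> TM \<tau> "A + 1" "\<lambda>y. T0 (- y)" T0 v1 d1 v2 d2 by (rule v)
    have sol: "bounded_stefan_solution K C L \<alpha> TM T0 \<tau> (\<lambda>t y. v1 t (- y)) v2 V.interface"
      by (rule V.stefan_solution) auto
    moreover have "(\<forall>y<0. T1' t y = v1 t (- y)) \<and> (\<forall>y>0. T2' t y = v2 t y) \<and> s' t = V.interface t"
      if sol': "bounded_stefan_solution K C L \<alpha> TM T0 \<tau> T1' T2' s'" and t: "t \<in> {0<..<\<tau>}" for T1' T2' s' t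
    proof -
      obtain M d1' d2' where B: "half_line_stefan (K / C) K L \<alpha> TM \<tau> M (\<lambda>y. T0 (- y)) T0 (\<lambda>t y. T1' t (- y)) d1' T2' d2'"
        and s': "\<And>t. t \<in> {0<..<\<tau>} \<Longrightarrow> (s' has_real_derivative interface_speed K L d1' d2' t) (at t)"
          "continuous_on {0..<\<tau>} s'" "s' 0 = 0"
        using solution_imp_half_line[OF sol' pos \<tau>(1) cT assms(8)] by blast
      interpret U: two_half_line_solutions "K / C" K L \<alpha> TM \<tau> "max M (A + 1)" "\<lambda>y. T0 (- y)" T0 v1 d1 v2 d2
          "\<lambda>t y. T1' t (- y)" d1' T2' d2' "A + 1"
      proof (intro two_half_line_solutions.intro two_half_line_solutions_axioms.intro)
        show "half_line_stefan (K / C) K L \<alpha> TM \<tau> (max M (A + 1)) (\<lambda>y. T0 (- y)) T0 v1 d1 v2 d2"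
          by (rule V.weaken_bound) simp
        show "half_line_stefan (K / C) K L \<alpha> TM \<tau> (max M (A + 1)) (\<lambda>y. T0 (- y)) T0 (\<lambda>t y. T1' t (- y)) d1' T2' d2'"
          by (rule half_line_stefan.weaken_bound[OF B]) simp
      qed (use d in auto)
      have "T1' t y = v1 t (- y)" if "y < 0" for y using U.unique(1)[OF t, of "- y"] that by simp
      moreover have "T2' t y = v2 t y" if "y > 0" for y using U.unique(2)[OF t, of y] that by simp
      moreover have "s' t - V.interface t = s' 0 - V.interface 0"
      proof (rule DERIV_isconst_end[where f="\<lambda>t. s' t - V.interface t"])
        show "continuous_on {0..t} (\<lambda>t. s' t - V.interface t)"
          using t by (intro continuous_on_diff continuous_on_subset[OF s'(2)] continuous_on_subset[OF V.continuous_interface]) auto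
        show "((\<lambda>t. s' t - V.interface t) has_real_derivative 0) (at x)" if "0 < x" "x < t" for x
          using DERIV_diff[OF s'(1)[of x] V.DERIV_interface[of x]] U.unique(3)[of x] that t by auto
      qed (use t in auto)
      ultimately show ?thesis using s'(3) V.interface_0 by auto
    qed
    ultimately show ?thesis by blast
  qed
  with \<tau>0(1) show ?thesis by blast
qed

end
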